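(* Let $d\ge1$, let $\{V(x)\}_{x\in\mathbb{R}}$ be the two-sided semi-selfsimilar Lévy environment with index $\alpha$ under the probability measure $Q$ (as defined in the context), and let $W(x)=\sum_{k=1}^dV(x_k)$ for $x=(x_1,\dots,x_d)\in\mathbb{R}^d$. Suppose that $\alpha\in(1,2)$ and $Q(V(1)<0)>0$. Then $\lambda_{\mathrm{ess}}^W=0$, $Q$-almost surely. In particular, $\{P_t^W\}_{t>0}$ is noncompact on $L^2(\mathbb{R}^d;\mu^W)$, $Q$-almost surely.
   Context: **Semi-selfsimilar Lévy environment.** Let $\mathcal{W}$ be the set of functions $w:\mathbb{R}\to\mathbb{R}$ with $w(0)=0$ that are right continuous with left limits on $[0,\infty)$ and left continuous with right limits on $(-\infty,0]$, with the $\sigma$-field $\mathcal{B}(\mathcal{W})$ generated by the cylindrical sets. For $w\in\mathcal W$ and $x\ge0$ put $V_+(x)(w)=w(x)$ and $V_-(x)(w)=w(-x)$. Let $Q$ be a probability measure on $(\mathcal{W},\mathcal{B}(\mathcal{W}))$ such that $\{V_+(x)\}_{x\ge0}$ is a real-valued Lévy process satisfying: (i) $Q(V_+(0)=0)=1$ and $Q(V_+(x)=0)<1$ for all $x>0$; (ii) its paths are $Q$-a.s. right continuous with left limits; (iii) there exist $c>0$, $c\ne1$, and $\alpha\in(0,2)$ such that $\{V_+(cx)\}_{x\ge0}$ and $\{c^{1/\alpha}V_+(x)\}_{x\ge0}$ have the same finite-dimensional distributions. Let $r_0=\inf\{c>1:\{V_+(cx)\}_{x\ge0}\overset{d}{=}\{c^{1/\alpha}V_+(x)\}_{x\ge0}\}$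 ($\overset{d}{=}$ denotes equality of finite-dimensional distributions). If $r_0=1$ the scaling relation holds for every $c>0$ and the process is called an $\alpha$-stable Lévy process; if $r_0>1$ it holds for $c=r_0^n$, $n\in\mathbb{Z}$, and the process is called an $(r_0,\alpha)$-semi-selfsimilar Lévy process. Suppose also that $\{V_-(x)\}_{x\ge0}$ is, under $Q$, a process of the same kind with the same $\alpha$ and $r_0$, independent of $\{V_+(x)\}_{x\ge0}$. Define $V(x)=V_+(x)$ for $x\ge0$ and $V(x)=V_-(-x)$ for $x<0$. **Dirichlet form, semigroup, essential spectrum.** For a locally bounded measurable function $w:\mathbb{R}^d\to\mathbb{R}$, let $\mu^w(\mathrm{d}x)=e^{-w(x)}\,\mathrm{d}x$ and $\mathcal{E}^w(u,v)=\frac12\int_{\mathbb{R}^d}\nabla u\cdot\nabla v\,e^{-w}\,\mathrm{d}x$. The form $(\mathcal{E}^w,C_c^\infty(\mathbb{R}^d))$ is closable on $L^2(\mathbb{R}^d;\mu^w)$; let $(\mathcal{E}^w,\mathcal{F}^w)$ be its closure with respect to the norm $(\mathcal{E}^w(u,u)+\|u\|_{L^2(\mathbb{R}^d;\mu^w)}^2)^{1/2}$, which is a regular Dirichlet form. Let $L^w$ be the associated non-positive definite self-adjoint operator, i.e. its domain $D(L^w)\subset\mathcal{F}^w$ and $\mathcal{E}^w(u,v)=\langle -L^wu,v\rangle_{L^2(\mathbb{R}^d;\mu^w)}$ for $u\in D(L^w)$, $v\in\mathcal{F}^w$ (formally $L^w=\frac12(\Delta-\nabla w\cdot\nabla)$).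 Let $\{P_t^w\}_{t>0}$ be the Markovian semigroup on $L^2(\mathbb{R}^d;\mu^w)$ generated by $L^w$, let $\sigma_{\mathrm{ess}}(-L^w)$ be the essential spectrum of $-L^w$, and $\lambda_{\mathrm{ess}}^w=\inf\sigma_{\mathrm{ess}}(-L^w)$, with $\inf\emptyset=\infty$. The semigroup is compact if and only if $\sigma_{\mathrm{ess}}(-L^w)=\emptyset$, i.e. $\lambda_{\mathrm{ess}}^w=\infty$; otherwise it is noncompact. For a random field $W$, these objects are defined realization by realization. *)

theory Defs
  imports "HOL-Probability.Probability"
begin

section \<open>Semi-selfsimilar Levy environments\<close>

definition cadlag :: "(real \<Rightarrow> real) \<Rightarrow> bool" where
  "cadlag f \<longleftrightarrow>
     (\<forall>x\<ge>0. continuous (at_right x) f) \<and> (\<forall>x>0. \<exists>l. (f \<longlongrightarrow> l) (at_left x))"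

definition path_space :: "(real \<Rightarrow> real) set" where
  "path_space = {w. w 0 = 0 \<and>
     (\<forall>x\<ge>0. continuous (at_right x) w) \<and> (\<forall>x>0. \<exists>l. (w \<longlongrightarrow> l) (at_left x)) \<and>
     (\<forall>x\<le>0. continuous (at_left x) w) \<and> (\<forall>x<0. \<exists>l. (w \<longlongrightarrow> l) (at_right x))}"

text \<open>The trace on the path space of the product sigma-field, i.e. the sigma-field generated by
  the cylindrical sets.\<close>

definition path_algebra :: "(real \<Rightarrow> real) measure" where
  "path_algebra = restrict_space (PiM UNIV (\<lambda>_. borel)) path_space"

definition V_plus :: "real \<Rightarrow> (real \<Rightarrow> real) \<Rightarrow> real" where
  "V_plus x w = w x"

definition V_minus :: "real \<Rightarrow> (real \<Rightarrow> real) \<Rightarrow> real" where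
  "V_minus x w = w (- x)"

definition V_env :: "real \<Rightarrow> (real \<Rightarrow> real) \<Rightarrow> real" where
  "V_env x w = (if x \<ge> 0 then V_plus x w else V_minus (- x) w)"

text \<open>Processes are indexed by all of \<^typ>\<open>real\<close>, but only their values at nonnegative
  times matter below.\<close>

definition levy_process :: "'a measure \<Rightarrow> (real \<Rightarrow> 'a \<Rightarrow> real) \<Rightarrow> bool" where
  "levy_process M X \<longleftrightarrow>
     prob_space M \<and>
     (\<forall>t\<ge>0. X t \<in> borel_measurable M) \<and>
     (AE \<omega> in M. X 0 \<omega> = 0) \<and>
     (\<forall>(n::nat) t. 0 \<le> t 0 \<and> (\<forall>i<n. t i < t (Suc i)) \<longrightarrow>
        prob_space.indep_vars M (\<lambda>_. borel) (\<lambda>i \<omega>. X (t (Suc i)) \<omega> - X (t i) \<omega>) {..<n}) \<and>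
     (\<forall>s\<ge>0. \<forall>t\<ge>0. distr M borel (\<lambda>\<omega>. X (s + t) \<omega> - X s \<omega>)
                 = distr M borel (\<lambda>\<omega>. X t \<omega> - X 0 \<omega>)) \<and>
     (\<forall>t\<ge>0. \<forall>e>0. ((\<lambda>s. measure M {\<omega> \<in> space M. \<bar>X s \<omega> - X t \<omega>\<bar> > e}) \<longlongrightarrow> 0)
                    (at t within {0..})) \<and>
     (AE \<omega> in M. cadlag (\<lambda>t. X t \<omega>))"

definition same_fdd :: "'a measure \<Rightarrow> (real \<Rightarrow> 'a \<Rightarrow> real) \<Rightarrow> (real \<Rightarrow> 'a \<Rightarrow> real) \<Rightarrow> bool" where
  "same_fdd M X Y \<longleftrightarrow>
     (\<forall>J. finite J \<and> J \<subseteq> {0..} \<longrightarrow>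
        distr M (PiM J (\<lambda>_. borel)) (\<lambda>\<omega>. \<lambda>x\<in>J. X x \<omega>)
      = distr M (PiM J (\<lambda>_. borel)) (\<lambda>\<omega>. \<lambda>x\<in>J. Y x \<omega>))"

definition scales :: "'a measure \<Rightarrow> (real \<Rightarrow> 'a \<Rightarrow> real) \<Rightarrow> real \<Rightarrow> real \<Rightarrow> bool" where
  "scales M X \<alpha> c \<longleftrightarrow>
     same_fdd M (\<lambda>x. X (c * x)) (\<lambda>x \<omega>. c powr (1 / \<alpha>) * X x \<omega>)"

definition scaling_ratio :: "'a measure \<Rightarrow> (real \<Rightarrow> 'a \<Rightarrow> real) \<Rightarrow> real \<Rightarrow> real" where
  "scaling_ratio M X \<alpha> = Inf {c. c > 1 \<and> scales M X \<alpha> c}"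

definition semi_selfsimilar_levy :: "'a measure \<Rightarrow> (real \<Rightarrow> 'a \<Rightarrow> real) \<Rightarrow> real \<Rightarrow> bool" where
  "semi_selfsimilar_levy M X \<alpha> \<longleftrightarrow>
     levy_process M X \<and>
     measure M {\<omega> \<in> space M. X 0 \<omega> = 0} = 1 \<and>
     (\<forall>x>0. measure M {\<omega> \<in> space M. X x \<omega> = 0} < 1) \<and>
     0 < \<alpha> \<and> \<alpha> < 2 \<and>
     (\<exists>c>0. c \<noteq> 1 \<and> scales M X \<alpha> c)"

definition levy_environment :: "(real \<Rightarrow> real) measure \<Rightarrow> real \<Rightarrow> bool" where
  "levy_environment Q \<alpha> \<longleftrightarrow>
     prob_space Q \<and> space Q = space path_algebra \<and> sets Q = sets path_algebra \<and>
     semi_selfsimilar_levy Q V_plus \<alpha> \<and>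
     semi_selfsimilar_levy Q V_minus \<alpha> \<and>
     scaling_ratio Q V_plus \<alpha> = scaling_ratio Q V_minus \<alpha> \<and>
     prob_space.indep_var Q
       (PiM {0..} (\<lambda>_. borel)) (\<lambda>w. \<lambda>x\<in>{0..}. V_plus x w)
       (PiM {0..} (\<lambda>_. borel)) (\<lambda>w. \<lambda>x\<in>{0..}. V_minus x w)"

definition W_env :: "(real \<Rightarrow> real) \<Rightarrow> real ^ 'n \<Rightarrow> real" where
  "W_env w x = (\<Sum>k\<in>UNIV. V_env (x $ k) w)"


section \<open>Operators on L2 spaces\<close>

text \<open>Elements of \<open>L\<^sup>2(M)\<close> are represented by square integrable functions, and equality in
  \<open>L\<^sup>2(M)\<close> by equality almost everywhere. An unbounded operator is represented by its graph, a set
  of pairs of such functions.\<close>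

definition l2 :: "'a measure \<Rightarrow> ('a \<Rightarrow> real) set" where
  "l2 M = {u \<in> borel_measurable M. integrable M (\<lambda>x. (u x)\<^sup>2)}"

definition l2_inner :: "'a measure \<Rightarrow> ('a \<Rightarrow> real) \<Rightarrow> ('a \<Rightarrow> real) \<Rightarrow> real" where
  "l2_inner M u v = (\<integral>x. u x * v x \<partial>M)"

definition l2_norm :: "'a measure \<Rightarrow> ('a \<Rightarrow> real) \<Rightarrow> real" where
  "l2_norm M u = sqrt (l2_inner M u u)"

type_synonym 'a l2_graph = "(('a \<Rightarrow> real) \<times> ('a \<Rightarrow> real)) set"

definition neg_graph :: "'a l2_graph \<Rightarrow> 'a l2_graph" where
  "neg_graph A = {(u, \<lambda>x. - f x) | u f. (u, f) \<in> A}"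

text \<open>\<open>A - z\<close> is onto, and one-to-one with bounded inverse. Real scalars suffice: the spectrum of
  a self-adjoint operator is real, and it is the same as that of the complexified operator.\<close>

definition resolvent_set :: "'a measure \<Rightarrow> 'a l2_graph \<Rightarrow> real set" where
  "resolvent_set M A = {z.
     (\<forall>f\<in>l2 M. \<exists>u g. (u, g) \<in> A \<and> (AE x in M. g x - z * u x = f x)) \<and>
     (\<exists>C. \<forall>(u, g)\<in>A. l2_norm M u \<le> C * l2_norm M (\<lambda>x. g x - z * u x))}"

definition spectrum :: "'a measure \<Rightarrow> 'a l2_graph \<Rightarrow> real set" where
  "spectrum M A = - resolvent_set M A"

definition eigenspace :: "'a measure \<Rightarrow> 'a l2_graph \<Rightarrow> real \<Rightarrow> ('a \<Rightarrow> real) set" where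
  "eigenspace M A z = {u. \<exists>g. (u, g) \<in> A \<and> (AE x in M. g x = z * u x)}"

definition finite_dim :: "'a measure \<Rightarrow> ('a \<Rightarrow> real) set \<Rightarrow> bool" where
  "finite_dim M S \<longleftrightarrow>
     (\<exists>B\<subseteq>S. finite B \<and> (\<forall>u\<in>S. \<exists>c. AE x in M. u x = (\<Sum>b\<in>B. c b * b x)))"

definition discrete_spectrum :: "'a measure \<Rightarrow> 'a l2_graph \<Rightarrow> real set" where
  "discrete_spectrum M A = {z. z isolated_in spectrum M A \<and>
     (\<exists>u\<in>eigenspace M A z. l2_norm M u \<noteq> 0) \<and> finite_dim M (eigenspace M A z)}"

definition ess_spectrum :: "'a measure \<Rightarrow> 'a l2_graph \<Rightarrow> real set" where
  "ess_spectrum M A = spectrum M A - discrete_spectrum M A"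

definition compact_operator :: "'a measure \<Rightarrow> (('a \<Rightarrow> real) \<Rightarrow> ('a \<Rightarrow> real)) \<Rightarrow> bool" where
  "compact_operator M T \<longleftrightarrow>
     (\<forall>u :: nat \<Rightarrow> 'a \<Rightarrow> real. (\<forall>n. u n \<in> l2 M) \<and> (\<exists>C. \<forall>n. l2_norm M (u n) \<le> C) \<longrightarrow>
        (\<exists>r g. strict_mono r \<and> g \<in> l2 M \<and>
           (\<lambda>n. l2_norm M (\<lambda>x. T (u (r n)) x - g x)) \<longlonglongrightarrow> 0))"

definition bounded_operator :: "'a measure \<Rightarrow> (('a \<Rightarrow> real) \<Rightarrow> ('a \<Rightarrow> real)) \<Rightarrow> bool" where
  "bounded_operator M T \<longleftrightarrow>
     (\<forall>u\<in>l2 M. T u \<in> l2 M) \<and>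
     (\<forall>u\<in>l2 M. \<forall>v\<in>l2 M. \<forall>a b.
        AE x in M. T (\<lambda>y. a * u y + b * v y) x = a * T u x + b * T v x) \<and>
     (\<exists>C. \<forall>u\<in>l2 M. l2_norm M (T u) \<le> C * l2_norm M u)"

text \<open>\<open>(P\<^sub>t)\<close>, \<open>t > 0\<close>, is a strongly continuous semigroup of bounded operators with
  infinitesimal generator \<open>A\<close>. This determines each \<open>P\<^sub>t\<close> up to null sets.\<close>

definition semigroup_generated_by ::
    "'a measure \<Rightarrow> 'a l2_graph \<Rightarrow> (real \<Rightarrow> ('a \<Rightarrow> real) \<Rightarrow> ('a \<Rightarrow> real)) \<Rightarrow> bool" where
  "semigroup_generated_by M A P \<longleftrightarrow>
     (\<forall>t>0. bounded_operator M (P t)) \<and>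
     (\<forall>s>0. \<forall>t>0. \<forall>u\<in>l2 M. AE x in M. P (s + t) u x = P s (P t u) x) \<and>
     (\<forall>u\<in>l2 M. ((\<lambda>t. l2_norm M (\<lambda>x. P t u x - u x)) \<longlongrightarrow> 0) (at_right 0)) \<and>
     (\<forall>u\<in>l2 M. \<forall>f\<in>l2 M. (u, f) \<in> A \<longleftrightarrow>
        ((\<lambda>t. l2_norm M (\<lambda>x. (P t u x - u x) / t - f x)) \<longlongrightarrow> 0) (at_right 0))"

definition compact_semigroup ::
    "'a measure \<Rightarrow> (real \<Rightarrow> ('a \<Rightarrow> real) \<Rightarrow> ('a \<Rightarrow> real)) \<Rightarrow> bool" where
  "compact_semigroup M P \<longleftrightarrow> (\<forall>t>0. compact_operator M (P t))"


section \<open>The Dirichlet form and its generator\<close>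

definition weighted_measure :: "(real ^ 'n \<Rightarrow> real) \<Rightarrow> (real ^ 'n) measure" where
  "weighted_measure w = density lborel (\<lambda>x. ennreal (exp (- w x)))"

definition partial_deriv :: "'n \<Rightarrow> (real ^ 'n \<Rightarrow> real) \<Rightarrow> real ^ 'n \<Rightarrow> real" where
  "partial_deriv k u x = frechet_derivative u (at x) (axis k 1)"

definition grad :: "(real ^ 'n \<Rightarrow> real) \<Rightarrow> real ^ 'n \<Rightarrow> real ^ 'n" where
  "grad u x = (\<chi> k. partial_deriv k u x)"

text \<open>Smooth: all iterated partial derivatives are totally differentiable (hence continuous).\<close>

definition test_functions :: "(real ^ 'n \<Rightarrow> real) set" where
  "test_functions = {u.
     (\<forall>ks. fold partial_deriv ks u differentiable_on UNIV) \<and> compact (closure {x. u x \<noteq> 0})}"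

definition pre_form ::
    "(real ^ 'n \<Rightarrow> real) \<Rightarrow> (real ^ 'n \<Rightarrow> real) \<Rightarrow> (real ^ 'n \<Rightarrow> real) \<Rightarrow> real" where
  "pre_form w u v = 1 / 2 * (\<integral>x. (grad u x \<bullet> grad v x) * exp (- w x) \<partial>lborel)"

definition form_approx ::
    "(real ^ 'n \<Rightarrow> real) \<Rightarrow> (nat \<Rightarrow> real ^ 'n \<Rightarrow> real) \<Rightarrow> (real ^ 'n \<Rightarrow> real) \<Rightarrow> bool" where
  "form_approx w \<phi> u \<longleftrightarrow>
     (\<forall>n. \<phi> n \<in> test_functions) \<and>
     u \<in> l2 (weighted_measure w) \<and> (\<lambda>n. l2_norm (weighted_measure w) (\<lambda>x. \<phi> n x - u x)) \<longlonglongrightarrow> 0 \<and>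
     (\<forall>e>0. \<exists>N. \<forall>m\<ge>N. \<forall>n\<ge>N.
        pre_form w (\<lambda>x. \<phi> m x - \<phi> n x) (\<lambda>x. \<phi> m x - \<phi> n x) < e)"

definition form_domain :: "(real ^ 'n \<Rightarrow> real) \<Rightarrow> (real ^ 'n \<Rightarrow> real) set" where
  "form_domain w = {u. \<exists>\<phi>. form_approx w \<phi> u}"

text \<open>The extension of \<^const>\<open>pre_form\<close> to its closure; the limit does not depend on the
  approximating sequences because \<^const>\<open>pre_form\<close> is closable (for locally bounded
  measurable \<open>w\<close>).\<close>

definition dirichlet_form ::
    "(real ^ 'n \<Rightarrow> real) \<Rightarrow> (real ^ 'n \<Rightarrow> real) \<Rightarrow> (real ^ 'n \<Rightarrow> real) \<Rightarrow> real" where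
  "dirichlet_form w u v =
     (THE l. \<forall>\<phi> \<psi>. form_approx w \<phi> u \<and> form_approx w \<psi> v \<longrightarrow>
        (\<lambda>n. pre_form w (\<phi> n) (\<psi> n)) \<longlonglongrightarrow> l)"

definition dirichlet_generator :: "(real ^ 'n \<Rightarrow> real) \<Rightarrow> (real ^ 'n) l2_graph" where
  "dirichlet_generator w = {(u, f). u \<in> form_domain w \<and> f \<in> l2 (weighted_measure w) \<and>
     (\<forall>v\<in>form_domain w. dirichlet_form w u v = l2_inner (weighted_measure w) (\<lambda>x. - f x) v)}"

text \<open>In \<^typ>\<open>ereal\<close> the infimum of the empty set is \<open>\<infinity>\<close>.\<close>

definition lambda_ess :: "(real ^ 'n \<Rightarrow> real) \<Rightarrow> ereal" where
  "lambda_ess w = Inf (ereal ` ess_spectrum (weighted_measure w) (neg_graph (dirichlet_generator w)))"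

end

theory Submission
  imports Defs "HOL-Library.Function_Algebras"
begin

text \<open>For \<open>x \<ge> 0\<close> the environment grows sublinearly along a sequence of scales. If \<open>b > 1\<close> is a
  factor of the scaling relation, the supremum of \<open>\<bar>V\<bar>\<close> over \<open>[0, b\<^sup>n]\<close> has the law of \<open>b^(n / \<alpha>)\<close>
  times the supremum over \<open>[0, 1]\<close>, and \<open>\<alpha> > 1\<close> makes this \<open>o(b\<^sup>n)\<close> in probability. So almost
  surely, for every \<open>\<epsilon> > 0\<close>, \<open>\<bar>V\<bar> \<le> \<epsilon> b\<^sup>n\<close> on \<open>[0, b\<^sup>n]\<close> for infinitely many \<open>n\<close>
  (\<open>sublinear_paths\<close>).

  Consequently the masses that \<open>exp (- V)\<close> gives to consecutive intervals of a fixed length \<open>h\<close>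
  can neither grow nor decay exponentially, and arbitrarily far out there is an interval whose two
  neighbours together weigh at most three times as much (\<open>no_exponential_dichotomy\<close>). A smooth
  bump on these three intervals has a Rayleigh quotient of order \<open>1 / h\<^sup>2\<close> (\<open>low_energy_bump\<close>).
  Since \<open>W\<close> is a sum over the coordinates, products of such bumps have explicit norm and energy,
  and bumps with disjoint supports give an orthonormal sequence \<open>u\<^sub>n\<close> of test functions whose
  energies tend to 0 (\<open>low_energy_sequence\<close>).

  Such a sequence puts 0 into the essential spectrum of the operator \<open>A = - L\<close> of the closed form.
  Let \<open>K = (1 + A)\<^sup>-\<^sup>1\<close>. Small energy means that \<open>K u\<^sub>n - u\<^sub>n \<rightarrow> 0\<close>, so \<open>A\<close> has no bounded inverse.
  Suppose that 0 is an isolated point of the spectrum and that the kernel of \<open>A\<close> has finite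
  dimension. A gap above 0 gives \<open>B\<^sup>2 \<ge> \<eta> B\<close> for \<open>B = 1 - K\<close> (\<open>gap_square\<close>), hence \<open>B\<^sup>3 \<ge> \<eta> B\<^sup>2\<close>
  (\<open>gap_range\<close>). This says that \<open>K\<close> is a strict contraction on the range of \<open>B\<close>, so that the
  iterates of \<open>K\<close> carry \<open>u\<^sub>n\<close> into the kernel and move it by at most a multiple of \<open>\<parallel>B u\<^sub>n\<parallel>\<close>
  (\<open>near_kernel\<close>). But an orthonormal sequence cannot approach a space of finite dimension. As the
  spectrum is nonnegative, the infimum of the essential spectrum is 0.

  For the semigroup, \<open>K u\<^sub>n\<close> lies in the domain of the generator and \<open>A K u\<^sub>n \<rightarrow> 0\<close>. The operators
  \<open>P\<^sub>t\<close> are uniformly bounded for small \<open>t\<close>, so \<open>P\<^sub>t K u\<^sub>n - K u\<^sub>n \<rightarrow> 0\<close> and \<open>P\<^sub>t u\<^sub>n - u\<^sub>n \<rightarrow> 0\<close>.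
  Hence \<open>P\<^sub>t u\<^sub>n\<close> has no convergent subsequence (\<open>semigroup_not_compact\<close>).

  All this is Hilbert space theory, carried out for a closable form on a semi-inner product space.
  It applies to the Dirichlet form because the weight is locally bounded: an \<open>L\<^sup>2\<close> limit of the
  gradients of a null sequence is orthogonal to all test functions by partial integration, so its
  integral over every box vanishes (\<open>weak_gradient_of_null\<close>).\<close>

section \<open>Semi-inner product spaces and spectral gaps\<close>

text \<open>The inner product may be degenerate and the carrier is a subspace of a larger vector space,
  so that square integrable functions can be used without passing to classes modulo null sets.
  Equality in the Hilbert space is \<open>nrm (x - y) = 0\<close>.\<close>

locale semi_inner =
  fixes S :: "'v::real_vector set" and ip :: "'v \<Rightarrow> 'v \<Rightarrow> real"
  assumes subspace: "subspace S"
    and ip_add: "\<lbrakk>x \<in> S; y \<in> S; z \<in> S\<rbrakk> \<Longrightarrow> ip (x + y) z = ip x z + ip y z"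
    and ip_scale: "\<lbrakk>x \<in> S; y \<in> S\<rbrakk> \<Longrightarrow> ip (c *\<^sub>R x) y = c * ip x y"
    and ip_sym: "\<lbrakk>x \<in> S; y \<in> S\<rbrakk> \<Longrightarrow> ip x y = ip y x"
    and ip_nonneg: "x \<in> S \<Longrightarrow> 0 \<le> ip x x"
begin

definition nrm :: "'v \<Rightarrow> real" where
  "nrm x = sqrt (ip x x)"

lemma add_mem [simp, intro]: "\<lbrakk>x \<in> S; y \<in> S\<rbrakk> \<Longrightarrow> x + y \<in> S"
  and diff_mem [simp, intro]: "\<lbrakk>x \<in> S; y \<in> S\<rbrakk> \<Longrightarrow> x - y \<in> S"
  and scale_mem [simp, intro]: "x \<in> S \<Longrightarrow> c *\<^sub>R x \<in> S"
  and zero_mem [simp, intro]: "0 \<in> S"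
  using subspace by (auto intro: subspace_add subspace_diff subspace_scale subspace_0)

lemma minus_mem [simp, intro]: "x \<in> S \<Longrightarrow> - x \<in> S"
  using subspace by (rule subspace_neg)

lemma sum_mem [simp, intro]: "(\<And>i. i \<in> I \<Longrightarrow> f i \<in> S) \<Longrightarrow> (\<Sum>i\<in>I. f i) \<in> S"
  using subspace by (auto intro: subspace_sum)

lemma ip_add_right: "\<lbrakk>x \<in> S; y \<in> S; z \<in> S\<rbrakk> \<Longrightarrow> ip x (y + z) = ip x y + ip x z"
  by (metis add_mem ip_add ip_sym)

lemma ip_scale_right: "\<lbrakk>x \<in> S; y \<in> S\<rbrakk> \<Longrightarrow> ip x (c *\<^sub>R y) = c * ip x y"
  by (metis scale_mem ip_scale ip_sym)

lemma ip_diff: "\<lbrakk>x \<in> S; y \<in> S; z \<in> S\<rbrakk> \<Longrightarrow> ip (x - y) z = ip x z - ip y z"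
  using ip_add[of x "(-1) *\<^sub>R y" z] ip_scale[of y z "-1"] by simp

lemma ip_diff_right: "\<lbrakk>x \<in> S; y \<in> S; z \<in> S\<rbrakk> \<Longrightarrow> ip x (y - z) = ip x y - ip x z"
  by (metis diff_mem ip_diff ip_sym)

lemma ip_zero [simp]: "x \<in> S \<Longrightarrow> ip 0 x = 0"
  using ip_scale[of 0 x 0] by simp

lemma ip_zero_right [simp]: "x \<in> S \<Longrightarrow> ip x 0 = 0"
  using ip_scale_right[of x 0 0] by simp

lemma ip_sum: "\<lbrakk>finite I; \<And>i. i \<in> I \<Longrightarrow> f i \<in> S; y \<in> S\<rbrakk> \<Longrightarrow> ip (\<Sum>i\<in>I. f i) y = (\<Sum>i\<in>I. ip (f i) y)"
  by (induction I rule: finite_induct) (auto simp: ip_add)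

lemmas ip_simps = ip_add ip_add_right ip_diff ip_diff_right ip_scale ip_scale_right

lemma nrm_nonneg [simp]: "x \<in> S \<Longrightarrow> 0 \<le> nrm x"
  by (simp add: nrm_def ip_nonneg)

lemma nrm_sq: "x \<in> S \<Longrightarrow> (nrm x)\<^sup>2 = ip x x"
  by (simp add: nrm_def ip_nonneg)

lemma nrm_zero [simp]: "nrm 0 = 0"
  by (simp add: nrm_def)

lemma nrm_scale: "x \<in> S \<Longrightarrow> nrm (c *\<^sub>R x) = \<bar>c\<bar> * nrm x"
  by (simp add: nrm_def ip_scale ip_scale_right real_sqrt_mult mult.assoc[symmetric])

lemma ip_square_le:
  assumes x: "x \<in> S" and y: "y \<in> S"
  shows "(ip x y)\<^sup>2 \<le> ip x x * ip y y"
proof (cases "ip y y = 0")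
  case True
  have *: "0 \<le> ip x x + 2 * t * ip x y" for t
    using ip_nonneg[of "x + t *\<^sub>R y"] x y True
    by (simp add: ip_simps ip_sym[OF y x] algebra_simps)
  have "ip x y = 0"
  proof (rule ccontr)
    assume "ip x y \<noteq> 0"
    then have "ip x x + 2 * (- (ip x x + 1) / ip x y) * ip x y = - ip x x - 2" by simp
    then show False using *[of "- (ip x x + 1) / ip x y"] ip_nonneg[OF x] by simp
  qed
  then show ?thesis using True by simp
next
  case False
  then have pos: "ip y y > 0" using ip_nonneg[OF y] by simp
  have "0 \<le> ip (ip y y *\<^sub>R x - ip x y *\<^sub>R y) (ip y y *\<^sub>R x - ip x y *\<^sub>R y)"
    using x y by (intro ip_nonneg) auto
  also have "\<dots> = ip y y * (ip x x * ip y y - (ip x y)\<^sup>2)"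
    using x y by (simp add: ip_simps ip_sym[OF y x] algebra_simps power2_eq_square)
  finally show ?thesis using pos by (simp add: zero_le_mult_iff)
qed

lemma ip_abs_le:
  assumes "x \<in> S" "y \<in> S"
  shows "\<bar>ip x y\<bar> \<le> nrm x * nrm y"
  using ip_square_le[OF assms] unfolding nrm_def
  by (metis real_sqrt_abs real_sqrt_le_iff real_sqrt_mult)

lemma ip_le: "\<lbrakk>x \<in> S; y \<in> S\<rbrakk> \<Longrightarrow> ip x y \<le> nrm x * nrm y"
  using ip_abs_le[of x y] by simp

lemma nrm_add: assumes "x \<in> S" "y \<in> S" shows "nrm (x + y) \<le> nrm x + nrm y"
proof (rule power2_le_imp_le)
  show "(nrm (x + y))\<^sup>2 \<le> (nrm x + nrm y)\<^sup>2"
    using assms ip_le[OF assms] ip_sym[OF assms]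
    by (simp add: nrm_sq ip_simps power2_sum)
qed (use assms in simp)

lemma nrm_diff: assumes "x \<in> S" "y \<in> S" shows "nrm (x - y) \<le> nrm x + nrm y"
  using nrm_add[of x "- y"] nrm_scale[of y "-1"] assms by simp

lemma nrm_commute: assumes "x \<in> S" "y \<in> S" shows "nrm (x - y) = nrm (y - x)"
  using nrm_scale[of "x - y" "-1"] assms by simp

lemma nrm_triangle: assumes "x \<in> S" "y \<in> S" "z \<in> S" shows "nrm (x - z) \<le> nrm (x - y) + nrm (y - z)"
  using nrm_add[of "x - y" "y - z"] assms by simp

lemma nrm_triangle2: assumes "x \<in> S" "y \<in> S" shows "nrm x \<le> nrm y + nrm (x - y)"
  using nrm_add[of y "x - y"] assms by simp

lemma nrm_eqI:
  assumes "x \<in> S" "y \<in> S" "nrm (x - y) = 0" shows "nrm x = nrm y"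
  using nrm_triangle2[of x y] nrm_triangle2[of y x] nrm_commute[of x y] assms by simp

lemma null_of_orthogonal: assumes "x \<in> S" "\<And>y. y \<in> S \<Longrightarrow> ip x y = 0" shows "nrm x = 0"
  using assms by (simp add: nrm_def)

lemma nrm_sum: "\<lbrakk>finite I; \<And>i. i \<in> I \<Longrightarrow> f i \<in> S\<rbrakk> \<Longrightarrow> nrm (\<Sum>i\<in>I. f i) \<le> (\<Sum>i\<in>I. nrm (f i))"
proof (induction I rule: finite_induct)
  case (insert i I)
  then show ?case using nrm_add[of "f i" "\<Sum>i\<in>I. f i"] by simp
qed simp

lemma tendsto_ip:
  assumes x: "(\<And>n. x n \<in> S)" "a \<in> S" "(\<lambda>n. nrm (x n - a)) \<longlonglongrightarrow> 0"
    and y: "(\<And>n. y n \<in> S)" "b \<in> S" "(\<lambda>n. nrm (y n - b)) \<longlonglongrightarrow> 0"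
  shows "(\<lambda>n. ip (x n) (y n)) \<longlonglongrightarrow> ip a b"
proof -
  have "(\<lambda>n. ip (x n) (y n) - ip a b) \<longlonglongrightarrow> 0"
  proof (rule Lim_null_comparison)
    show "(\<lambda>n. nrm (x n - a) * (nrm b + nrm (y n - b)) + nrm a * nrm (y n - b)) \<longlonglongrightarrow> 0"
      by (rule tendsto_eq_intros x y refl | simp)+
    show "\<forall>\<^sub>F n in sequentially. norm (ip (x n) (y n) - ip a b)
        \<le> nrm (x n - a) * (nrm b + nrm (y n - b)) + nrm a * nrm (y n - b)"
    proof (intro always_eventually allI)
      fix n
      have "ip (x n) (y n) - ip a b = ip (x n - a) (y n) + ip a (y n - b)"
        using x y by (simp add: ip_simps)
      moreover have "\<bar>ip (x n - a) (y n)\<bar> \<le> nrm (x n - a) * nrm (y n)"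
        using x y by (intro ip_abs_le) auto
      moreover have "\<dots> \<le> nrm (x n - a) * (nrm b + nrm (y n - b))"
        using x y by (intro mult_left_mono nrm_triangle2) auto
      moreover have "\<bar>ip a (y n - b)\<bar> \<le> nrm a * nrm (y n - b)"
        using x y by (intro ip_abs_le) auto
      ultimately show "norm (ip (x n) (y n) - ip a b)
        \<le> nrm (x n - a) * (nrm b + nrm (y n - b)) + nrm a * nrm (y n - b)"
        by simp
    qed
  qed
  then show ?thesis by (simp add: LIM_zero_iff)
qed

text \<open>Symmetry alone forces linearity, up to null vectors: test against an arbitrary vector and
  move \<open>B\<close> to the other side.\<close>

lemma symmetric_linear:
  assumes "\<And>x. x \<in> S \<Longrightarrow> B x \<in> S"
    and "\<And>x y. x \<in> S \<Longrightarrow> y \<in> S \<Longrightarrow> ip (B x) y = ip x (B y)"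
    and "x \<in> S" "y \<in> S"
  shows "nrm (B (a *\<^sub>R x + b *\<^sub>R y) - (a *\<^sub>R B x + b *\<^sub>R B y)) = 0"
  by (rule null_of_orthogonal) (use assms in \<open>auto simp: ip_simps\<close>)

text \<open>The inequality \<open>(B - c)\<^sup>2 \<ge> c\<^sup>2\<close> with \<open>c = \<eta> / 2\<close>, multiplied out. It is what the spectral
  theorem gives if \<open>B\<close> has no spectrum in \<open>(0, \<eta>)\<close>. The elementary reason is that the best lower
  bound \<open>d\<close> of \<open>B - c\<close> is attained spectrally: \<open>c + d\<close> or \<open>c - d\<close> is an approximate eigenvalue,
  and \<open>d < c\<close> would put both into the gap.\<close>

lemma gap_square:
  fixes B :: "'v \<Rightarrow> 'v"
  assumes B: "\<And>x. x \<in> S \<Longrightarrow> B x \<in> S"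
    and sym: "\<And>x y. x \<in> S \<Longrightarrow> y \<in> S \<Longrightarrow> ip (B x) y = ip x (B y)"
    and contr: "\<And>x. x \<in> S \<Longrightarrow> nrm (B x) \<le> nrm x"
    and "0 < \<eta>"
    and below: "\<And>\<kappa>. 0 < \<kappa> \<Longrightarrow> \<kappa> < \<eta> \<Longrightarrow> \<exists>k>0. \<forall>x\<in>S. k * nrm x \<le> nrm (B x - \<kappa> *\<^sub>R x)"
    and x: "x \<in> S"
  shows "\<eta> * ip (B x) x \<le> ip (B x) (B x)"
proof -
  define c where "c = \<eta> / 2"
  have c: "0 < c" using \<open>0 < \<eta>\<close> by (simp add: c_def)
  define q where "q y = ip (B y) (B y) - 2 * c * ip (B y) y + c\<^sup>2 * ip y y" for y
  have q_eq: "q y = (nrm (B y - c *\<^sub>R y))\<^sup>2" if "y \<in> S" for y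
    using that B sym[OF that that]
    by (simp only: q_def nrm_sq diff_mem scale_mem)
       (simp add: ip_simps power2_eq_square algebra_simps)
  define D where "D = {q y / ip y y | y. y \<in> S \<and> 0 < ip y y}"
  have D_nonneg: "0 \<le> r" if "r \<in> D" for r
    using that q_eq by (auto simp: D_def)
  then have bdd: "bdd_below D" by (rule bdd_belowI)
  have "c\<^sup>2 * ip x x \<le> q x"
  proof (rule ccontr)
    assume neg: "\<not> ?thesis"
    have "ip x x \<noteq> 0"
    proof
      assume "ip x x = 0"
      then show False using neg q_eq[OF x] by simp
    qed
    then have xpos: "0 < ip x x" using ip_nonneg[OF x] by simp
    then have xD: "q x / ip x x \<in> D" using x by (auto simp: D_def)
    \<comment> \<open>\<open>d\<close> is the best constant in \<open>d \<parallel>y\<parallel> \<le> \<parallel>B y - c y\<parallel>\<close>.\<close>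
    define d where "d = sqrt (Inf D)"
    have Inf_nonneg: "0 \<le> Inf D" using xD D_nonneg by (intro cInf_greatest) auto
    then have d2: "d\<^sup>2 = Inf D" and d0: "0 \<le> d" by (simp_all add: d_def)
    have "Inf D \<le> q x / ip x x" using xD bdd by (rule cInf_lower)
    also have "\<dots> < c\<^sup>2" using neg xpos by (simp add: field_simps)
    finally have dc: "d < c" using d2 c power_less_imp_less_base[of d 2 c] by simp
    have d_le: "d\<^sup>2 * ip y y \<le> q y" if "y \<in> S" for y
    proof (cases "ip y y = 0")
      case True
      then show ?thesis using q_eq[OF that] by simp
    next
      case False
      then have "0 < ip y y" using ip_nonneg[OF that] by simp
      moreover from this that have "Inf D \<le> q y / ip y y"
        by (intro cInf_lower bdd) (auto simp: D_def)
      ultimately show ?thesis by (simp add: d2 field_simps)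
    qed
    define G where "G y = B (B y) - (2 * c) *\<^sub>R B y + (c\<^sup>2 - d\<^sup>2) *\<^sub>R y" for y
    have G: "G y \<in> S" if "y \<in> S" for y
      using that B by (simp add: G_def)
    have G_sym: "ip (G y) z = ip y (G z)" if "y \<in> S" "z \<in> S" for y z
      using that B by (simp add: G_def ip_simps sym)
    have G_diag: "ip y (G y) = q y - d\<^sup>2 * ip y y" if "y \<in> S" for y
      using that B sym by (simp add: G_def q_def ip_simps algebra_simps)
    \<comment> \<open>\<open>G\<close> is \<open>(B - c)\<^sup>2 - d\<^sup>2 = (B - (c + d)) (B - (c - d))\<close>, which is positive by the choice of
      \<open>d\<close>. The Cauchy-Schwarz inequality of its form bounds \<open>\<parallel>G y\<parallel>\<close> by the form, so a positive
      lower bound of \<open>G\<close> would allow a larger \<open>d\<close>.\<close>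
    interpret g: semi_inner S "\<lambda>y z. ip y (G z)"
    proof
      show "0 \<le> ip y (G y)" if "y \<in> S" for y
        using G_diag[OF that] d_le[OF that] by simp
      show "ip y (G z) = ip z (G y)" if "y \<in> S" "z \<in> S" for y z
        using G_sym[OF that] ip_sym[of z "G y"] that G by simp
    qed (use subspace G in \<open>auto simp: ip_simps\<close>)
    define M where "M = (1 + c)\<^sup>2"
    have M: "M > 0" using c by (simp add: M_def)
    have q_le: "q y \<le> M * ip y y" if "y \<in> S" for y
    proof -
      have "nrm (B y - c *\<^sub>R y) \<le> nrm (B y) + nrm (c *\<^sub>R y)"
        using that B by (intro nrm_diff) auto
      also have "\<dots> \<le> (1 + c) * nrm y"
        using contr[OF that] c that by (simp add: nrm_scale algebra_simps)
      finally have "(nrm (B y - c *\<^sub>R y))\<^sup>2 \<le> ((1 + c) * nrm y)\<^sup>2"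
        using that B by (intro power_mono) auto
      then show ?thesis by (simp add: q_eq that M_def power_mult_distrib nrm_sq)
    qed
    have G_le: "ip (G y) (G y) \<le> M * (q y - d\<^sup>2 * ip y y)" if y: "y \<in> S" for y
    proof (cases "ip (G y) (G y) = 0")
      case True
      then show ?thesis using d_le[OF y] M by simp
    next
      case False
      then have pos: "0 < ip (G y) (G y)" using ip_nonneg[OF G[OF y]] by simp
      have "(ip (G y) (G y))\<^sup>2 \<le> ip (G y) (G (G y)) * ip y (G y)"
        using g.ip_square_le[of "G y" y] G y by simp
      also have "\<dots> \<le> (M * ip (G y) (G y)) * ip y (G y)"
      proof (rule mult_right_mono)
        have "0 \<le> d\<^sup>2 * ip (G y) (G y)" using pos by simp
        then show "ip (G y) (G (G y)) \<le> M * ip (G y) (G y)"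
          using q_le[OF G[OF y]] G_diag[OF G[OF y]] by linarith
      qed (use g.ip_nonneg y in auto)
      finally show ?thesis using pos G_diag[OF y]
        by (simp add: power2_eq_square mult.assoc mult.left_commute)
    qed
    obtain k1 where k1: "k1 > 0" "\<And>y. y \<in> S \<Longrightarrow> k1 * nrm y \<le> nrm (B y - (c + d) *\<^sub>R y)"
      using below[of "c + d"] c d0 dc by (auto simp: c_def)
    obtain k2 where k2: "k2 > 0" "\<And>y. y \<in> S \<Longrightarrow> k2 * nrm y \<le> nrm (B y - (c - d) *\<^sub>R y)"
      using below[of "c - d"] c d0 dc by (auto simp: c_def)
    define k where "k = (k1 * k2)\<^sup>2 / M"
    have k: "k > 0" using k1 k2 M by (simp add: k_def)
    have "(d\<^sup>2 + k) * ip y y \<le> q y" if y: "y \<in> S" for y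
    proof -
      define z where "z = B y - (c - d) *\<^sub>R y"
      have z: "z \<in> S" using y B by (simp add: z_def)
      have "nrm (B z - (c + d) *\<^sub>R z) = nrm (G y)"
      proof (rule nrm_eqI)
        have "nrm (B (1 *\<^sub>R B y + (d - c) *\<^sub>R y) - (1 *\<^sub>R B (B y) + (d - c) *\<^sub>R B y)) = 0"
          by (rule symmetric_linear) (use B sym y in auto)
        moreover have "(B z - (c + d) *\<^sub>R z) - G y
            = B (1 *\<^sub>R B y + (d - c) *\<^sub>R y) - (1 *\<^sub>R B (B y) + (d - c) *\<^sub>R B y)"
          by (simp add: z_def G_def algebra_simps power2_eq_square)
             (simp flip: scaleR_add_left add: algebra_simps)
        ultimately show "nrm ((B z - (c + d) *\<^sub>R z) - G y) = 0" by simp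
      qed (use y z B G in auto)
      have "k1 * (k2 * nrm y) \<le> k1 * nrm z"
        using k2(2)[OF y] k1(1) by (simp add: z_def)
      also have "\<dots> \<le> nrm (G y)"
        using k1(2)[OF z] \<open>nrm (B z - (c + d) *\<^sub>R z) = nrm (G y)\<close> by simp
      finally have "(k1 * k2 * nrm y)\<^sup>2 \<le> (nrm (G y))\<^sup>2"
        using k1 k2 y by (intro power_mono) (auto simp: mult.assoc)
      then have "(k1 * k2)\<^sup>2 * ip y y \<le> M * (q y - d\<^sup>2 * ip y y)"
        using G_le[OF y] G[OF y] y by (simp add: power_mult_distrib nrm_sq)
      then show ?thesis using M by (simp add: k_def field_simps)
    qed
    then have "d\<^sup>2 + k \<le> r" if "r \<in> D" for r
      using that by (auto simp: D_def field_simps)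
    then have "d\<^sup>2 + k \<le> Inf D" using xD by (intro cInf_greatest) auto
    then show False using d2 k by simp
  qed
  then show ?thesis using sym[OF x x] by (simp add: q_def c_def)
qed

text \<open>In terms of a spectral value \<open>t\<close>, the claim \<open>t\<^sup>2 (t - \<eta>) \<ge> 0\<close> follows from \<open>t \<ge> 0\<close> and
  \<open>t (t - \<eta>) \<ge> 0\<close> by the identity \<open>t\<^sup>2 (t - \<eta>) / \<eta>\<^sup>2 = t (1 - t / \<eta>)\<^sup>2 + t (t - \<eta>) / \<eta>\<close>, whose
  terms are meaningful without a functional calculus.\<close>

lemma gap_range:
  assumes B: "\<And>x. x \<in> S \<Longrightarrow> B x \<in> S"
    and sym: "\<And>x y. x \<in> S \<Longrightarrow> y \<in> S \<Longrightarrow> ip (B x) y = ip x (B y)"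
    and pos: "\<And>x. x \<in> S \<Longrightarrow> 0 \<le> ip (B x) x"
    and "0 < \<eta>"
    and gap: "\<And>x. x \<in> S \<Longrightarrow> \<eta> * ip (B x) x \<le> ip (B x) (B x)"
    and x: "x \<in> S"
  shows "\<eta> * ip (B x) (B x) \<le> ip (B (B x)) (B x)"
proof -
  define y where "y = x - (1 / \<eta>) *\<^sub>R B x"
  have y: "y \<in> S" using x B by (simp add: y_def)
  have "ip (B y) y = ip (B x) x - 2 / \<eta> * ip (B x) (B x) + (1 / \<eta>)\<^sup>2 * ip (B (B x)) (B x)"
  proof -
    have "ip (B y) y = ip (B y) x - (1 / \<eta>) * ip (B y) (B x)"
      using x y B by (simp add: y_def ip_simps)
    also have "ip (B y) x = ip y (B x)" using x y by (simp add: sym)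
    also have "ip (B y) (B x) = ip y (B (B x))" using x y B by (simp add: sym)
    finally show ?thesis using x B sym[of x "B x"] sym[of "x" x] sym[of "B x" "B x"]
      by (simp add: y_def ip_simps power2_eq_square algebra_simps)
  qed
  then have "0 \<le> \<eta>\<^sup>2 * (ip (B x) x - 2 / \<eta> * ip (B x) (B x) + (1 / \<eta>)\<^sup>2 * ip (B (B x)) (B x))"
    using pos[OF y] by simp
  also have "\<dots> = \<eta> * (\<eta> * ip (B x) x - ip (B x) (B x)) - \<eta> * ip (B x) (B x) + ip (B (B x)) (B x)"
    using \<open>0 < \<eta>\<close> by (simp add: field_simps power2_eq_square)
  also have "\<dots> \<le> - \<eta> * ip (B x) (B x) + ip (B (B x)) (B x)"
    using gap[OF x] \<open>0 < \<eta>\<close> by (simp add: mult_le_0_iff)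
  finally show ?thesis by simp
qed

end

section \<open>Linear relations\<close>

text \<open>Gaussian elimination, one equation at a time.\<close>

lemma nontrivial_relation:
  fixes c :: "'i \<Rightarrow> 'b \<Rightarrow> real"
  assumes "finite B" "finite I" "card B < card I"
  shows "\<exists>a. (\<exists>i\<in>I. a i \<noteq> 0) \<and> (\<forall>b\<in>B. (\<Sum>i\<in>I. a i * c i b) = 0)"
  using assms
proof (induction B arbitrary: I c rule: finite_induct)
  case empty
  then obtain i where "i \<in> I" by fastforce
  then show ?case by (intro exI[of _ "\<lambda>_. 1"]) auto
next
  case (insert b B)
  show ?case
  proof (cases "\<forall>i\<in>I. c i b = 0")
    case True
    from insert.prems insert.hyps have "card B < card I" by simp
    then obtain a where "\<exists>i\<in>I. a i \<noteq> 0" "\<forall>b\<in>B. (\<Sum>i\<in>I. a i * c i b) = 0"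
      using insert.IH[OF insert.prems(1)] by blast
    with True show ?thesis by (intro exI[of _ a]) simp
  next
    case False
    then obtain j where j: "j \<in> I" "c j b \<noteq> 0" by auto
    \<comment> \<open>Eliminate the unknown \<open>j\<close> by means of the equation \<open>b\<close>.\<close>
    define I' where "I' = I - {j}"
    have I': "finite I'" "card B < card I'" and I_eq: "I = insert j I'" and "j \<notin> I'"
      using insert.prems insert.hyps j by (auto simp: I'_def)
    obtain a where a: "\<exists>i\<in>I'. a i \<noteq> 0"
      and a0: "\<And>b'. b' \<in> B \<Longrightarrow> (\<Sum>i\<in>I'. a i * (c i b' - c i b / c j b * c j b')) = 0"
      using insert.IH[OF I'(1,2), of "\<lambda>i b'. c i b' - c i b / c j b * c j b'"] by blast
    define a' where "a' = a(j := - (\<Sum>i\<in>I'. a i * c i b) / c j b)"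
    have sum: "(\<Sum>i\<in>I. a' i * c i b') = - (\<Sum>i\<in>I'. a i * c i b) / c j b * c j b' + (\<Sum>i\<in>I'. a i * c i b')" for b'
    proof -
      have "(\<Sum>i\<in>I'. a' i * c i b') = (\<Sum>i\<in>I'. a i * c i b')"
        by (rule sum.cong) (use \<open>j \<notin> I'\<close> in \<open>auto simp: a'_def\<close>)
      then show ?thesis using I'(1) \<open>j \<notin> I'\<close> unfolding I_eq by (simp add: a'_def)
    qed
    have "(\<Sum>i\<in>I. a' i * c i b') = 0" if "b' \<in> insert b B" for b'
    proof (cases "b' = b")
      case True
      then show ?thesis using sum[of b] j by simp
    next
      case False
      have "(\<Sum>i\<in>I'. a i * (c i b' - c i b / c j b * c j b'))
          = (\<Sum>i\<in>I'. a i * c i b') - (\<Sum>i\<in>I'. a i * c i b) / c j b * c j b'"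
        by (simp add: right_diff_distrib sum_subtractf sum_distrib_right sum_divide_distrib mult.assoc)
      then show ?thesis using that False a0[of b'] sum[of b'] by simp
    qed
    moreover have "\<exists>i\<in>I. a' i \<noteq> 0" using a \<open>j \<notin> I'\<close> unfolding I_eq a'_def by (metis fun_upd_other insertCI)
    ultimately show ?thesis by blast
  qed
qed

section \<open>Completeness and uniform boundedness\<close>

locale semi_hilbert = semi_inner +
  assumes complete: "\<lbrakk>\<And>n. x n \<in> S; \<And>\<epsilon>. \<epsilon> > 0 \<Longrightarrow> \<exists>N. \<forall>m\<ge>N. \<forall>n\<ge>N. nrm (x m - x n) < \<epsilon>\<rbrakk>
      \<Longrightarrow> \<exists>a\<in>S. (\<lambda>n. nrm (x n - a)) \<longlonglongrightarrow> 0"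
begin

text \<open>The principle of uniform boundedness for seminorms. If the bound fails, some \<open>p i\<close> is large
  at a point of any given ball, hence by continuity on a whole smaller ball. The common point of a
  nested sequence of such balls contradicts pointwise boundedness.\<close>

lemma uniform_bound:
  fixes p :: "nat \<Rightarrow> 'a \<Rightarrow> real"
  assumes add: "\<And>n x y. \<lbrakk>x \<in> S; y \<in> S\<rbrakk> \<Longrightarrow> p n (x + y) \<le> p n x + p n y"
    and scale: "\<And>n c x. x \<in> S \<Longrightarrow> p n (c *\<^sub>R x) = \<bar>c\<bar> * p n x"
    and bounded: "\<And>n. \<exists>C. \<forall>x\<in>S. p n x \<le> C * nrm x"
    and pointwise: "\<And>x. x \<in> S \<Longrightarrow> \<exists>M. \<forall>n. p n x \<le> M"
  shows "\<exists>M. \<forall>n. \<forall>x\<in>S. p n x \<le> M * nrm x"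
proof (rule ccontr)
  assume "\<not> ?thesis"
  then have unbounded: "\<exists>n. \<exists>x\<in>S. M * nrm x < p n x" for M
    by (meson not_le)
  have step: "\<exists>x' r'. x' \<in> S \<and> 0 < r' \<and> r' \<le> r / 2 \<and> nrm (x' - x) + r' \<le> r \<and>
      (\<exists>i. \<forall>y\<in>S. nrm (y - x') \<le> r' \<longrightarrow> real k \<le> p i y)"
    if x: "x \<in> S" and r: "0 < r" for x r k
  proof -
    obtain i z where z: "z \<in> S" "2 * (real k + 1) / r * nrm z < p i z"
      using unbounded by blast
    obtain C0 where C0: "\<forall>x\<in>S. p i x \<le> C0 * nrm x" using bounded by blast
    define C where "C = max C0 1"
    have C: "C \<ge> 1" "\<And>x. x \<in> S \<Longrightarrow> p i x \<le> C * nrm x"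
    proof -
      fix x assume "x \<in> S"
      then have "p i x \<le> C0 * nrm x" using C0 by blast
      also have "\<dots> \<le> C * nrm x" using \<open>x \<in> S\<close> by (intro mult_right_mono) (auto simp: C_def)
      finally show "p i x \<le> C * nrm x" .
    qed (simp add: C_def)
    have "nrm z \<noteq> 0" using z C(2)[of z] by auto
    then have zpos: "nrm z > 0" using nrm_nonneg[OF z(1)] by linarith
    \<comment> \<open>As \<open>2 h = (x + h) - (x - h)\<close>, one of \<open>x + h\<close> and \<open>x - h\<close> makes \<open>p i\<close> as large as at \<open>h\<close>.\<close>
    define h where "h = (r / (2 * nrm z)) *\<^sub>R z"
    have h: "h \<in> S" "nrm h = r / 2" using z zpos r by (auto simp: h_def nrm_scale)
    have "real k + 1 = r / (2 * nrm z) * (2 * (real k + 1) / r * nrm z)"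
      using r zpos by (simp add: field_simps)
    also have "\<dots> < r / (2 * nrm z) * p i z"
      using z(2) r zpos by (intro mult_strict_left_mono) auto
    also have "\<dots> = p i h" using z r zpos by (simp add: h_def scale)
    finally have ph: "real k + 1 < p i h" .
    have "2 * p i h = p i ((x + h) + (-1) *\<^sub>R (x - h))"
      using h scale[of h i 2] by (simp add: scaleR_2)
    also have "\<dots> \<le> p i (x + h) + p i (x - h)"
      using add[of "x + h" "(-1) *\<^sub>R (x - h)" i] scale[of "x - h" i "-1"] x h by simp
    finally have "real k + 1 < p i (x + h) \<or> real k + 1 < p i (x - h)" using ph by linarith
    moreover have "nrm ((x + h) - x) = r / 2" "nrm ((x - h) - x) = r / 2"
      using h nrm_scale[of h "-1"] by simp_all
    ultimately obtain x' where x': "x' \<in> S" "nrm (x' - x) = r / 2" "real k + 1 < p i x'"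
      using x h(1) by (metis add_mem diff_mem)
    define r' where "r' = min (r / 2) (1 / C)"
    have "real k \<le> p i y" if "y \<in> S" "nrm (y - x') \<le> r'" for y
    proof -
      have "p i x' \<le> p i y + p i (x' - y)" using add[of y "x' - y" i] that x' by simp
      also have "p i (x' - y) \<le> C * nrm (x' - y)" using C that x' by simp
      also have "\<dots> \<le> C * (1 / C)"
        using that x' C nrm_commute[of x' y] by (intro mult_left_mono) (auto simp: r'_def)
      finally show ?thesis using x' C by simp
    qed
    then show ?thesis using x' r C by (intro exI[of _ x'] exI[of _ r']) (auto simp: r'_def)
  qed
  have "\<exists>f. \<forall>k. (fst (f k) \<in> S \<and> 0 < snd (f k) \<and> snd (f k) \<le> (1 / 2) ^ k) \<and>
      (snd (f (Suc k)) \<le> snd (f k) / 2 \<and> nrm (fst (f (Suc k)) - fst (f k)) + snd (f (Suc k)) \<le> snd (f k) \<and>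
      (\<exists>i. \<forall>y\<in>S. nrm (y - fst (f (Suc k))) \<le> snd (f (Suc k)) \<longrightarrow> real k \<le> p i y))"
  proof (rule dependent_nat_choice)
    show "\<exists>f :: 'a \<times> real. fst f \<in> S \<and> 0 < snd f \<and> snd f \<le> (1 / 2) ^ 0"
      by (intro exI[of _ "(0, 1)"]) auto
    fix f :: "'a \<times> real" and k :: nat
    assume f: "fst f \<in> S \<and> 0 < snd f \<and> snd f \<le> (1 / 2) ^ k"
    then obtain x' r' where *: "x' \<in> S \<and> 0 < r' \<and> r' \<le> snd f / 2 \<and> nrm (x' - fst f) + r' \<le> snd f \<and>
      (\<exists>i. \<forall>y\<in>S. nrm (y - x') \<le> r' \<longrightarrow> real k \<le> p i y)"
      using step[of "fst f" "snd f" k] by blast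
    then have "r' \<le> (1 / 2) ^ Suc k" using f by simp
    with * show "\<exists>g. (fst g \<in> S \<and> 0 < snd g \<and> snd g \<le> (1 / 2) ^ Suc k) \<and>
        (snd g \<le> snd f / 2 \<and> nrm (fst g - fst f) + snd g \<le> snd f \<and>
        (\<exists>i. \<forall>y\<in>S. nrm (y - fst g) \<le> snd g \<longrightarrow> real k \<le> p i y))"
      by (intro exI[of _ "(x', r')"]) auto
  qed
  then obtain f where f: "\<And>k. fst (f k) \<in> S" "\<And>k. 0 < snd (f k)" "\<And>k. snd (f k) \<le> (1 / 2) ^ k"
    "\<And>k. nrm (fst (f (Suc k)) - fst (f k)) + snd (f (Suc k)) \<le> snd (f k)"
    "\<And>k. \<exists>i. \<forall>y\<in>S. nrm (y - fst (f (Suc k))) \<le> snd (f (Suc k)) \<longrightarrow> real k \<le> p i y"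
    by blast
  define x where "x k = fst (f k)" for k
  define r where "r k = snd (f k)" for k
  have x: "x k \<in> S" and r: "0 < r k" "r k \<le> (1 / 2) ^ k" for k
    using f by (auto simp: x_def r_def)
  have nested: "nrm (x (k + j) - x k) + r (k + j) \<le> r k" for k j
  proof (induction j)
    case (Suc j)
    have "nrm (x (k + Suc j) - x k) \<le> nrm (x (k + Suc j) - x (k + j)) + nrm (x (k + j) - x k)"
      using x by (intro nrm_triangle) auto
    then show ?case using f(4)[of "k + j"] Suc by (simp add: x_def r_def)
  qed (use x in simp)
  have close: "nrm (x m - x k) \<le> (1 / 2) ^ k" if "k \<le> m" for k m
  proof -
    have "nrm (x m - x k) + r m \<le> r k" using nested[of k "m - k"] that by simp
    then show ?thesis using r[of m] r[of k] by linarith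
  qed
  have "\<exists>a\<in>S. (\<lambda>n. nrm (x n - a)) \<longlonglongrightarrow> 0"
  proof (rule complete)
    fix \<epsilon> :: real assume "\<epsilon> > 0"
    then obtain N where N: "(1 / 2) ^ N < \<epsilon> / 2"
      using real_arch_pow_inv[of "\<epsilon> / 2" "1 / 2"] by auto
    have "nrm (x m - x n) < \<epsilon>" if "m \<ge> N" "n \<ge> N" for m n
    proof -
      have "nrm (x m - x n) \<le> nrm (x m - x N) + nrm (x N - x n)"
        using x by (intro nrm_triangle) auto
      then show ?thesis using close[OF that(1)] close[OF that(2)] N nrm_commute[OF x x, of N n]
        by linarith
    qed
    then show "\<exists>N. \<forall>m\<ge>N. \<forall>n\<ge>N. nrm (x m - x n) < \<epsilon>" by blast
  qed (rule x)
  then obtain a where a: "a \<in> S" "(\<lambda>n. nrm (x n - a)) \<longlonglongrightarrow> 0" by blast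
  have a_close: "nrm (a - x k) \<le> r k" for k
  proof (rule field_le_epsilon)
    fix \<epsilon> :: real assume "\<epsilon> > 0"
    then obtain N where N: "\<And>n. n \<ge> N \<Longrightarrow> nrm (x n - a) < \<epsilon>"
      using order_tendstoD(2)[OF a(2)] by (auto simp: eventually_sequentially)
    have "nrm (a - x k) \<le> nrm (a - x (k + N)) + nrm (x (k + N) - x k)"
      using x a by (intro nrm_triangle) auto
    then show "nrm (a - x k) \<le> r k + \<epsilon>"
      using N[of "k + N"] nested[of k N] r(1)[of "k + N"] nrm_commute[OF a(1) x, of "k + N"] by simp
  qed
  obtain M where M: "\<And>n. p n a \<le> M" using pointwise[OF a(1)] by blast
  obtain k :: nat where "M < real k" using reals_Archimedean2 by blast
  moreover obtain i where "\<forall>y\<in>S. nrm (y - x (Suc k)) \<le> r (Suc k) \<longrightarrow> real k \<le> p i y"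
    using f(5)[of k] by (auto simp: x_def r_def)
  ultimately show False using a_close[of "Suc k"] a(1) M[of i] by fastforce
qed

end

section \<open>Closable forms and their resolvents\<close>

text \<open>The form \<open>e\<close> is given on a space \<open>T\<close> of nice vectors, like a Dirichlet form on test
  functions. The constants \<open>approx\<close>, \<open>dom\<close>, \<open>E\<close> and \<open>gen\<close> are its closure and the nonnegative
  operator that represents the closure, written in the way in which they are defined for the
  Dirichlet form.\<close>

locale closable_form = semi_hilbert H ip + form: semi_inner T e
  for H :: "'v::real_vector set" and ip and T :: "'v set" and e +
  assumes T_subset: "T \<subseteq> H"
    and closable: "\<lbrakk>\<And>n. \<rho> n \<in> T; (\<lambda>n. nrm (\<rho> n)) \<longlonglongrightarrow> 0;
        \<And>\<epsilon>. \<epsilon> > 0 \<Longrightarrow> \<exists>N. \<forall>m\<ge>N. \<forall>n\<ge>N. e (\<rho> m - \<rho> n) (\<rho> m - \<rho> n) < \<epsilon>\<rbrakk>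
      \<Longrightarrow> (\<lambda>n. e (\<rho> n) (\<rho> n)) \<longlonglongrightarrow> 0"
begin

lemma T_mem [simp]: "x \<in> T \<Longrightarrow> x \<in> H"
  using T_subset by blast

definition approx :: "(nat \<Rightarrow> 'v) \<Rightarrow> 'v \<Rightarrow> bool" where
  "approx \<phi> u \<longleftrightarrow> (\<forall>n. \<phi> n \<in> T) \<and> u \<in> H \<and> (\<lambda>n. nrm (\<phi> n - u)) \<longlonglongrightarrow> 0 \<and>
     (\<forall>\<epsilon>>0. \<exists>N. \<forall>m\<ge>N. \<forall>n\<ge>N. e (\<phi> m - \<phi> n) (\<phi> m - \<phi> n) < \<epsilon>)"

definition dom :: "'v set" where
  "dom = {u. \<exists>\<phi>. approx \<phi> u}"

definition E :: "'v \<Rightarrow> 'v \<Rightarrow> real" where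
  "E u v = (THE l. \<forall>\<phi> \<psi>. approx \<phi> u \<and> approx \<psi> v \<longrightarrow> (\<lambda>n. e (\<phi> n) (\<psi> n)) \<longlonglongrightarrow> l)"

definition gen :: "('v \<times> 'v) set" where
  "gen = {(u, g). u \<in> dom \<and> g \<in> H \<and> (\<forall>v\<in>dom. E u v = ip g v)}"

lemma approxD:
  assumes "approx \<phi> u"
  shows "\<phi> n \<in> T" "\<phi> n \<in> H" "u \<in> H" "(\<lambda>n. nrm (\<phi> n - u)) \<longlonglongrightarrow> 0"
  using assms by (auto simp: approx_def)

lemma approx_Cauchy:
  assumes "approx \<phi> u" "\<epsilon> > 0"
  shows "\<exists>N. \<forall>m\<ge>N. \<forall>n\<ge>N. form.nrm (\<phi> m - \<phi> n) < \<epsilon>"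
proof -
  obtain N where "\<forall>m\<ge>N. \<forall>n\<ge>N. e (\<phi> m - \<phi> n) (\<phi> m - \<phi> n) < \<epsilon>\<^sup>2"
    using assms unfolding approx_def by (meson zero_less_power)
  then have "\<forall>m\<ge>N. \<forall>n\<ge>N. form.nrm (\<phi> m - \<phi> n) < \<epsilon>"
    using assms(2) by (auto simp: form.nrm_def intro: real_less_lsqrt)
  then show ?thesis ..
qed

lemma approxI:
  assumes "\<And>n. \<phi> n \<in> T" "u \<in> H" "(\<lambda>n. nrm (\<phi> n - u)) \<longlonglongrightarrow> 0"
    and "\<And>\<epsilon>. \<epsilon> > 0 \<Longrightarrow> \<exists>N. \<forall>m\<ge>N. \<forall>n\<ge>N. form.nrm (\<phi> m - \<phi> n) < \<epsilon>"
  shows "approx \<phi> u"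
  unfolding approx_def
proof (intro conjI allI impI)
  fix \<epsilon> :: real assume "\<epsilon> > 0"
  then obtain N where N: "\<And>m n. m \<ge> N \<Longrightarrow> n \<ge> N \<Longrightarrow> form.nrm (\<phi> m - \<phi> n) < sqrt \<epsilon>"
    using assms(4)[of "sqrt \<epsilon>"] by auto
  then have "\<forall>m\<ge>N. \<forall>n\<ge>N. e (\<phi> m - \<phi> n) (\<phi> m - \<phi> n) < \<epsilon>"
    by (simp add: form.nrm_def)
  then show "\<exists>N. \<forall>m\<ge>N. \<forall>n\<ge>N. e (\<phi> m - \<phi> n) (\<phi> m - \<phi> n) < \<epsilon>" by blast
qed (use assms in auto)

lemma approx_bounded:
  assumes "approx \<phi> u"
  shows "\<exists>C. \<forall>n. form.nrm (\<phi> n) \<le> C"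
proof -
  obtain N where N: "\<And>m n. m \<ge> N \<Longrightarrow> n \<ge> N \<Longrightarrow> form.nrm (\<phi> m - \<phi> n) < 1"
    using approx_Cauchy[OF assms, of 1] by auto
  note \<phi> = approxD(1)[OF assms]
  have "form.nrm (\<phi> n) \<le> 1 + (\<Sum>i\<le>N. form.nrm (\<phi> i))" for n
  proof (cases "n \<le> N")
    case True
    then have "form.nrm (\<phi> n) \<le> (\<Sum>i\<le>N. form.nrm (\<phi> i))"
      using \<phi> by (intro member_le_sum) auto
    then show ?thesis by simp
  next
    case False
    have "form.nrm (\<phi> N) \<le> (\<Sum>i\<le>N. form.nrm (\<phi> i))"
      using \<phi> by (intro member_le_sum) auto
    then show ?thesis using form.nrm_triangle2[OF \<phi> \<phi>, of n N] N[of n N] False by simp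
  qed
  then show ?thesis by blast
qed

lemma approx_const: "u \<in> T \<Longrightarrow> approx (\<lambda>_. u) u"
  by (rule approxI) auto

lemma approx_lin:
  assumes "approx \<phi> u" "approx \<psi> v"
  shows "approx (\<lambda>n. a *\<^sub>R \<phi> n + b *\<^sub>R \<psi> n) (a *\<^sub>R u + b *\<^sub>R v)"
proof (rule approxI)
  note D = approxD[OF assms(1)] approxD[OF assms(2)]
  show "(\<lambda>n. nrm (a *\<^sub>R \<phi> n + b *\<^sub>R \<psi> n - (a *\<^sub>R u + b *\<^sub>R v))) \<longlonglongrightarrow> 0"
  proof (rule Lim_null_comparison)
    show "(\<lambda>n. \<bar>a\<bar> * nrm (\<phi> n - u) + \<bar>b\<bar> * nrm (\<psi> n - v)) \<longlonglongrightarrow> 0"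
      by (rule tendsto_eq_intros D refl | simp)+
    have "a *\<^sub>R \<phi> n + b *\<^sub>R \<psi> n - (a *\<^sub>R u + b *\<^sub>R v) = a *\<^sub>R (\<phi> n - u) + b *\<^sub>R (\<psi> n - v)" for n
      by (simp add: algebra_simps)
    then have "nrm (a *\<^sub>R \<phi> n + b *\<^sub>R \<psi> n - (a *\<^sub>R u + b *\<^sub>R v))
        \<le> \<bar>a\<bar> * nrm (\<phi> n - u) + \<bar>b\<bar> * nrm (\<psi> n - v)" for n
      using D nrm_add[of "a *\<^sub>R (\<phi> n - u)" "b *\<^sub>R (\<psi> n - v)"] by (simp add: nrm_scale)
    then show "\<forall>\<^sub>F n in sequentially. norm (nrm (a *\<^sub>R \<phi> n + b *\<^sub>R \<psi> n - (a *\<^sub>R u + b *\<^sub>R v)))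
        \<le> \<bar>a\<bar> * nrm (\<phi> n - u) + \<bar>b\<bar> * nrm (\<psi> n - v)"
      using D by (intro always_eventually) simp
  qed
  fix \<epsilon> :: real assume "\<epsilon> > 0"
  define \<delta> where "\<delta> = \<epsilon> / (\<bar>a\<bar> + \<bar>b\<bar> + 1)"
  have \<delta>: "\<delta> > 0" using \<open>\<epsilon> > 0\<close> by (simp add: \<delta>_def add_nonneg_pos)
  obtain M where M: "\<And>m n. m \<ge> M \<Longrightarrow> n \<ge> M \<Longrightarrow> form.nrm (\<phi> m - \<phi> n) < \<delta>"
    using approx_Cauchy[OF assms(1) \<delta>] by auto
  obtain N where N: "\<And>m n. m \<ge> N \<Longrightarrow> n \<ge> N \<Longrightarrow> form.nrm (\<psi> m - \<psi> n) < \<delta>"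
    using approx_Cauchy[OF assms(2) \<delta>] by auto
  have "form.nrm (a *\<^sub>R \<phi> m + b *\<^sub>R \<psi> m - (a *\<^sub>R \<phi> n + b *\<^sub>R \<psi> n)) < \<epsilon>"
    if "m \<ge> max M N" "n \<ge> max M N" for m n
  proof -
    have eq: "a *\<^sub>R \<phi> m + b *\<^sub>R \<psi> m - (a *\<^sub>R \<phi> n + b *\<^sub>R \<psi> n) = a *\<^sub>R (\<phi> m - \<phi> n) + b *\<^sub>R (\<psi> m - \<psi> n)"
      by (simp add: algebra_simps)
    have "form.nrm (a *\<^sub>R (\<phi> m - \<phi> n) + b *\<^sub>R (\<psi> m - \<psi> n))
        \<le> \<bar>a\<bar> * form.nrm (\<phi> m - \<phi> n) + \<bar>b\<bar> * form.nrm (\<psi> m - \<psi> n)"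
      using D form.nrm_add[of "a *\<^sub>R (\<phi> m - \<phi> n)" "b *\<^sub>R (\<psi> m - \<psi> n)"]
      by (simp add: form.nrm_scale)
    also have "\<dots> \<le> \<bar>a\<bar> * \<delta> + \<bar>b\<bar> * \<delta>"
      using M[of m n] N[of m n] that by (intro add_mono mult_left_mono) auto
    also have "\<dots> < (\<bar>a\<bar> + \<bar>b\<bar> + 1) * \<delta>" using \<delta> by (simp add: algebra_simps)
    also have "\<dots> = \<epsilon>" by (simp add: \<delta>_def)
    finally show ?thesis by (simp only: eq)
  qed
  then show "\<exists>N. \<forall>m\<ge>N. \<forall>n\<ge>N. form.nrm (a *\<^sub>R \<phi> m + b *\<^sub>R \<psi> m - (a *\<^sub>R \<phi> n + b *\<^sub>R \<psi> n)) < \<epsilon>"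
    by blast
qed (use approxD[OF assms(1)] approxD[OF assms(2)] in auto)

lemma dom_subspace: "subspace dom"
  unfolding subspace_def
proof (intro conjI ballI allI)
  show "0 \<in> dom" unfolding dom_def using approx_const[of 0] by auto
  show "x + y \<in> dom" if "x \<in> dom" "y \<in> dom" for x y
    using that approx_lin[of _ x _ y 1 1] unfolding dom_def by auto
  show "c *\<^sub>R x \<in> dom" if "x \<in> dom" for c x
    using that approx_lin[of _ x _ x c 0] unfolding dom_def by auto
qed

lemma T_dom [simp]: "u \<in> T \<Longrightarrow> u \<in> dom"
  unfolding dom_def using approx_const by blast

lemma dom_mem [simp]: "u \<in> dom \<Longrightarrow> u \<in> H"
  unfolding dom_def approx_def by blast

lemma form_diff_le:
  assumes "x \<in> T" "y \<in> T" "x' \<in> T" "y' \<in> T"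
  shows "\<bar>e x y - e x' y'\<bar> \<le> form.nrm (x - x') * form.nrm y + form.nrm x' * form.nrm (y - y')"
proof -
  have "e x y - e x' y' = e (x - x') y + e x' (y - y')"
    using assms by (simp add: form.ip_simps)
  then show ?thesis
    using form.ip_abs_le[of "x - x'" y] form.ip_abs_le[of x' "y - y'"] assms by simp
qed

text \<open>This is where closability enters: two sequences that approximate the same vector differ by a
  Cauchy sequence which tends to 0 in \<open>H\<close>.\<close>

lemma approx_unique:
  assumes "approx \<phi> u" "approx \<phi>' u"
  shows "(\<lambda>n. form.nrm (\<phi> n - \<phi>' n)) \<longlonglongrightarrow> 0"
proof -
  have a: "approx (\<lambda>n. \<phi> n - \<phi>' n) 0"
    using approx_lin[OF assms, of 1 "-1"] by simp
  have "(\<lambda>n. e (\<phi> n - \<phi>' n) (\<phi> n - \<phi>' n)) \<longlonglongrightarrow> 0"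
    by (rule closable) (use a in \<open>auto simp: approx_def\<close>)
  then show ?thesis unfolding form.nrm_def by (rule tendsto_eq_rhs[OF tendsto_real_sqrt]) simp
qed

text \<open>The definite description in \<open>E\<close> is proper: the limit exists because \<open>e (\<phi> n) (\<psi> n)\<close> is a
  Cauchy sequence, and by \<open>approx_unique\<close> it is the same for all approximating sequences.\<close>

lemma E_tendsto:
  assumes "approx \<phi> u" "approx \<psi> v"
  shows "(\<lambda>n. e (\<phi> n) (\<psi> n)) \<longlonglongrightarrow> E u v"
proof -
  note T = approxD(1)[OF assms(1)] approxD(1)[OF assms(2)]
  obtain C D where C: "\<And>n. form.nrm (\<phi> n) \<le> C" and D: "\<And>n. form.nrm (\<psi> n) \<le> D"
    using approx_bounded[OF assms(1)] approx_bounded[OF assms(2)] by blast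
  have C0: "0 \<le> C" and D0: "0 \<le> D"
    using form.nrm_nonneg[OF T(1)] form.nrm_nonneg[OF T(2)] C D order_trans by blast+
  have "Cauchy (\<lambda>n. e (\<phi> n) (\<psi> n))"
  proof (rule metric_CauchyI)
    fix \<epsilon> :: real assume \<epsilon>: "\<epsilon> > 0"
    define \<delta> where "\<delta> = \<epsilon> / (C + D + 1)"
    have \<delta>: "\<delta> > 0" using \<epsilon> C0 D0 by (simp add: \<delta>_def)
    obtain M where M: "\<And>m n. m \<ge> M \<Longrightarrow> n \<ge> M \<Longrightarrow> form.nrm (\<phi> m - \<phi> n) < \<delta>"
      using approx_Cauchy[OF assms(1) \<delta>] by auto
    obtain N where N: "\<And>m n. m \<ge> N \<Longrightarrow> n \<ge> N \<Longrightarrow> form.nrm (\<psi> m - \<psi> n) < \<delta>"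
      using approx_Cauchy[OF assms(2) \<delta>] by auto
    have "dist (e (\<phi> m) (\<psi> m)) (e (\<phi> n) (\<psi> n)) < \<epsilon>" if "m \<ge> max M N" "n \<ge> max M N" for m n
    proof -
      have "\<bar>e (\<phi> m) (\<psi> m) - e (\<phi> n) (\<psi> n)\<bar>
          \<le> form.nrm (\<phi> m - \<phi> n) * form.nrm (\<psi> m) + form.nrm (\<phi> n) * form.nrm (\<psi> m - \<psi> n)"
        using T by (intro form_diff_le) auto
      also have "\<dots> \<le> \<delta> * D + C * \<delta>"
        using M[of m n] N[of m n] that C D C0 D0 T \<delta> by (intro add_mono mult_mono) (auto intro: less_imp_le)
      also have "\<dots> < (C + D + 1) * \<delta>" using \<delta> by (simp add: algebra_simps)
      also have "\<dots> = \<epsilon>" using C0 D0 by (simp add: \<delta>_def)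
      finally show ?thesis by (simp add: dist_real_def)
    qed
    then show "\<exists>N. \<forall>m\<ge>N. \<forall>n\<ge>N. dist (e (\<phi> m) (\<psi> m)) (e (\<phi> n) (\<psi> n)) < \<epsilon>" by blast
  qed
  then obtain l where l: "(\<lambda>n. e (\<phi> n) (\<psi> n)) \<longlonglongrightarrow> l"
    using Cauchy_convergent_iff convergent_def by blast
  have all: "(\<lambda>n. e (\<phi>' n) (\<psi>' n)) \<longlonglongrightarrow> l" if a: "approx \<phi>' u" "approx \<psi>' v" for \<phi>' \<psi>'
  proof -
    note T' = approxD(1)[OF a(1)] approxD(1)[OF a(2)]
    obtain D' where D': "\<And>n. form.nrm (\<psi>' n) \<le> D'" using approx_bounded[OF a(2)] by blast
    have "(\<lambda>n. e (\<phi>' n) (\<psi>' n) - e (\<phi> n) (\<psi> n)) \<longlonglongrightarrow> 0"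
    proof (rule Lim_null_comparison)
      show "(\<lambda>n. form.nrm (\<phi>' n - \<phi> n) * D' + C * form.nrm (\<psi>' n - \<psi> n)) \<longlonglongrightarrow> 0"
        by (rule tendsto_eq_intros approx_unique[OF a(1) assms(1)] approx_unique[OF a(2) assms(2)] refl | simp)+
      have "\<bar>e (\<phi>' n) (\<psi>' n) - e (\<phi> n) (\<psi> n)\<bar>
          \<le> form.nrm (\<phi>' n - \<phi> n) * D' + C * form.nrm (\<psi>' n - \<psi> n)" for n
      proof -
        have "\<bar>e (\<phi>' n) (\<psi>' n) - e (\<phi> n) (\<psi> n)\<bar>
            \<le> form.nrm (\<phi>' n - \<phi> n) * form.nrm (\<psi>' n) + form.nrm (\<phi> n) * form.nrm (\<psi>' n - \<psi> n)"
          using T T' by (intro form_diff_le) auto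
        also have "\<dots> \<le> form.nrm (\<phi>' n - \<phi> n) * D' + C * form.nrm (\<psi>' n - \<psi> n)"
          using T T' C D' by (intro add_mono mult_left_mono mult_right_mono) auto
        finally show ?thesis .
      qed
      then show "\<forall>\<^sub>F n in sequentially. norm (e (\<phi>' n) (\<psi>' n) - e (\<phi> n) (\<psi> n))
          \<le> form.nrm (\<phi>' n - \<phi> n) * D' + C * form.nrm (\<psi>' n - \<psi> n)" by simp
    qed
    from tendsto_add[OF this l] show ?thesis by simp
  qed
  have "E u v = l"
    unfolding E_def
    by (rule the_equality) (use all assms LIMSEQ_unique l in blast)+
  then show ?thesis using l by simp
qed

lemma E_sym: "u \<in> dom \<Longrightarrow> v \<in> dom \<Longrightarrow> E u v = E v u"
proof -
  assume "u \<in> dom" "v \<in> dom"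
  then obtain \<phi> \<psi> where a: "approx \<phi> u" "approx \<psi> v" by (auto simp: dom_def)
  have "(\<lambda>n. e (\<phi> n) (\<psi> n)) = (\<lambda>n. e (\<psi> n) (\<phi> n))"
    using approxD(1)[OF a(1)] approxD(1)[OF a(2)] by (auto intro: form.ip_sym)
  then show "E u v = E v u" using E_tendsto[OF a] E_tendsto[OF a(2,1)] LIMSEQ_unique by metis
qed

lemma E_nonneg: "u \<in> dom \<Longrightarrow> 0 \<le> E u u"
proof -
  assume "u \<in> dom"
  then obtain \<phi> where a: "approx \<phi> u" by (auto simp: dom_def)
  show "0 \<le> E u u"
    by (rule LIMSEQ_le_const[OF E_tendsto[OF a a]]) (use approxD(1)[OF a] form.ip_nonneg in auto)
qed

lemma E_lin:
  assumes "u \<in> dom" "u' \<in> dom" "v \<in> dom"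
  shows "E (a *\<^sub>R u + b *\<^sub>R u') v = a * E u v + b * E u' v"
proof -
  obtain \<phi> \<phi>' \<psi> where a: "approx \<phi> u" "approx \<phi>' u'" "approx \<psi> v"
    using assms by (auto simp: dom_def)
  have "(\<lambda>n. a * e (\<phi> n) (\<psi> n) + b * e (\<phi>' n) (\<psi> n)) \<longlonglongrightarrow> a * E u v + b * E u' v"
    by (intro tendsto_intros E_tendsto a)
  moreover have "(\<lambda>n. e (a *\<^sub>R \<phi> n + b *\<^sub>R \<phi>' n) (\<psi> n)) \<longlonglongrightarrow> E (a *\<^sub>R u + b *\<^sub>R u') v"
    by (intro E_tendsto approx_lin a)
  moreover have "e (a *\<^sub>R \<phi> n + b *\<^sub>R \<phi>' n) (\<psi> n) = a * e (\<phi> n) (\<psi> n) + b * e (\<phi>' n) (\<psi> n)" for n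
    using approxD(1)[OF a(1)] approxD(1)[OF a(2)] approxD(1)[OF a(3)] by (simp add: form.ip_simps)
  ultimately show ?thesis using LIMSEQ_unique by simp
qed

lemma E_T: "u \<in> T \<Longrightarrow> v \<in> T \<Longrightarrow> E u v = e u v"
  using E_tendsto[OF approx_const approx_const, of u v] LIMSEQ_unique[OF tendsto_const] by metis

text \<open>The solution minimises \<open>e u u + s * ip u u - 2 * ip f u\<close>. A minimising sequence can be taken
  in \<open>T\<close>, and the parallelogram identity makes it Cauchy, so it approximates its limit in the
  sense of \<open>approx\<close>. The equation is the vanishing of the first variation.\<close>

lemma resolvent_exists:
  assumes f: "f \<in> H" and s: "s > 0"
  shows "\<exists>u\<in>dom. \<forall>v\<in>dom. E u v + s * ip u v = ip f v"
proof -
  define a where "a x y = e x y + s * ip x y" for x y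
  interpret a: semi_inner T a
  proof
    show "subspace T" by (rule form.subspace)
  qed (use s in \<open>auto simp: a_def form.ip_simps ip_simps algebra_simps form.ip_nonneg ip_nonneg
        form.ip_sym ip_sym T_mem\<close>)
  define J where "J \<phi> = a \<phi> \<phi> - 2 * ip f \<phi>" for \<phi>
  have J_ge: "- ip f f / s \<le> J \<phi>" if \<phi>: "\<phi> \<in> T" for \<phi>
  proof -
    have "0 \<le> ip (s *\<^sub>R \<phi> - f) (s *\<^sub>R \<phi> - f)" using \<phi> f by (intro ip_nonneg) auto
    also have "\<dots> = s * (s * ip \<phi> \<phi> - 2 * ip f \<phi>) + ip f f"
      using \<phi> f ip_sym[of f \<phi>] by (simp add: ip_simps algebra_simps)
    finally have "0 \<le> (s * (s * ip \<phi> \<phi> - 2 * ip f \<phi>) + ip f f) / s" using s by simp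
    also have "\<dots> = s * ip \<phi> \<phi> - 2 * ip f \<phi> + ip f f / s" using s by (simp add: field_simps)
    finally show ?thesis using form.ip_nonneg[OF \<phi>] by (simp add: J_def a_def)
  qed
  define m where "m = Inf (J ` T)"
  have bdd: "bdd_below (J ` T)" using J_ge by (auto intro!: bdd_belowI)
  have m_le: "m \<le> J \<phi>" if "\<phi> \<in> T" for \<phi>
    unfolding m_def using that bdd by (intro cInf_lower) auto
  have "\<exists>\<phi>\<in>T. J \<phi> < m + 1 / real (Suc n)" for n
  proof -
    have "J ` T \<noteq> {}" using form.zero_mem by blast
    then have "\<exists>x\<in>J ` T. x < m + 1 / real (Suc n)"
      using bdd cInf_less_iff[of "J ` T" "m + 1 / real (Suc n)"] by (simp add: m_def)
    then show ?thesis by blast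
  qed
  then obtain \<phi> where \<phi>: "\<And>n. \<phi> n \<in> T" "\<And>n. J (\<phi> n) < m + 1 / real (Suc n)" by metis
  have dist: "a (\<phi> j - \<phi> k) (\<phi> j - \<phi> k) \<le> 2 / real (Suc j) + 2 / real (Suc k)" for j k
  proof -
    have "a (\<phi> j - \<phi> k) (\<phi> j - \<phi> k) = 2 * J (\<phi> j) + 2 * J (\<phi> k) - 4 * J ((1/2) *\<^sub>R (\<phi> j + \<phi> k))"
      using \<phi>(1) f a.ip_sym[of "\<phi> j" "\<phi> k"] by (simp add: J_def a.ip_simps ip_simps algebra_simps)
    then show ?thesis
      using \<phi>(2)[of j] \<phi>(2)[of k] m_le[of "(1/2) *\<^sub>R (\<phi> j + \<phi> k)"] \<phi>(1) by simp
  qed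
  have a_small: "\<exists>N. \<forall>j\<ge>N. \<forall>k\<ge>N. a (\<phi> j - \<phi> k) (\<phi> j - \<phi> k) < \<epsilon>" if "\<epsilon> > 0" for \<epsilon>
  proof -
    obtain N :: nat where N: "4 / \<epsilon> < real N" using reals_Archimedean2 by blast
    have "2 / real (Suc j) < \<epsilon> / 2" if "j \<ge> N" for j
      using N that \<open>\<epsilon> > 0\<close> by (simp add: field_simps) (smt (verit) mult_left_mono of_nat_le_iff)
    then have "a (\<phi> j - \<phi> k) (\<phi> j - \<phi> k) < \<epsilon>" if "j \<ge> N" "k \<ge> N" for j k
      using dist[of j k] \<open>\<And>j. N \<le> j \<Longrightarrow> 2 / real (Suc j) < \<epsilon> / 2\<close>[of j]
        \<open>\<And>j. N \<le> j \<Longrightarrow> 2 / real (Suc j) < \<epsilon> / 2\<close>[of k] that by linarith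
    then show ?thesis by blast
  qed
  have e_le: "e (\<phi> j - \<phi> k) (\<phi> j - \<phi> k) \<le> a (\<phi> j - \<phi> k) (\<phi> j - \<phi> k)"
    and ip_le_a: "s * ip (\<phi> j - \<phi> k) (\<phi> j - \<phi> k) \<le> a (\<phi> j - \<phi> k) (\<phi> j - \<phi> k)" for j k
    using \<phi>(1) s by (simp_all add: a_def ip_nonneg form.ip_nonneg)
  have "\<exists>u\<in>H. (\<lambda>n. nrm (\<phi> n - u)) \<longlonglongrightarrow> 0"
  proof (rule complete)
    fix \<epsilon> :: real assume \<epsilon>: "\<epsilon> > 0"
    obtain N where N: "\<And>j k. j \<ge> N \<Longrightarrow> k \<ge> N \<Longrightarrow> a (\<phi> j - \<phi> k) (\<phi> j - \<phi> k) < s * \<epsilon>\<^sup>2"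
      using a_small[of "s * \<epsilon>\<^sup>2"] s \<epsilon> by auto
    have "nrm (\<phi> j - \<phi> k) < \<epsilon>" if "j \<ge> N" "k \<ge> N" for j k
    proof -
      have "s * ip (\<phi> j - \<phi> k) (\<phi> j - \<phi> k) < s * \<epsilon>\<^sup>2"
        using ip_le_a N[OF that] by (rule le_less_trans)
      then have "ip (\<phi> j - \<phi> k) (\<phi> j - \<phi> k) < \<epsilon>\<^sup>2" using s by simp
      then show ?thesis using \<epsilon> by (auto simp: nrm_def intro: real_less_lsqrt)
    qed
    then show "\<exists>N. \<forall>m\<ge>N. \<forall>n\<ge>N. nrm (\<phi> m - \<phi> n) < \<epsilon>" by blast
  qed (use \<phi> in auto)
  then obtain u where u: "u \<in> H" "(\<lambda>n. nrm (\<phi> n - u)) \<longlonglongrightarrow> 0" by blast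
  have ap: "approx \<phi> u"
    unfolding approx_def using \<phi>(1) u a_small e_le by (meson le_less_trans)
  have min: "(a (\<phi> n) \<psi> - ip f \<psi>)\<^sup>2 \<le> (a \<psi> \<psi> + 1) / real (Suc n)" if \<psi>: "\<psi> \<in> T" for n \<psi>
  proof -
    define \<delta> where "\<delta> = a (\<phi> n) \<psi> - ip f \<psi>"
    define q where "q = a \<psi> \<psi> + 1"
    have q: "q \<ge> 1" using a.ip_nonneg[OF \<psi>] by (simp add: q_def)
    \<comment> \<open>Compare with \<open>\<phi> n + t \<psi>\<close> for a nearly optimal \<open>t\<close>; the summand 1 in \<open>q\<close> avoids division by
      0.\<close>
    define t where "t = - \<delta> / q"
    have "m \<le> J (\<phi> n + t *\<^sub>R \<psi>)" using \<phi>(1) \<psi> by (intro m_le) auto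
    also have "\<dots> = J (\<phi> n) + 2 * t * \<delta> + t\<^sup>2 * a \<psi> \<psi>"
      using \<phi>(1) \<psi> f a.ip_sym[of "\<phi> n" \<psi>]
      by (simp add: J_def \<delta>_def a.ip_simps ip_simps algebra_simps power2_eq_square)
    also have "\<dots> \<le> J (\<phi> n) + 2 * t * \<delta> + t\<^sup>2 * q" by (simp add: q_def mult_left_mono)
    also have "\<dots> = J (\<phi> n) - \<delta>\<^sup>2 / q"
      using q by (simp add: t_def power2_eq_square field_simps)
    finally have "\<delta>\<^sup>2 / q \<le> 1 / real (Suc n)" using \<phi>(2)[of n] by linarith
    then have "\<delta>\<^sup>2 \<le> 1 / real (Suc n) * q" using q by (simp add: pos_divide_le_eq)
    then show ?thesis by (simp add: \<delta>_def q_def)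
  qed
  show ?thesis
  proof (intro bexI[of _ u] ballI)
    show "u \<in> dom" using ap by (auto simp: dom_def)
    fix v assume "v \<in> dom"
    then obtain \<psi> where \<psi>: "approx \<psi> v" by (auto simp: dom_def)
    note \<psi>D = approxD[OF \<psi>]
    have lim1: "(\<lambda>n. a (\<phi> n) (\<psi> n) - ip f (\<psi> n)) \<longlonglongrightarrow> E u v + s * ip u v - ip f v"
      unfolding a_def
    proof (intro tendsto_intros E_tendsto ap \<psi>)
      show "(\<lambda>n. ip (\<phi> n) (\<psi> n)) \<longlonglongrightarrow> ip u v"
        using approxD[OF ap] \<psi>D by (intro tendsto_ip) auto
      show "(\<lambda>n. ip f (\<psi> n)) \<longlonglongrightarrow> ip f v"
        using f \<psi>D by (intro tendsto_ip) auto
    qed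
    have "(\<lambda>n. a (\<psi> n) (\<psi> n)) \<longlonglongrightarrow> E v v + s * ip v v"
      unfolding a_def by (intro tendsto_intros E_tendsto \<psi> tendsto_ip) (use \<psi>D in auto)
    then have "(\<lambda>n. (a (\<psi> n) (\<psi> n) + 1) * (1 / real (Suc n))) \<longlonglongrightarrow> (E v v + s * ip v v + 1) * 0"
      by (intro tendsto_intros LIMSEQ_Suc[OF lim_1_over_n])
    then have "(\<lambda>n. (a (\<phi> n) (\<psi> n) - ip f (\<psi> n))\<^sup>2) \<longlonglongrightarrow> 0"
      by (rule Lim_null_comparison[rotated, OF tendsto_eq_rhs]) (use min \<psi>D in auto)
    moreover have "(\<lambda>n. (a (\<phi> n) (\<psi> n) - ip f (\<psi> n))\<^sup>2) \<longlonglongrightarrow> (E u v + s * ip u v - ip f v)\<^sup>2"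
      by (intro tendsto_intros lim1)
    ultimately have "(E u v + s * ip u v - ip f v)\<^sup>2 = 0" using LIMSEQ_unique by blast
    then show "E u v + s * ip u v = ip f v" by simp
  qed
qed

lemma gen_resolvent:
  assumes "f \<in> H" "s > 0"
  shows "\<exists>u. (u, f - s *\<^sub>R u) \<in> gen"
proof -
  obtain u where u: "u \<in> dom" "\<forall>v\<in>dom. E u v + s * ip u v = ip f v"
    using resolvent_exists[OF assms] by blast
  have "(u, f - s *\<^sub>R u) \<in> gen"
    using u assms by (auto simp: gen_def ip_simps algebra_simps)
  then show ?thesis ..
qed

lemma gen_bound:
  assumes "(u, g) \<in> gen" "s > 0"
  shows "nrm u \<le> 1 / s * nrm (g + s *\<^sub>R u)"
proof -
  have u: "u \<in> dom" "g \<in> H" "E u u = ip g u" using assms by (auto simp: gen_def)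
  have "s * (nrm u)\<^sup>2 \<le> ip (g + s *\<^sub>R u) u"
    using u E_nonneg[OF u(1)] by (simp add: ip_simps nrm_sq)
  also have "\<dots> \<le> nrm (g + s *\<^sub>R u) * nrm u" using u by (intro ip_le) auto
  finally have "nrm u * (s * nrm u) \<le> nrm u * nrm (g + s *\<^sub>R u)"
    by (simp add: power2_eq_square algebra_simps)
  then have "s * nrm u \<le> nrm (g + s *\<^sub>R u)"
  proof (cases "nrm u = 0")
    case False
    then have "0 < nrm u" using nrm_nonneg[of u] u by (simp add: less_le)
    then show ?thesis using \<open>nrm u * (s * nrm u) \<le> nrm u * nrm (g + s *\<^sub>R u)\<close>
      by (simp add: mult_le_cancel_left_pos)
  qed (use u in simp)
  then show ?thesis using assms by (simp add: field_simps)
qed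

text \<open>The resolvent \<open>(1 + A)\<^sup>-\<^sup>1\<close> of the operator \<open>A\<close> with graph \<open>gen\<close>. Only its inner products
  with other vectors are determined, hence it is linear up to null vectors.\<close>

definition K :: "'v \<Rightarrow> 'v" where
  "K f = (SOME u. (u, f - u) \<in> gen)"

lemma K_gen: "f \<in> H \<Longrightarrow> (K f, f - K f) \<in> gen"
  unfolding K_def using gen_resolvent[of f 1] by (intro someI_ex[of "\<lambda>u. (u, f - u) \<in> gen"]) simp

lemma K_dom: "f \<in> H \<Longrightarrow> K f \<in> dom"
  and K_mem [simp]: "f \<in> H \<Longrightarrow> K f \<in> H"
  and K_eq: "f \<in> H \<Longrightarrow> v \<in> dom \<Longrightarrow> E (K f) v = ip (f - K f) v"
  using K_gen[of f] by (auto simp: gen_def)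

lemma K_sym: assumes "f \<in> H" "g \<in> H" shows "ip (K f) g = ip f (K g)"
  using K_eq[of f "K g"] K_eq[of g "K f"] E_sym[of "K f" "K g"] K_dom assms
    ip_sym[of "K g" "K f"] ip_sym[of g "K f"]
  by (simp add: ip_simps)

lemma K_pos: assumes "f \<in> H" shows "ip (K f) (K f) \<le> ip (K f) f"
  using K_eq[of f "K f"] E_nonneg[of "K f"] K_dom assms ip_sym[of f "K f"]
  by (simp add: ip_simps)

text \<open>For a spectral value \<open>t \<ge> 0\<close> this is \<open>(t / (1 + t))\<^sup>2 \<le> t / 2\<close>. In terms of \<open>r = f - K f\<close>,
  the equation for \<open>K f\<close> reads \<open>E r v + ip r v = E f v\<close>; take \<open>v = r\<close> and bound the mixed term by
  the mean of \<open>E f f\<close> and \<open>E r r\<close>.\<close>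

lemma K_approximates:
  assumes f: "f \<in> T"
  shows "(nrm (f - K f))\<^sup>2 \<le> e f f / 2"
proof -
  define r where "r = f - K f"
  have r: "r \<in> dom" "r \<in> H" "f \<in> dom" "f \<in> H"
    using f K_dom[of f] dom_subspace by (auto simp: r_def intro: subspace_diff)
  have "E r r = E f r - E (K f) r"
    using E_lin[of f "K f" r 1 "-1"] r K_dom by (simp add: r_def)
  then have 1: "E r r + ip r r = E f r" using K_eq[of f r] r by (simp add: r_def)
  have "E (f - r) (f - r) = E f f - 2 * E f r + E r r"
    using E_lin[of f r "f - r" 1 "-1"] E_lin[of f r f 1 "-1"] E_lin[of f r r 1 "-1"]
      E_sym[of "f - r" f] E_sym[of "f - r" r] E_sym[of f r] r dom_subspace
    by (simp add: subspace_diff)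
  moreover have "0 \<le> E (f - r) (f - r)" using r dom_subspace by (intro E_nonneg) (auto intro: subspace_diff)
  ultimately have "ip r r \<le> E f f / 2 - E r r / 2" using 1 by simp
  then show ?thesis using E_nonneg[of r] r E_T[of f f] f by (simp add: nrm_sq flip: r_def)
qed

section \<open>A gap above zero\<close>

lemma K_lin:
  assumes "x \<in> H" "y \<in> H"
  shows "nrm (K (x - y) - (K x - K y)) = 0"
  using symmetric_linear[OF K_mem K_sym assms, of 1 "-1"] by simp

text \<open>The kernel vector is the limit of \<open>(K ^^ n) x\<close>. Successive differences are
  \<open>- B ((K ^^ n) x)\<close> with \<open>B = 1 - K\<close>. They lie in the range of \<open>B\<close>, where \<open>K\<close> contracts by the
  factor \<open>sqrt (1 - \<eta>)\<close>, so they are dominated by a geometric series.\<close>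

lemma near_kernel:
  assumes \<eta>: "0 < \<eta>" "\<eta> < 1"
    and gap: "\<And>x. x \<in> H \<Longrightarrow> \<eta> * ip (x - K x) x \<le> ip (x - K x) (x - K x)"
    and x: "x \<in> H"
  shows "\<exists>y\<in>H. nrm (y - K y) = 0 \<and> nrm (x - y) \<le> nrm (x - K x) / (1 - sqrt (1 - \<eta>))"
proof -
  define B where "B z = z - K z" for z
  define r where "r = sqrt (1 - \<eta>)"
  have r: "0 \<le> r" "r < 1" using \<eta> by (auto simp: r_def)
  have B: "B z \<in> H" if "z \<in> H" for z using that by (simp add: B_def)
  have B_sym: "ip (B z) z' = ip z (B z')" if "z \<in> H" "z' \<in> H" for z z'
    using that by (simp add: B_def ip_simps K_sym)
  have B_sq: "ip (B z) (B z) \<le> ip (B z) z" if "z \<in> H" for z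
    using that K_pos[OF that] ip_sym[of z "K z"] by (simp add: B_def ip_simps)
  have B_pos: "0 \<le> ip (B z) z" if "z \<in> H" for z
    using B_sq[OF that] ip_nonneg[OF B[OF that]] by linarith
  have contr: "nrm (B (K z)) \<le> r * nrm (B z)" if z: "z \<in> H" for z
  proof -
    define y where "y = B z"
    have y: "y \<in> H" using z B by (simp add: y_def)
    have "nrm (B (K z)) = nrm (K y)"
      by (rule nrm_eqI[symmetric]) (use K_lin[of z "K z"] z y in \<open>simp_all add: y_def B_def\<close>)
    moreover have "(nrm (K y))\<^sup>2 \<le> (r * nrm y)\<^sup>2"
    proof -
      have "K y = y - B y" by (simp add: B_def)
      then have "(nrm (K y))\<^sup>2 = ip y y - 2 * ip (B y) y + ip (B y) (B y)"
        using y B ip_sym[of y "B y"] K_mem[OF y] by (simp add: nrm_sq) (simp add: ip_simps)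
      also have "\<dots> \<le> ip y y - ip (B y) y" using B_sq[OF y] by simp
      also have "\<dots> \<le> (1 - \<eta>) * ip y y"
        using gap_range[of B \<eta> z] B B_sym B_pos \<eta> gap z by (simp add: y_def B_def algebra_simps)
      finally show ?thesis using y \<eta> by (simp add: r_def power_mult_distrib nrm_sq)
    qed
    ultimately show ?thesis
      using r y by (auto simp flip: y_def intro: power2_le_imp_le)
  qed
  define z where "z n = (K ^^ n) x" for n
  have z: "z n \<in> H" for n by (induction n) (use x in \<open>auto simp: z_def\<close>)
  have z_Suc: "z (Suc n) = K (z n)" for n by (simp add: z_def)
  have Bz: "nrm (B (z (m + j))) \<le> r ^ j * nrm (B (z m))" for m j
  proof (induction j)
    case (Suc j)
    have "nrm (B (z (m + Suc j))) \<le> r * nrm (B (z (m + j)))"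
      using contr[OF z] by (simp add: z_Suc)
    also have "\<dots> \<le> r * (r ^ j * nrm (B (z m)))" using Suc r by (intro mult_left_mono) auto
    finally show ?case by simp
  qed simp
  have sum_le: "(\<Sum>i<j. r ^ i) \<le> 1 / (1 - r)" for j
    using r sum_gp_strict[of r j] by (simp add: divide_right_mono)
  have close: "nrm (z (m + j) - z m) \<le> nrm (B (z m)) / (1 - r)" for m j
  proof -
    have "nrm (z (m + j) - z m) \<le> nrm (B (z m)) * (\<Sum>i<j. r ^ i)"
    proof (induction j)
      case (Suc j)
      have "nrm (z (m + Suc j) - z m) \<le> nrm (z (m + Suc j) - z (m + j)) + nrm (z (m + j) - z m)"
        using z by (intro nrm_triangle) auto
      also have "nrm (z (m + Suc j) - z (m + j)) = nrm (B (z (m + j)))"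
        using nrm_commute[of "z (m + Suc j)" "z (m + j)"] z by (simp add: z_Suc B_def)
      finally show ?case using Suc Bz[of m j] by (simp add: algebra_simps)
    qed (use z in simp)
    also have "\<dots> \<le> nrm (B (z m)) * (1 / (1 - r))"
      using z B by (intro mult_left_mono sum_le) auto
    finally show ?thesis by simp
  qed
  have Bz0: "(\<lambda>n. nrm (B (z n))) \<longlonglongrightarrow> 0"
  proof (rule Lim_null_comparison)
    show "(\<lambda>n. r ^ n * nrm (B (z 0))) \<longlonglongrightarrow> 0"
      by (rule tendsto_mult_left_zero LIMSEQ_power_zero)+ (use r in simp)
  qed (use Bz[of 0] z B in simp)
  have "\<exists>y\<in>H. (\<lambda>n. nrm (z n - y)) \<longlonglongrightarrow> 0"
  proof (rule complete)
    fix \<epsilon> :: real assume \<epsilon>: "\<epsilon> > 0"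
    then have "\<epsilon> * (1 - r) / 2 > 0" using r by simp
    then obtain N where N: "nrm (B (z N)) < \<epsilon> * (1 - r) / 2"
      using order_tendstoD(2)[OF Bz0, of "\<epsilon> * (1 - r) / 2"] unfolding eventually_sequentially
      by (meson order_refl)
    then have N': "nrm (B (z N)) / (1 - r) < \<epsilon> / 2" using r by (simp add: field_simps)
    have "nrm (z m - z n) < \<epsilon>" if "m \<ge> N" "n \<ge> N" for m n
    proof -
      have "nrm (z m - z n) \<le> nrm (z m - z N) + nrm (z N - z n)"
        using z by (intro nrm_triangle) auto
      moreover have "nrm (z m - z N) < \<epsilon> / 2" "nrm (z N - z n) < \<epsilon> / 2"
        using le_less_trans[OF close[of N "m - N"] N'] le_less_trans[OF close[of N "n - N"] N']
          that nrm_commute[OF z z, of N n] by simp_all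
      ultimately show ?thesis by linarith
    qed
    then show "\<exists>N. \<forall>m\<ge>N. \<forall>n\<ge>N. nrm (z m - z n) < \<epsilon>" by blast
  qed (rule z)
  then obtain y where y: "y \<in> H" "(\<lambda>n. nrm (z n - y)) \<longlonglongrightarrow> 0" by blast
  have B_le: "nrm (B w) \<le> nrm w" if "w \<in> H" for w
  proof -
    have "(nrm (B w))\<^sup>2 \<le> nrm (B w) * nrm w"
      using B_sq[OF that] ip_le[OF B[OF that] that] that B by (simp add: nrm_sq)
    then show ?thesis using that B
      by (cases "nrm (B w) = 0") (auto simp: power2_eq_square less_le)
  qed
  have "nrm (B y) = 0"
  proof (rule LIMSEQ_unique)
    show "(\<lambda>n. nrm (B y)) \<longlonglongrightarrow> nrm (B y)" by simp
    show "(\<lambda>n. nrm (B y)) \<longlonglongrightarrow> 0"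
    proof (rule Lim_null_comparison)
      show "(\<lambda>n. nrm (z n - y) + nrm (B (z n))) \<longlonglongrightarrow> 0"
        using tendsto_add[OF y(2) Bz0] by simp
      have "nrm (B y) \<le> nrm (z n - y) + nrm (B (z n))" for n
      proof -
        have "nrm (B y - B (z n)) = nrm (B (y - z n))"
        proof (rule nrm_eqI)
          have "B y - B (z n) - B (y - z n) = K (y - z n) - (K y - K (z n))"
            by (simp add: B_def)
          then show "nrm (B y - B (z n) - B (y - z n)) = 0" using K_lin[OF y(1) z] by simp
        qed (use y z B in auto)
        then show ?thesis
          using nrm_triangle2[of "B y" "B (z n)"] B_le[of "y - z n"] y(1) z B nrm_commute[of y "z n"]
          by simp
      qed
      then show "\<forall>\<^sub>F n in sequentially. norm (nrm (B y)) \<le> nrm (z n - y) + nrm (B (z n))"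
        using B[OF y(1)] by simp
    qed
  qed
  moreover have "nrm (x - y) \<le> nrm (B x) / (1 - r)"
  proof (rule LIMSEQ_le_const)
    show "(\<lambda>n. nrm (z n - y) + nrm (B x) / (1 - r)) \<longlonglongrightarrow> nrm (B x) / (1 - r)"
      using tendsto_add[OF y(2) tendsto_const] by simp
    have "nrm (x - y) \<le> nrm (z n - y) + nrm (B x) / (1 - r)" for n
      using close[of 0 n] nrm_triangle[of x "z n" y] z[of n] x y nrm_commute[of x "z n"]
      by (simp add: z_def)
    then show "\<exists>N. \<forall>n\<ge>N. nrm (x - y) \<le> nrm (z n - y) + nrm (B x) / (1 - r)" by blast
  qed
  ultimately show ?thesis using y by (auto simp: B_def r_def)
qed

text \<open>The spectral values \<open>z\<close> of \<open>A\<close> and \<open>\<kappa>\<close> of \<open>1 - K\<close> correspond by \<open>\<kappa> = z / (1 + z)\<close>, which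
  maps \<open>(0, \<delta>)\<close> onto \<open>(0, \<delta> / (1 + \<delta>))\<close>.\<close>

lemma gap_of_resolvent:
  assumes "\<delta> > 0"
    and res: "\<And>z. 0 < z \<Longrightarrow> z < \<delta> \<Longrightarrow> \<exists>C. \<forall>(u, g)\<in>gen. nrm u \<le> C * nrm (g - z *\<^sub>R u)"
    and x: "x \<in> H"
  shows "\<delta> / (1 + \<delta>) * ip (x - K x) x \<le> ip (x - K x) (x - K x)"
proof (rule gap_square[of "\<lambda>x. x - K x"])
  show "ip (x - K x) y = ip x (y - K y)" if "x \<in> H" "y \<in> H" for x y
    using that by (simp add: ip_simps K_sym)
  show "nrm (x - K x) \<le> nrm x" if "x \<in> H" for x
  proof (rule power2_le_imp_le)
    show "(nrm (x - K x))\<^sup>2 \<le> (nrm x)\<^sup>2"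
      using that K_pos[OF that] ip_nonneg[of "K x"] ip_sym[of x "K x"] by (simp add: nrm_sq ip_simps)
  qed (use that in simp)
  show "0 < \<delta> / (1 + \<delta>)" using \<open>\<delta> > 0\<close> by simp
  fix \<kappa> :: real assume \<kappa>: "0 < \<kappa>" "\<kappa> < \<delta> / (1 + \<delta>)"
  have "\<delta> / (1 + \<delta>) < 1" using \<open>\<delta> > 0\<close> by simp
  with \<kappa> have \<kappa>1: "\<kappa> < 1" by linarith
  \<comment> \<open>\<open>(A - z) K = (1 + z) ((1 - K) - \<kappa>)\<close>\<close>
  define z where "z = \<kappa> / (1 - \<kappa>)"
  have z: "0 < z" "z < \<delta>" and one_z: "(1 + z) * (1 - \<kappa>) = 1"
    using \<kappa> \<kappa>1 \<open>\<delta> > 0\<close> by (auto simp: z_def field_simps)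
  obtain C0 where C0: "\<And>u g. (u, g) \<in> gen \<Longrightarrow> nrm u \<le> C0 * nrm (g - z *\<^sub>R u)"
    using res[OF z] by auto
  define C where "C = max C0 0"
  define L where "L = (1 + (1 + z) * C) * (1 + z)"
  have L: "L > 0" using z by (simp add: L_def C_def add_pos_nonneg)
  have "1 / L * nrm y \<le> nrm (y - K y - \<kappa> *\<^sub>R y)" if y: "y \<in> H" for y
  proof -
    define v where "v = y - K y - z *\<^sub>R K y"
    have v: "v \<in> H" using y by (simp add: v_def)
    have v_eq: "v = (1 + z) *\<^sub>R (y - K y - \<kappa> *\<^sub>R y)"
    proof -
      have "(1 + z) *\<^sub>R (y - K y - \<kappa> *\<^sub>R y) = ((1 + z) * (1 - \<kappa>)) *\<^sub>R y - (1 + z) *\<^sub>R K y"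
        by (simp add: algebra_simps)
      then show ?thesis using one_z by (simp add: v_def algebra_simps)
    qed
    have "nrm (K y) \<le> C0 * nrm v" using C0[OF K_gen[OF y]] by (simp add: v_def)
    also have "\<dots> \<le> C * nrm v" using v by (intro mult_right_mono) (auto simp: C_def)
    finally have Ky: "nrm (K y) \<le> C * nrm v" .
    have "y = v + (1 + z) *\<^sub>R K y" by (simp add: v_def algebra_simps)
    then have "nrm y \<le> nrm v + (1 + z) * nrm (K y)"
      using nrm_add[of v "(1 + z) *\<^sub>R K y"] v y z by (simp add: nrm_scale)
    also have "\<dots> \<le> nrm v + (1 + z) * (C * nrm v)"
      using Ky z by (intro add_left_mono mult_left_mono) auto
    also have "\<dots> = (1 + (1 + z) * C) * nrm v" by (simp add: algebra_simps)
    also have "nrm v = (1 + z) * nrm (y - K y - \<kappa> *\<^sub>R y)"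
      unfolding v_eq using y z by (subst nrm_scale) auto
    finally show ?thesis using L by (simp add: L_def field_simps)
  qed
  then show "\<exists>k>0. \<forall>x\<in>H. k * nrm x \<le> nrm (x - K x - \<kappa> *\<^sub>R x)"
    using L by (intro exI[of _ "1 / L"]) auto
qed (use x in auto)

end

section \<open>Orthonormal sequences of vanishing energy\<close>

locale low_energy = closable_form +
  fixes u :: "nat \<Rightarrow> 'a"
  assumes u_T: "\<And>n. u n \<in> T"
    and orthonormal: "\<And>m n. ip (u m) (u n) = (if m = n then 1 else 0)"
    and energy: "(\<lambda>n. e (u n) (u n)) \<longlonglongrightarrow> 0"
begin

lemma u_H [simp]: "u n \<in> H"
  using u_T by simp

lemma nrm_u [simp]: "nrm (u n) = 1"
  by (simp add: nrm_def orthonormal)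

lemma u_K: "(\<lambda>n. nrm (u n - K (u n))) \<longlonglongrightarrow> 0"
proof -
  have "(\<lambda>n. (nrm (u n - K (u n)))\<^sup>2) \<longlonglongrightarrow> 0"
  proof (rule Lim_null_comparison)
    show "(\<lambda>n. e (u n) (u n) / 2) \<longlonglongrightarrow> 0"
      using tendsto_divide[OF energy tendsto_const, of 2] by simp
    show "\<forall>\<^sub>F n in sequentially. norm ((nrm (u n - K (u n)))\<^sup>2) \<le> e (u n) (u n) / 2"
      using K_approximates[OF u_T] by simp
  qed
  then have "(\<lambda>n. sqrt ((nrm (u n - K (u n)))\<^sup>2)) \<longlonglongrightarrow> sqrt 0"
    by (rule tendsto_real_sqrt)
  then show ?thesis by simp
qed

lemma not_bounded_below: "\<not> (\<exists>C. \<forall>(v, g)\<in>gen. nrm v \<le> C * nrm g)"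
proof
  assume "\<exists>C. \<forall>(v, g)\<in>gen. nrm v \<le> C * nrm g"
  then obtain C where C: "\<And>v g. (v, g) \<in> gen \<Longrightarrow> nrm v \<le> C * nrm g" by auto
  have "1 \<le> C * nrm (u n - K (u n)) + nrm (u n - K (u n))" for n
    using C[OF K_gen[of "u n"]] nrm_triangle2[of "u n" "K (u n)"] by simp
  moreover have "(\<lambda>n. C * nrm (u n - K (u n)) + nrm (u n - K (u n))) \<longlonglongrightarrow> C * 0 + 0"
    by (intro tendsto_intros u_K)
  ultimately have "1 \<le> C * 0 + 0" by (intro LIMSEQ_le_const) auto
  then show False by simp
qed

text \<open>By \<open>near_kernel\<close> the vectors \<open>u n\<close> come arbitrarily close to the kernel. Among more of them
  than the kernel has dimensions, a linear combination of the nearby kernel vectors vanishes, and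
  the same combination of the orthonormal \<open>u n\<close> would be too small for its coefficients.\<close>

lemma kernel_not_finite_dimensional:
  assumes "\<delta> > 0"
    and res: "\<And>z. 0 < z \<Longrightarrow> z < \<delta> \<Longrightarrow> \<exists>C. \<forall>(v, g)\<in>gen. nrm v \<le> C * nrm (g - z *\<^sub>R v)"
    and F: "finite F" "F \<subseteq> H"
    and span: "\<And>v g. (v, g) \<in> gen \<Longrightarrow> nrm g = 0 \<Longrightarrow> \<exists>c. nrm (v - (\<Sum>b\<in>F. c b *\<^sub>R b)) = 0"
  shows False
proof -
  define \<eta> where "\<eta> = \<delta> / (1 + \<delta>)"
  have \<eta>: "0 < \<eta>" "\<eta> < 1" using \<open>\<delta> > 0\<close> by (auto simp: \<eta>_def)
  define r where "r = 1 - sqrt (1 - \<eta>)"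
  have r: "r > 0" using \<eta> by (simp add: r_def)
  define k where "k = card F + 1"
  have "r / real (k + 1) > 0" using r by simp
  then obtain N where N: "\<And>n. n \<ge> N \<Longrightarrow> nrm (u n - K (u n)) < r / real (k + 1)"
    using order_tendstoD(2)[OF u_K] by (auto simp: eventually_sequentially)
  define I where "I = {N..<N + k}"
  have I: "finite I" "card F < card I" by (auto simp: I_def k_def)
  have "\<exists>c. nrm (u i - (\<Sum>b\<in>F. c b *\<^sub>R b)) < 1 / real (k + 1)" if i: "i \<in> I" for i
  proof -
    obtain y where y: "y \<in> H" "nrm (y - K y) = 0" "nrm (u i - y) \<le> nrm (u i - K (u i)) / r"
      using near_kernel[OF \<eta>, of "u i"] gap_of_resolvent[OF \<open>\<delta> > 0\<close> res] unfolding \<eta>_def r_def by auto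
    obtain c where c: "nrm (K y - (\<Sum>b\<in>F. c b *\<^sub>R b)) = 0"
      using span[OF K_gen[OF y(1)] y(2)] by blast
    have s: "(\<Sum>b\<in>F. c b *\<^sub>R b) \<in> H" using F by (intro sum_mem scale_mem) auto
    have "nrm (u i - (\<Sum>b\<in>F. c b *\<^sub>R b)) \<le> nrm (u i - y) + nrm (y - (\<Sum>b\<in>F. c b *\<^sub>R b))"
      using y s by (intro nrm_triangle) auto
    also have "\<dots> \<le> nrm (u i - y) + (nrm (y - K y) + nrm (K y - (\<Sum>b\<in>F. c b *\<^sub>R b)))"
      using y s by (intro add_left_mono nrm_triangle) auto
    also have "\<dots> \<le> nrm (u i - K (u i)) / r" using y c by simp
    also have "\<dots> < 1 / real (k + 1)"
      using N[of i] i r by (simp add: I_def field_simps)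
    finally show ?thesis by blast
  qed
  then obtain c where c: "\<And>i. i \<in> I \<Longrightarrow> nrm (u i - (\<Sum>b\<in>F. c i b *\<^sub>R b)) < 1 / real (k + 1)"
    by metis
  obtain a where a: "\<exists>i\<in>I. a i \<noteq> 0" "\<forall>b\<in>F. (\<Sum>i\<in>I. a i * c i b) = 0"
    using nontrivial_relation[OF F(1) I] by blast
  define v where "v = (\<Sum>i\<in>I. a i *\<^sub>R u i)"
  have v: "v \<in> H" by (auto simp: v_def)
  \<comment> \<open>Testing \<open>v\<close> against the \<open>u j\<close> with the largest coefficient gives \<open>M \<le> \<parallel>v\<parallel>\<close>, while the
    distances to the kernel give \<open>\<parallel>v\<parallel> < M\<close>.\<close>
  define M where "M = Max ((\<lambda>i. \<bar>a i\<bar>) ` I)"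
  have "M \<in> (\<lambda>i. \<bar>a i\<bar>) ` I" unfolding M_def using I a by (intro Max_in) auto
  then obtain j where j: "j \<in> I" "M = \<bar>a j\<bar>" by blast
  have M: "\<bar>a i\<bar> \<le> M" if "i \<in> I" for i
    unfolding M_def using I that by (intro Max_ge) auto
  have Mpos: "M > 0" using a M by fastforce
  have "ip v (u j) = (\<Sum>i\<in>I. a i * (if i = j then 1 else 0))"
    using I by (simp add: v_def ip_sum ip_scale orthonormal)
  also have "\<dots> = (\<Sum>i\<in>I. if i = j then a i else 0)" by (intro sum.cong) auto
  also have "\<dots> = a j" using I j by simp
  finally have "M \<le> nrm v" using ip_abs_le[of v "u j"] v j by simp
  also have "v = (\<Sum>i\<in>I. a i *\<^sub>R (u i - (\<Sum>b\<in>F. c i b *\<^sub>R b)))"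
  proof -
    have "(\<Sum>i\<in>I. a i *\<^sub>R (\<Sum>b\<in>F. c i b *\<^sub>R b)) = (\<Sum>i\<in>I. \<Sum>b\<in>F. (a i * c i b) *\<^sub>R b)"
      by (simp add: scaleR_sum_right)
    also have "\<dots> = (\<Sum>b\<in>F. \<Sum>i\<in>I. (a i * c i b) *\<^sub>R b)" by (rule sum.swap)
    also have "\<dots> = 0" using a(2) by (simp flip: scaleR_sum_left)
    finally show ?thesis by (simp add: v_def scaleR_diff_right sum_subtractf)
  qed
  also have "nrm \<dots> \<le> (\<Sum>i\<in>I. nrm (a i *\<^sub>R (u i - (\<Sum>b\<in>F. c i b *\<^sub>R b))))"
    using I F by (intro nrm_sum scale_mem diff_mem sum_mem) auto
  also have "\<dots> \<le> (\<Sum>i\<in>I. M * (1 / real (k + 1)))"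
  proof (rule sum_mono)
    fix i assume i: "i \<in> I"
    have "u i - (\<Sum>b\<in>F. c i b *\<^sub>R b) \<in> H" using F by (intro diff_mem sum_mem scale_mem) auto
    moreover from this have "\<bar>a i\<bar> * nrm (u i - (\<Sum>b\<in>F. c i b *\<^sub>R b)) \<le> M * (1 / real (k + 1))"
      using c[OF i] M[OF i] Mpos by (intro mult_mono) (auto intro: less_imp_le)
    ultimately show "nrm (a i *\<^sub>R (u i - (\<Sum>b\<in>F. c i b *\<^sub>R b))) \<le> M * (1 / real (k + 1))"
      by (simp only: nrm_scale)
  qed
  also have "\<dots> = M * (real k / real (k + 1))" by (simp add: I_def)
  also have "\<dots> < M * 1" using Mpos by (intro mult_strict_left_mono) auto
  finally show False by simp
qed

text \<open>The family \<open>P\<close> is assumed to be linear and a semigroup up to null vectors only, as is the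
  case for operators on square integrable functions.\<close>

lemma semigroup_not_compact:
  assumes P: "\<And>t x. t > 0 \<Longrightarrow> x \<in> H \<Longrightarrow> P t x \<in> H"
    and lin: "\<And>t x y a b. t > 0 \<Longrightarrow> x \<in> H \<Longrightarrow> y \<in> H \<Longrightarrow>
        nrm (P t (a *\<^sub>R x + b *\<^sub>R y) - (a *\<^sub>R P t x + b *\<^sub>R P t y)) = 0"
    and bounded: "\<And>t. t > 0 \<Longrightarrow> \<exists>C. \<forall>x\<in>H. nrm (P t x) \<le> C * nrm x"
    and semigroup: "\<And>s t x. s > 0 \<Longrightarrow> t > 0 \<Longrightarrow> x \<in> H \<Longrightarrow> nrm (P (s + t) x - P s (P t x)) = 0"
    and continuous: "\<And>x. x \<in> H \<Longrightarrow> ((\<lambda>t. nrm (P t x - x)) \<longlongrightarrow> 0) (at_right 0)"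
    and generator: "\<And>v g. (v, g) \<in> gen \<Longrightarrow> ((\<lambda>t. nrm ((1 / t) *\<^sub>R (P t v - v) + g)) \<longlongrightarrow> 0) (at_right 0)"
    and compact: "\<And>t. t > 0 \<Longrightarrow>
        \<exists>r g. strict_mono (r :: nat \<Rightarrow> nat) \<and> g \<in> H \<and> (\<lambda>n. nrm (P t (u (r n)) - g)) \<longlonglongrightarrow> 0"
  shows False
proof -
  have P_diff: "nrm (P t x - P t y) = nrm (P t (x - y))" if "t > 0" "x \<in> H" "y \<in> H" for t x y
    using lin[of t x y 1 "-1"] that P[of t]
    by (intro nrm_eqI) (auto simp: nrm_commute[of "P t x - P t y" "P t (x - y)"])
  have P_scale: "nrm (P t (c *\<^sub>R x)) = \<bar>c\<bar> * nrm (P t x)" if "t > 0" "x \<in> H" for t c x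
  proof -
    have "nrm (P t (c *\<^sub>R x)) = nrm (c *\<^sub>R P t x)"
      using lin[of t x 0 c 0] that P[of t] by (intro nrm_eqI) auto
    then show ?thesis using that P by (simp add: nrm_scale)
  qed
  have P_add: "nrm (P t (x + y)) \<le> nrm (P t x) + nrm (P t y)" if "t > 0" "x \<in> H" "y \<in> H" for t x y
  proof -
    have "nrm (P t (x + y)) = nrm (P t x + P t y)"
      using lin[of t x y 1 1] that P[of t] by (intro nrm_eqI) auto
    then show ?thesis using nrm_add that P by simp
  qed
  \<comment> \<open>Uniform boundedness near time 0: otherwise there are times \<open>s n \<rightarrow> 0\<close> at which the norms of
    \<open>P (s n)\<close> are unbounded, although \<open>P (s n) x\<close> converges for every \<open>x\<close>.\<close>
  have "\<exists>d>0. \<exists>M. \<forall>s. 0 < s \<and> s \<le> d \<longrightarrow> (\<forall>x\<in>H. nrm (P s x) \<le> M * nrm x)"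
  proof (rule ccontr)
    assume "\<not> ?thesis"
    then have "\<exists>s. 0 < s \<and> s \<le> 1 / real (Suc n) \<and> (\<exists>x\<in>H. real n * nrm x < nrm (P s x))" for n
      by (metis divide_pos_pos less_numeral_extra(1) not_le of_nat_0_less_iff zero_less_Suc)
    then obtain s where s: "\<And>n. 0 < s n" "\<And>n. s n \<le> 1 / real (Suc n)"
      "\<And>n. \<exists>x\<in>H. real n * nrm x < nrm (P (s n) x)" by metis
    have s0: "filterlim s (at_right 0) sequentially"
    proof (rule tendsto_imp_filterlim_at_right)
      show "s \<longlonglongrightarrow> 0"
        by (rule Lim_null_comparison[OF _ LIMSEQ_Suc[OF lim_1_over_n]])
           (use s in \<open>auto intro!: always_eventually simp: less_imp_le\<close>)
    qed (use s in simp)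
    have "\<exists>M. \<forall>n. \<forall>x\<in>H. nrm (P (s n) x) \<le> M * nrm x"
    proof (rule uniform_bound)
      fix x assume x: "x \<in> H"
      have "(\<lambda>n. nrm (P (s n) x - x)) \<longlonglongrightarrow> 0"
        using filterlim_compose[OF continuous[OF x] s0] .
      then have "Bseq (\<lambda>n. nrm (P (s n) x - x))" by (rule convergent_imp_Bseq[OF convergentI])
      then obtain M where M: "\<And>n. nrm (P (s n) x - x) \<le> M"
        using x P s(1) unfolding Bseq_def by fastforce
      have "nrm (P (s n) x) \<le> nrm x + M" for n
        using nrm_triangle2[of "P (s n) x" x] M[of n] x P s(1) by fastforce
      then show "\<exists>M. \<forall>n. nrm (P (s n) x) \<le> M" by blast
    qed (use s P_add P_scale bounded in auto)
    then obtain M where M: "\<And>n x. x \<in> H \<Longrightarrow> nrm (P (s n) x) \<le> M * nrm x" by blast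
    obtain n :: nat where n: "M < real n" using reals_Archimedean2 by blast
    obtain x where x: "x \<in> H" "real n * nrm x < nrm (P (s n) x)" using s(3) by blast
    have "real n * nrm x < M * nrm x" using x M[OF x(1), of n] by linarith
    moreover have "M * nrm x \<le> real n * nrm x" using n x by (intro mult_right_mono) auto
    ultimately show False by linarith
  qed
  then obtain t M0 where t: "t > 0" and M0: "\<And>s x. 0 < s \<Longrightarrow> s \<le> t \<Longrightarrow> x \<in> H \<Longrightarrow> nrm (P s x) \<le> M0 * nrm x"
    by blast
  define M where "M = max M0 1"
  have M: "M \<ge> 1" "nrm (P s x) \<le> M * nrm x" if "0 < s" "s \<le> t" "x \<in> H" for s x
  proof -
    show "nrm (P s x) \<le> M * nrm x"
      using M0[OF that] that by (intro order_trans[OF M0[OF that]] mult_right_mono) (auto simp: M_def)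
  qed (simp add: M_def)
  have M1: "M \<ge> 1" by (simp add: M_def)
  \<comment> \<open>Split \<open>[0, t]\<close> into \<open>n + 1\<close> equal parts and telescope; in the limit the increments over one
    part become the derivative of the semigroup at 0.\<close>
  have growth: "nrm (P t v - v) \<le> t * M * nrm g" if vg: "(v, g) \<in> gen" for v g
  proof -
    have v: "v \<in> H" "g \<in> H" using vg by (auto simp: gen_def)
    have step: "nrm (P (real j * h) v - v) \<le> real j * (M * nrm (P h v - v))"
      if h: "0 < h" "real j * h \<le> t" "j > 0" for h j
      using h(3,2)
    proof (induction j rule: nat_induct_non_zero)
      case 1
      have "1 * nrm (P h v - v) \<le> M * nrm (P h v - v)" using M1 v P h by (intro mult_right_mono) auto
      then show ?case by simp
    next
      case (Suc j)
      have jh: "0 < real j * h" "real j * h \<le> t"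
        using Suc h(1) by (auto simp: algebra_simps)
      have "nrm (P (real (Suc j) * h) v - v)
          \<le> nrm (P (real j * h + h) v - P (real j * h) (P h v)) + nrm (P (real j * h) (P h v) - v)"
      proof -
        have "real (Suc j) * h = real j * h + h" by (simp add: algebra_simps)
        then show ?thesis using v P jh h(1) by (simp only:) (intro nrm_triangle, auto)
      qed
      also have "\<dots> \<le> 0 + (nrm (P (real j * h) (P h v) - P (real j * h) v) + nrm (P (real j * h) v - v))"
        using v P jh h(1) semigroup[of "real j * h" h v] by (intro add_mono nrm_triangle) auto
      also have "nrm (P (real j * h) (P h v) - P (real j * h) v) \<le> M * nrm (P h v - v)"
        using P_diff[of "real j * h" "P h v" v] M(2)[of "real j * h" "P h v - v"] jh v P h(1) by simp
      finally show ?case using Suc jh by (simp add: algebra_simps)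
    qed
    define h where "h n = t / real (Suc n)" for n
    have h: "0 < h n" for n using t by (simp add: h_def)
    have h0: "filterlim h (at_right 0) sequentially"
    proof (rule tendsto_imp_filterlim_at_right)
      have "(\<lambda>n. t * (1 / real (Suc n))) \<longlonglongrightarrow> t * 0"
        by (intro tendsto_intros LIMSEQ_Suc[OF lim_1_over_n])
      then show "h \<longlonglongrightarrow> 0" unfolding h_def[abs_def] by simp
    qed (use h in simp)
    have lim: "(\<lambda>n. nrm ((1 / h n) *\<^sub>R (P (h n) v - v) + g)) \<longlonglongrightarrow> 0"
      using filterlim_compose[OF generator[OF vg] h0] .
    have "nrm (P t v - v) \<le> t * M * (nrm g + nrm ((1 / h n) *\<^sub>R (P (h n) v - v) + g))" for n
    proof -
      have Pv: "P (h n) v - v \<in> H" using P h v by auto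
      have tn: "real (Suc n) * h n = t" by (simp add: h_def)
      have "nrm (P t v - v) \<le> real (Suc n) * (M * nrm (P (h n) v - v))"
        using step[of "h n" "Suc n"] h[of n] unfolding tn by simp
      also have "nrm (P (h n) v - v) = h n * nrm ((1 / h n) *\<^sub>R (P (h n) v - v))"
        using h[of n] Pv by (simp add: nrm_scale)
      also have "real (Suc n) * (M * (h n * nrm ((1 / h n) *\<^sub>R (P (h n) v - v))))
          = (real (Suc n) * h n) * M * nrm ((1 / h n) *\<^sub>R (P (h n) v - v))" by simp
      also have "\<dots> \<le> t * M * (nrm g + nrm ((1 / h n) *\<^sub>R (P (h n) v - v) + g))"
      proof -
        have "nrm ((1 / h n) *\<^sub>R (P (h n) v - v))
            \<le> nrm ((1 / h n) *\<^sub>R (P (h n) v - v) + g) + nrm g"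
          using nrm_diff[of "(1 / h n) *\<^sub>R (P (h n) v - v) + g" g] Pv v by simp
        then show ?thesis unfolding tn using t M1 by (intro mult_left_mono) auto
      qed
      finally show ?thesis .
    qed
    moreover have "(\<lambda>n. t * M * (nrm g + nrm ((1 / h n) *\<^sub>R (P (h n) v - v) + g))) \<longlonglongrightarrow> t * M * (nrm g + 0)"
      by (intro tendsto_intros lim)
    ultimately show ?thesis by (intro LIMSEQ_le_const) auto
  qed
  have Pu: "(\<lambda>n. nrm (P t (u n) - u n)) \<longlonglongrightarrow> 0"
  proof (rule Lim_null_comparison)
    show "(\<lambda>n. (M + t * M + 1) * nrm (u n - K (u n))) \<longlonglongrightarrow> 0"
      using tendsto_mult_left[OF u_K, of "M + t * M + 1"] by simp
    have "nrm (P t (u n) - u n) \<le> (M + t * M + 1) * nrm (u n - K (u n))" for n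
    proof -
      have Kn: "K (u n) \<in> H" by simp
      have "nrm (P t (u n) - u n) \<le> nrm (P t (u n) - P t (K (u n))) + nrm (P t (K (u n)) - u n)"
        using P t Kn by (intro nrm_triangle) auto
      also have "nrm (P t (K (u n)) - u n) \<le> nrm (P t (K (u n)) - K (u n)) + nrm (K (u n) - u n)"
        using P t Kn by (intro nrm_triangle) auto
      also have "nrm (P t (u n) - P t (K (u n))) \<le> M * nrm (u n - K (u n))"
        using P_diff[of t "u n" "K (u n)"] M(2)[of t "u n - K (u n)"] t by simp
      also have "nrm (P t (K (u n)) - K (u n)) \<le> t * M * nrm (u n - K (u n))"
        using growth[OF K_gen] by simp
      finally show ?thesis using nrm_commute[of "K (u n)" "u n"] by (simp add: algebra_simps)
    qed
    then show "\<forall>\<^sub>F n in sequentially. norm (nrm (P t (u n) - u n)) \<le> (M + t * M + 1) * nrm (u n - K (u n))"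
      using P t by simp
  qed
  obtain r g where r: "strict_mono r" "g \<in> H" "(\<lambda>n. nrm (P t (u (r n)) - g)) \<longlonglongrightarrow> 0"
    using compact[OF t] by blast
  have ug: "(\<lambda>n. nrm (u (r n) - g)) \<longlonglongrightarrow> 0"
  proof (rule Lim_null_comparison)
    show "(\<lambda>n. nrm (P t (u (r n)) - u (r n)) + nrm (P t (u (r n)) - g)) \<longlonglongrightarrow> 0"
      using tendsto_add[OF LIMSEQ_subseq_LIMSEQ[OF Pu r(1)] r(3)] by (simp add: o_def)
    have "nrm (u (r n) - g) \<le> nrm (P t (u (r n)) - u (r n)) + nrm (P t (u (r n)) - g)" for n
      using nrm_triangle[of "u (r n)" "P t (u (r n))" g] P[OF t, of "u (r n)"] r(2)
        nrm_commute[of "u (r n)" "P t (u (r n))"] by simp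
    then show "\<forall>\<^sub>F n in sequentially. norm (nrm (u (r n) - g))
        \<le> nrm (P t (u (r n)) - u (r n)) + nrm (P t (u (r n)) - g)" using r(2) by simp
  qed
  obtain N where N: "\<And>n. n \<ge> N \<Longrightarrow> nrm (u (r n) - g) < 1 / 2"
    using order_tendstoD(2)[OF ug, of "1 / 2"] by (auto simp: eventually_sequentially)
  have "r N \<noteq> r (Suc N)" using r(1) by (metis lessI less_irrefl strict_monoD)
  then have "(nrm (u (r N) - u (r (Suc N))))\<^sup>2 = 2"
    by (simp add: nrm_sq ip_simps orthonormal)
  moreover have "nrm (u (r N) - u (r (Suc N))) < 1"
    using nrm_triangle[of "u (r N)" g "u (r (Suc N))"] r(2) N[of N] N[of "Suc N"]
      nrm_commute[of g "u (r (Suc N))"] by simp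
  then have "(nrm (u (r N) - u (r (Suc N))))\<^sup>2 < 1"
    by (simp add: power_less_one_iff)
  ultimately show False by simp
qed

end

section \<open>Square integrable functions as a complete semi-inner product space\<close>

instantiation "fun" :: (type, real_vector) real_vector
begin

definition "c *\<^sub>R f = (\<lambda>x. c *\<^sub>R f x)"

instance
  by standard (simp_all add: scaleR_fun_def fun_eq_iff fun_diff_def algebra_simps)

end

lemma scaleR_fun_apply [simp]: "(c *\<^sub>R f) x = c *\<^sub>R f x"
  by (simp add: scaleR_fun_def)

lemma l2I: "u \<in> borel_measurable M \<Longrightarrow> integrable M (\<lambda>x. (u x)\<^sup>2) \<Longrightarrow> u \<in> l2 M"
  by (simp add: l2_def)

lemma l2_measurable [measurable_dest]: "u \<in> l2 M \<Longrightarrow> u \<in> borel_measurable M"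
  by (simp add: l2_def)

lemma l2_mult_integrable:
  assumes "u \<in> l2 M" "v \<in> l2 M"
  shows "integrable M (\<lambda>x. u x * v x)"
proof (rule Bochner_Integration.integrable_bound)
  show "integrable M (\<lambda>x. (u x)\<^sup>2 + (v x)\<^sup>2)"
    using assms by (auto simp: l2_def)
  show "(\<lambda>x. u x * v x) \<in> borel_measurable M"
    using assms by (auto simp: l2_def)
  have "\<bar>a * b\<bar> \<le> a\<^sup>2 + b\<^sup>2" for a b :: real
    using sum_squares_bound[of a b] sum_squares_bound[of a "-b"] by (simp add: abs_le_iff)
  then show "AE x in M. norm (u x * v x) \<le> norm ((u x)\<^sup>2 + (v x)\<^sup>2)"
    by (simp add: abs_of_nonneg)
qed

lemma l2_add: assumes "u \<in> l2 M" "v \<in> l2 M" shows "u + v \<in> l2 M"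
proof (rule l2I)
  have "(\<lambda>x. (u x)\<^sup>2 + 2 * (u x * v x) + (v x)\<^sup>2) = (\<lambda>x. ((u + v) x)\<^sup>2)"
    by (simp add: power2_sum algebra_simps)
  moreover have "integrable M (\<lambda>x. (u x)\<^sup>2 + 2 * (u x * v x) + (v x)\<^sup>2)"
    using assms l2_mult_integrable[OF assms] by (auto simp: l2_def)
  ultimately show "integrable M (\<lambda>x. ((u + v) x)\<^sup>2)" by simp
qed (use assms in \<open>auto simp: l2_def plus_fun_def\<close>)

lemma l2_scale: assumes "u \<in> l2 M" shows "c *\<^sub>R u \<in> l2 M"
  using assms by (auto simp: l2_def scaleR_fun_def power_mult_distrib)

lemma semi_inner_l2: "semi_inner (l2 M) (l2_inner M)"
proof
  show "subspace (l2 M)"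
    unfolding subspace_def
    by (auto simp: l2_add l2_scale) (simp add: l2_def zero_fun_def)
  show "l2_inner M (x + y) z = l2_inner M x z + l2_inner M y z"
    if "x \<in> l2 M" "y \<in> l2 M" "z \<in> l2 M" for x y z
    using that by (simp add: l2_inner_def distrib_right l2_mult_integrable)
  show "l2_inner M (c *\<^sub>R x) y = c * l2_inner M x y" for c x y
    by (simp add: l2_inner_def scaleR_fun_def mult.assoc)
  show "l2_inner M x y = l2_inner M y x" for x y
    by (simp add: l2_inner_def mult.commute)
  show "0 \<le> l2_inner M x x" for x
    by (simp add: l2_inner_def)
qed

lemma l2_norm_eq: "semi_inner.nrm (l2_inner M) u = l2_norm M u"
  by (simp add: semi_inner.nrm_def[OF semi_inner_l2] l2_norm_def)

lemma l2_norm_null [simp]: "l2_norm M 0 = 0"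
  by (simp add: l2_norm_def l2_inner_def)

lemma l2_norm_less_iff:
  assumes "u \<in> l2 M" "\<epsilon> > 0"
  shows "l2_norm M u < \<epsilon> \<longleftrightarrow> (\<integral>\<^sup>+x. ennreal ((u x)\<^sup>2) \<partial>M) < ennreal (\<epsilon>\<^sup>2)"
proof -
  have "(\<integral>\<^sup>+x. ennreal ((u x)\<^sup>2) \<partial>M) = ennreal (l2_inner M u u)"
    unfolding l2_inner_def power2_eq_square[symmetric]
    using assms by (intro nn_integral_eq_integral) (auto simp: l2_def)
  moreover have "0 \<le> l2_inner M u u" by (simp add: l2_inner_def)
  moreover have "l2_norm M u < \<epsilon> \<longleftrightarrow> l2_inner M u u < \<epsilon>\<^sup>2"
    using assms(2) real_sqrt_less_iff[of "l2_inner M u u" "\<epsilon>\<^sup>2"] by (simp add: l2_norm_def)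
  ultimately show ?thesis by (simp add: ennreal_less_iff)
qed

text \<open>Along a subsequence with increments \<open>d j\<close> of norm at most \<open>2\<^sup>-\<^sup>j\<close>, the sum of
  \<open>2\<^sup>j * (d j)\<^sup>2\<close> has a finite integral. Where it is finite, \<open>d j\<close> decays geometrically and the
  subsequence converges. The limit in norm follows by Fatou's lemma.\<close>

lemma l2_complete:
  fixes u :: "nat \<Rightarrow> 'a \<Rightarrow> real"
  assumes u: "\<And>n. u n \<in> l2 M"
    and Cauchy: "\<And>\<epsilon>. \<epsilon> > 0 \<Longrightarrow> \<exists>N. \<forall>m\<ge>N. \<forall>n\<ge>N. l2_norm M (u m - u n) < \<epsilon>"
  shows "\<exists>g\<in>l2 M. (\<lambda>n. l2_norm M (u n - g)) \<longlonglongrightarrow> 0"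
proof -
  interpret semi_inner "l2 M" "l2_inner M" by (rule semi_inner_l2)
  have [measurable]: "u n \<in> borel_measurable M" for n using u by (rule l2_measurable)
  have "\<exists>N>k. \<forall>m\<ge>N. \<forall>n\<ge>N. l2_norm M (u m - u n) < (1 / 2) ^ j" for k j
  proof -
    obtain N where N: "\<forall>m\<ge>N. \<forall>n\<ge>N. l2_norm M (u m - u n) < (1 / 2) ^ j"
      using Cauchy[of "(1 / 2) ^ j"] by auto
    then show ?thesis by (intro exI[of _ "max N (Suc k)"]) auto
  qed
  then have "\<exists>r. \<forall>j. (\<forall>m\<ge>r j. \<forall>n\<ge>r j. l2_norm M (u m - u n) < (1 / 2) ^ j) \<and> r j < r (Suc j)"
    by (intro dependent_nat_choice) (use less_nat_zero_code in blast)+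
  then obtain r where r: "\<And>j m n. m \<ge> r j \<Longrightarrow> n \<ge> r j \<Longrightarrow> l2_norm M (u m - u n) < (1 / 2) ^ j"
    and r_mono: "\<And>j. r j < r (Suc j)" by blast
  have strict: "strict_mono r" using r_mono by (simp add: strict_mono_Suc_iff)
  define d where "d j x = u (r (Suc j)) x - u (r j) x" for j x
  define s where "s x = (\<Sum>j. ennreal (2 ^ j * (d j x)\<^sup>2))" for x
  have [measurable]: "d j \<in> borel_measurable M" for j unfolding d_def by measurable
  have "(\<integral>\<^sup>+x. s x \<partial>M) = (\<Sum>j. \<integral>\<^sup>+x. ennreal (2 ^ j * (d j x)\<^sup>2) \<partial>M)"
    unfolding s_def by (rule nn_integral_suminf) measurable
  also have "\<dots> \<le> (\<Sum>j. ennreal ((1 / 2) ^ j))"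
  proof (intro suminf_le summableI)
    fix j
    have "l2_norm M (u (r (Suc j)) - u (r j)) < (1 / 2) ^ j"
      using r_mono[of j] by (intro r) auto
    then have "(\<integral>\<^sup>+x. ennreal ((d j x)\<^sup>2) \<partial>M) < ennreal (((1 / 2) ^ j)\<^sup>2)"
      using l2_norm_less_iff[of "u (r (Suc j)) - u (r j)" M "(1 / 2) ^ j"] diff_mem[OF u u]
      by (simp add: d_def)
    then have "ennreal (2 ^ j) * (\<integral>\<^sup>+x. ennreal ((d j x)\<^sup>2) \<partial>M) \<le> ennreal (2 ^ j) * ennreal (((1 / 2) ^ j)\<^sup>2)"
      by (intro mult_left_mono) auto
    also have "\<dots> = ennreal ((1 / 2) ^ j)"
      by (simp add: ennreal_mult[symmetric] power2_eq_square power_divide)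
    finally show "(\<integral>\<^sup>+x. ennreal (2 ^ j * (d j x)\<^sup>2) \<partial>M) \<le> ennreal ((1 / 2) ^ j)"
      by (simp add: ennreal_mult nn_integral_cmult)
  qed
  also have "\<dots> = ennreal (\<Sum>j. (1 / 2) ^ j)"
    by (rule suminf_ennreal2) (auto intro: summable_geometric)
  finally have "(\<integral>\<^sup>+x. s x \<partial>M) \<noteq> \<infinity>" by (auto simp: top_unique)
  moreover have [measurable]: "s \<in> borel_measurable M" unfolding s_def by measurable
  ultimately have fin: "AE x in M. s x \<noteq> \<infinity>" by (intro nn_integral_noteq_infinite) auto
  define g where "g x = lim (\<lambda>j. u (r j) x)" for x
  have [measurable]: "g \<in> borel_measurable M" unfolding g_def by measurable
  have lim: "AE x in M. (\<lambda>j. u (r j) x) \<longlonglongrightarrow> g x"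
    using fin
  proof eventually_elim
    fix x assume fin: "s x \<noteq> \<infinity>"
    then obtain R where R: "0 \<le> R" "s x = ennreal R" by (cases "s x") auto
    have d_le: "\<bar>d j x\<bar> \<le> sqrt R * (1 / sqrt 2) ^ j" for j
    proof -
      define f where "f = (\<lambda>i. ennreal (2 ^ i * (d i x)\<^sup>2))"
      have "sum f {j} \<le> suminf f" by (rule sum_le_suminf) auto
      then have "ennreal (2 ^ j * (d j x)\<^sup>2) \<le> ennreal R"
        using R(2) by (simp add: s_def f_def)
      then have "2 ^ j * (d j x)\<^sup>2 \<le> R" using R(1) by (subst (asm) ennreal_le_iff)
      then have "\<bar>d j x\<bar>\<^sup>2 \<le> R / 2 ^ j" by (simp add: field_simps)
      then have "\<bar>d j x\<bar> \<le> sqrt (R / 2 ^ j)" by (rule real_le_rsqrt)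
      then show ?thesis by (simp add: real_sqrt_divide real_sqrt_power power_divide)
    qed
    have "summable (\<lambda>j. sqrt R * (1 / sqrt 2) ^ j)"
      by (intro summable_mult summable_geometric) simp
    then have "summable (\<lambda>j. d j x)"
      by (rule summable_comparison_test'[of _ 0]) (use d_le in auto)
    then have "convergent (\<lambda>n. \<Sum>j<n. d j x)" by (simp add: summable_iff_convergent)
    moreover have "(\<Sum>j<n. d j x) = u (r n) x - u (r 0) x" for n
      unfolding d_def by (rule sum_lessThan_telescope)
    ultimately obtain l where "(\<lambda>n. u (r n) x - u (r 0) x) \<longlonglongrightarrow> l" by (auto simp: convergent_def)
    from tendsto_add[OF this tendsto_const, of "u (r 0) x"]
    have "convergent (\<lambda>n. u (r n) x)" by (auto simp: convergent_def)
    then show "(\<lambda>j. u (r j) x) \<longlonglongrightarrow> g x" by (simp add: g_def convergent_LIMSEQ_iff)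
  qed
  have bound: "(\<integral>\<^sup>+x. ennreal ((u m x - g x)\<^sup>2) \<partial>M) \<le> ennreal (((1 / 2) ^ j)\<^sup>2)" if "m \<ge> r j" for m j
  proof -
    have "(\<integral>\<^sup>+x. ennreal ((u m x - g x)\<^sup>2) \<partial>M)
        = (\<integral>\<^sup>+x. liminf (\<lambda>k. ennreal ((u m x - u (r k) x)\<^sup>2)) \<partial>M)"
    proof (rule nn_integral_cong_AE, use lim in eventually_elim)
      fix x assume "(\<lambda>j. u (r j) x) \<longlonglongrightarrow> g x"
      then have "(\<lambda>k. ennreal ((u m x - u (r k) x)\<^sup>2)) \<longlonglongrightarrow> ennreal ((u m x - g x)\<^sup>2)"
        by (intro tendsto_intros)
      then show "ennreal ((u m x - g x)\<^sup>2) = liminf (\<lambda>k. ennreal ((u m x - u (r k) x)\<^sup>2))"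
        by (rule lim_imp_Liminf[OF trivial_limit_sequentially, symmetric])
    qed
    also have "\<dots> \<le> liminf (\<lambda>k. \<integral>\<^sup>+x. ennreal ((u m x - u (r k) x)\<^sup>2) \<partial>M)"
      by (rule nn_integral_liminf) measurable
    also have "\<dots> \<le> ennreal (((1 / 2) ^ j)\<^sup>2)"
    proof (rule Liminf_le)
      show "\<forall>\<^sub>F k in sequentially. (\<integral>\<^sup>+x. ennreal ((u m x - u (r k) x)\<^sup>2) \<partial>M) \<le> ennreal (((1 / 2) ^ j)\<^sup>2)"
        using eventually_ge_at_top[of j]
      proof eventually_elim
        case (elim k)
        then have "r j \<le> r k" using strict by (simp add: strict_mono_less_eq)
        then have "l2_norm M (u m - u (r k)) < (1 / 2) ^ j" using that by (intro r) auto
        then show ?case using l2_norm_less_iff[of "u m - u (r k)" M "(1 / 2) ^ j"] diff_mem[OF u u]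
          by simp
      qed
    qed simp
    finally show ?thesis .
  qed
  have diff: "u (r 0) - g \<in> l2 M"
  proof (rule l2I)
    show "integrable M (\<lambda>x. ((u (r 0) - g) x)\<^sup>2)"
      using bound[of 0 "r 0"] by (intro integrableI_nonneg) (auto simp: fun_diff_def intro: le_less_trans)
  qed (auto simp: fun_diff_def)
  have g: "g \<in> l2 M" using diff_mem[OF u[of "r 0"] diff] by simp
  have "(\<lambda>n. l2_norm M (u n - g)) \<longlonglongrightarrow> 0"
  proof (rule LIMSEQ_I)
    fix \<epsilon> :: real assume \<epsilon>: "\<epsilon> > 0"
    obtain j where j: "(1 / 2) ^ j < \<epsilon>" using real_arch_pow_inv[OF \<epsilon>, of "1 / 2"] by auto
    have "l2_norm M (u n - g) < \<epsilon>" if "n \<ge> r j" for n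
    proof -
      have "((1 / 2) ^ j)\<^sup>2 < \<epsilon>\<^sup>2" using j \<epsilon> by (intro power_strict_mono) auto
      then have "(\<integral>\<^sup>+x. ennreal ((u n x - g x)\<^sup>2) \<partial>M) < ennreal (\<epsilon>\<^sup>2)"
        using bound[OF that] by (auto simp: ennreal_less_iff elim!: le_less_trans)
      then show ?thesis using l2_norm_less_iff[of "u n - g" M \<epsilon>] diff_mem[OF u g] \<epsilon> by simp
    qed
    moreover have "0 \<le> l2_norm M f" for f by (simp add: l2_norm_def l2_inner_def)
    ultimately show "\<exists>N. \<forall>n\<ge>N. norm (l2_norm M (u n - g) - 0) < \<epsilon>" by auto
  qed
  with g show ?thesis by blast
qed

lemma semi_hilbert_l2: "semi_hilbert (l2 M) (l2_inner M)"
  by (intro semi_hilbert.intro semi_inner_l2 semi_hilbert_axioms.intro)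
     (simp only: l2_norm_eq, rule l2_complete)

lemma l2_norm_zero_iff:
  assumes "u \<in> l2 M"
  shows "l2_norm M u = 0 \<longleftrightarrow> (AE x in M. u x = 0)"
proof -
  have "l2_norm M u = 0 \<longleftrightarrow> (\<integral>x. (u x)\<^sup>2 \<partial>M) = 0"
    by (simp add: l2_norm_def l2_inner_def power2_eq_square)
  also have "\<dots> \<longleftrightarrow> (AE x in M. (u x)\<^sup>2 = 0)"
    using assms by (intro integral_nonneg_eq_0_iff_AE) (auto simp: l2_def)
  finally show ?thesis by simp
qed

section \<open>Smooth functions of compact support\<close>

text \<open>A smooth function is represented by the sequence of all its derivatives, which keeps the
  iterated partial derivatives of products explicit.\<close>

definition derivatives :: "(nat \<Rightarrow> real \<Rightarrow> real) \<Rightarrow> bool" where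
  "derivatives g \<longleftrightarrow> (\<forall>n x. (g n has_real_derivative g (Suc n) x) (at x))"

lemma derivativesD: "derivatives g \<Longrightarrow> (g n has_real_derivative g (Suc n) x) (at x)"
  by (simp add: derivatives_def)

lemma derivatives_mult:
  assumes "derivatives f" "derivatives g"
  shows "derivatives (\<lambda>n x. \<Sum>k\<le>n. real (n choose k) * (f k x * g (n - k) x))"
  unfolding derivatives_def
proof (intro allI)
  fix n x
  let ?t = "\<lambda>k. f k x * g (Suc n - k) x"
  have "((\<lambda>x. \<Sum>k\<le>n. real (n choose k) * (f k x * g (n - k) x)) has_real_derivative
      (\<Sum>k\<le>n. real (n choose k) * (f (Suc k) x * g (n - k) x + f k x * g (Suc (n - k)) x))) (at x)"
    by (rule derivative_eq_intros DERIV_sum derivativesD[OF assms(1)] derivativesD[OF assms(2)] refl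
        | simp add: algebra_simps)+
  also have "(\<Sum>k\<le>n. real (n choose k) * (f (Suc k) x * g (n - k) x + f k x * g (Suc (n - k)) x))
      = (\<Sum>k\<le>n. real (n choose k) * ?t (Suc k)) + (\<Sum>k\<le>n. real (n choose k) * ?t k)"
    by (simp add: Suc_diff_le distrib_left sum.distrib)
  also have "(\<Sum>k\<le>n. real (n choose k) * ?t k) = ?t 0 + (\<Sum>k\<le>n. real (n choose Suc k) * ?t (Suc k))"
  proof -
    have "(\<Sum>k\<le>n. real (n choose k) * ?t k) = (\<Sum>k\<le>Suc n. real (n choose k) * ?t k)" by simp
    also have "\<dots> = ?t 0 + (\<Sum>k\<le>n. real (n choose Suc k) * ?t (Suc k))"
      by (simp only: sum.atMost_Suc_shift binomial_n_0 of_nat_1 mult_1)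
    finally show ?thesis .
  qed
  also have "(\<Sum>k\<le>n. real (n choose k) * ?t (Suc k)) + (?t 0 + (\<Sum>k\<le>n. real (n choose Suc k) * ?t (Suc k)))
      = (\<Sum>k\<le>Suc n. real (Suc n choose k) * ?t k)"
    by (simp only: sum.atMost_Suc_shift binomial_n_0 of_nat_1 mult_1 binomial_Suc_Suc of_nat_add
        distrib_right sum.distrib add.left_commute)
  finally show "((\<lambda>x. \<Sum>k\<le>n. real (n choose k) * (f k x * g (n - k) x)) has_real_derivative
      (\<Sum>k\<le>Suc n. real (Suc n choose k) * (f k x * g (Suc n - k) x))) (at x)" .
qed

lemma derivatives_affine:
  assumes "derivatives g"
  shows "derivatives (\<lambda>n x. a ^ n * g n (a * x + b))"
  unfolding derivatives_def
proof (intro allI)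
  fix n x
  have "((\<lambda>x. g n (a * x + b)) has_real_derivative g (Suc n) (a * x + b) * a) (at x)"
    by (rule DERIV_chain2[OF derivativesD[OF assms]]) (auto intro!: derivative_eq_intros)
  from DERIV_cmult[OF this, of "a ^ n"]
  show "((\<lambda>x. a ^ n * g n (a * x + b)) has_real_derivative a ^ Suc n * g (Suc n) (a * x + b)) (at x)"
    by (simp add: algebra_simps)
qed

text \<open>The polynomials \<open>p\<^sub>n\<close> for which the \<open>n\<close>-th derivative of \<open>exp (- (1 / x))\<close> is
  \<open>p\<^sub>n (1 / x) * exp (- (1 / x))\<close>.\<close>

primrec exp_coeff :: "nat \<Rightarrow> real poly" where
  "exp_coeff 0 = 1"
| "exp_coeff (Suc n) = [:0, 0, 1:] * (exp_coeff n - pderiv (exp_coeff n))"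

text \<open>The derivatives of the function that is \<open>exp (- (1 / x))\<close> for \<open>x > 0\<close> and 0 otherwise, the
  source of all smooth functions of compact support below.\<close>

definition flat_exp :: "nat \<Rightarrow> real \<Rightarrow> real" where
  "flat_exp n x = (if 0 < x then poly (exp_coeff n) (1 / x) * exp (- (1 / x)) else 0)"

lemma poly_times_exp_tendsto_0: "((\<lambda>y. poly p y * exp (- y)) \<longlongrightarrow> (0::real)) at_top"
proof -
  have "((\<lambda>y. \<Sum>i\<le>degree p. coeff p i * (y ^ i / exp y)) \<longlongrightarrow> (\<Sum>i\<le>degree p. coeff p i * 0)) at_top"
    by (intro tendsto_intros tendsto_power_div_exp_0)
  then show ?thesis by (simp add: poly_altdef exp_minus divide_inverse sum_distrib_right mult.assoc)
qed

lemma derivatives_flat_exp: "derivatives flat_exp"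
  unfolding derivatives_def
proof (intro allI)
  fix n and x :: real
  consider "x < 0" | "x > 0" | "x = 0" by linarith
  then show "(flat_exp n has_real_derivative flat_exp (Suc n) x) (at x)"
  proof cases
    case 1
    have "((\<lambda>_. 0) has_real_derivative 0) (at x)" by simp
    then have "(flat_exp n has_real_derivative 0) (at x)"
      by (rule has_field_derivative_transform_within_open[of _ _ _ "{..<0}"])
         (use 1 in \<open>auto simp: flat_exp_def\<close>)
    then show ?thesis using 1 by (simp add: flat_exp_def)
  next
    case 2
    have "((\<lambda>x. 1 / x) has_real_derivative - (1 / x)\<^sup>2) (at x)"
      using 2 by (auto intro!: derivative_eq_intros simp: power2_eq_square)
    note d = this
    have "((\<lambda>x. poly (exp_coeff n) (1 / x)) has_real_derivative poly (pderiv (exp_coeff n)) (1 / x) * - (1 / x)\<^sup>2) (at x)"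
      by (rule DERIV_chain2[OF poly_DERIV d])
    moreover have "((\<lambda>x. exp (- (1 / x))) has_real_derivative exp (- (1 / x)) * (1 / x)\<^sup>2) (at x)"
      using DERIV_chain2[OF DERIV_exp DERIV_minus[OF d]] by simp
    ultimately have "((\<lambda>x. poly (exp_coeff n) (1 / x) * exp (- (1 / x))) has_real_derivative
        poly (exp_coeff (Suc n)) (1 / x) * exp (- (1 / x))) (at x)"
      by (rule derivative_eq_intros) (simp add: algebra_simps power2_eq_square)
    then have "(flat_exp n has_real_derivative poly (exp_coeff (Suc n)) (1 / x) * exp (- (1 / x))) (at x)"
      by (rule has_field_derivative_transform_within_open[of _ _ _ "{0<..}"])
         (use 2 in \<open>auto simp: flat_exp_def\<close>)
    then show ?thesis using 2 by (simp add: flat_exp_def)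
  next
    case 3
    have "((\<lambda>h. (flat_exp n h - flat_exp n 0) / h) \<longlongrightarrow> 0) (at 0)"
    proof (rule filterlim_split_at)
      have "((\<lambda>h::real. 0) \<longlongrightarrow> (0::real)) (at_left 0)" by simp
      moreover have "\<forall>\<^sub>F h in at_left 0. (0::real) = (flat_exp n h - flat_exp n 0) / h"
        unfolding eventually_at_filter by (auto simp: flat_exp_def)
      ultimately show "((\<lambda>h. (flat_exp n h - flat_exp n 0) / h) \<longlongrightarrow> 0) (at_left 0)"
        by (rule Lim_transform_eventually)
      have "((\<lambda>h. poly ([:0, 1:] * exp_coeff n) (inverse h) * exp (- inverse h)) \<longlongrightarrow> 0) (at_right 0)"
        by (rule filterlim_compose[OF poly_times_exp_tendsto_0 filterlim_inverse_at_top_right])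
      moreover have "\<forall>\<^sub>F h in at_right 0. poly ([:0, 1:] * exp_coeff n) (inverse h) * exp (- inverse h)
          = (flat_exp n h - flat_exp n 0) / h"
        unfolding eventually_at_filter by (auto simp: flat_exp_def divide_inverse)
      ultimately show "((\<lambda>h. (flat_exp n h - flat_exp n 0) / h) \<longlongrightarrow> 0) (at_right 0)"
        by (rule Lim_transform_eventually)
    qed
    then show ?thesis using 3 by (simp add: DERIV_def flat_exp_def)
  qed
qed

text \<open>Products of functions of one coordinate each, where \<open>m k\<close> counts the differentiations in
  direction \<open>k\<close>. This class is closed under partial derivatives, which makes the iterated partial
  derivatives of a test function explicit.\<close>

definition coordinate_product :: "('n::finite \<Rightarrow> nat \<Rightarrow> real \<Rightarrow> real) \<Rightarrow> ('n \<Rightarrow> nat) \<Rightarrow> real ^ 'n \<Rightarrow> real" where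
  "coordinate_product g m x = (\<Prod>k\<in>UNIV. g k (m k) (x $ k))"

lemma partial_deriv_eq:
  assumes "(u has_derivative D) (at x)"
  shows "partial_deriv k u x = D (axis k 1)"
  using frechet_derivative_at[OF assms] by (simp add: partial_deriv_def)

lemma coordinate_product_derivative:
  assumes g: "\<And>k. derivatives (g k)"
  shows "coordinate_product g m differentiable (at x)"
    and "partial_deriv j (coordinate_product g m) = coordinate_product g (m(j := Suc (m j)))"
proof -
  let ?D = "\<lambda>x h. \<Sum>k\<in>UNIV. (g k (Suc (m k)) (x $ k) * h $ k) * (\<Prod>i\<in>UNIV - {k}. g i (m i) (x $ i))"
  have D: "(coordinate_product g m has_derivative ?D x) (at x)" for x :: "real ^ 'a"
    unfolding coordinate_product_def[abs_def]
  proof (rule has_derivative_prod)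
    fix k :: 'a
    have "(g k (m k) has_derivative (\<lambda>h. g k (Suc (m k)) (x $ k) * h)) (at (x $ k))"
      using derivativesD[OF g[of k], of "m k" "x $ k"] by (simp add: has_field_derivative_def)
    moreover have "((\<lambda>x. x $ k) has_derivative (\<lambda>h. h $ k)) (at x)"
      by (rule bounded_linear_imp_has_derivative) (rule bounded_linear_vec_nth)
    ultimately show "((\<lambda>x. g k (m k) (x $ k)) has_derivative (\<lambda>h. g k (Suc (m k)) (x $ k) * h $ k)) (at x)"
      using has_derivative_compose[of "\<lambda>x. x $ k" "\<lambda>h. h $ k" x UNIV "g k (m k)"] by simp
  qed
  show "coordinate_product g m differentiable (at x)" using D by (auto simp: differentiable_def)
  show "partial_deriv j (coordinate_product g m) = coordinate_product g (m(j := Suc (m j)))"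
  proof
    fix x :: "real ^ 'a"
    have "partial_deriv j (coordinate_product g m) x
        = (\<Sum>k\<in>UNIV. if k = j then g j (Suc (m j)) (x $ j) * (\<Prod>i\<in>UNIV - {j}. g i (m i) (x $ i)) else 0)"
      unfolding partial_deriv_eq[OF D] by (intro sum.cong) (auto simp: axis_def)
    also have "\<dots> = g j (Suc (m j)) (x $ j) * (\<Prod>i\<in>UNIV - {j}. g i (m i) (x $ i))" by simp
    also have "\<dots> = coordinate_product g (m(j := Suc (m j))) x"
      unfolding coordinate_product_def by (subst prod.remove[of UNIV j]) auto
    finally show "partial_deriv j (coordinate_product g m) x = coordinate_product g (m(j := Suc (m j))) x" .
  qed
qed

lemma coordinate_product_test:
  fixes g :: "'n::finite \<Rightarrow> nat \<Rightarrow> real \<Rightarrow> real"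
  assumes g: "\<And>k. derivatives (g k)" and supp: "\<And>k x. g k 0 x \<noteq> 0 \<Longrightarrow> a $ k \<le> x \<and> x \<le> b $ k"
  shows "coordinate_product g (\<lambda>_. 0) \<in> test_functions"
proof -
  have fold: "\<exists>m'. fold partial_deriv ks (coordinate_product g m) = coordinate_product g m'" for ks m
    by (induction ks arbitrary: m) (auto simp: coordinate_product_derivative[OF g])
  have "fold partial_deriv ks (coordinate_product g (\<lambda>_. 0)) differentiable_on UNIV" for ks
  proof -
    obtain m' where "fold partial_deriv ks (coordinate_product g (\<lambda>_. 0)) = coordinate_product g m'"
      using fold by blast
    then show ?thesis
      using coordinate_product_derivative(1)[of g m'] g by (simp add: differentiable_on_def)
  qed
  moreover have "{x. coordinate_product g (\<lambda>_. 0) x \<noteq> 0} \<subseteq> cbox a b"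
    using supp by (auto simp: coordinate_product_def mem_box_cart)
  then have "bounded {x. coordinate_product g (\<lambda>_. 0) x \<noteq> 0}"
    by (rule bounded_subset[OF bounded_cbox])
  ultimately show ?thesis by (simp add: test_functions_def)
qed

text \<open>Leibniz' formula for the derivatives of
  \<open>flat_exp 0 (s * (x - a)) * flat_exp 0 (s * (b - x))\<close>, a function that for \<open>s > 0\<close> is positive
  exactly on \<open>(a, b)\<close> and tends to the indicator of this interval as \<open>s \<rightarrow> \<infinity>\<close>.\<close>

definition bump :: "real \<Rightarrow> real \<Rightarrow> real \<Rightarrow> nat \<Rightarrow> real \<Rightarrow> real" where
  "bump a b s n x = (\<Sum>k\<le>n. real (n choose k) *
     ((s ^ k * flat_exp k (s * x + - (s * a))) * ((- s) ^ (n - k) * flat_exp (n - k) (- s * x + s * b))))"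

lemma derivatives_bump: "derivatives (bump a b s)"
  unfolding bump_def[abs_def]
  by (intro derivatives_mult derivatives_affine[where a = s] derivatives_affine[where a = "- s"] derivatives_flat_exp)

lemma bump_0: "bump a b s 0 x = flat_exp 0 (s * (x - a)) * flat_exp 0 (s * (b - x))"
  by (simp add: bump_def algebra_simps)

lemma flat_exp_0: "flat_exp 0 x = (if 0 < x then exp (- (1 / x)) else 0)"
  by (simp add: flat_exp_def)

lemma flat_exp_0_bounds: "0 \<le> flat_exp 0 x" "flat_exp 0 x \<le> 1"
  by (auto simp: flat_exp_0)

lemma bump_0_bounds: "0 \<le> bump a b s 0 x" "bump a b s 0 x \<le> 1"
  using flat_exp_0_bounds by (auto simp: bump_0 intro: mult_le_one)

lemma bump_outside: "s > 0 \<Longrightarrow> \<not> (a < x \<and> x < b) \<Longrightarrow> bump a b s n x = 0"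
proof -
  assume s: "s > 0" and x: "\<not> (a < x \<and> x < b)"
  have "\<not> 0 < s * x + - (s * a) \<or> \<not> 0 < - s * x + s * b" using s x by (simp add: not_less)
  then show ?thesis by (auto simp: bump_def flat_exp_def intro!: sum.neutral)
qed

lemma bump_0_tendsto_1:
  assumes "a < x" "x < b"
  shows "(\<lambda>n. bump a b (real (Suc n)) 0 x) \<longlonglongrightarrow> 1"
proof -
  have "(\<lambda>n. flat_exp 0 (real (Suc n) * y)) \<longlonglongrightarrow> 1" if "y > 0" for y
  proof -
    have "(\<lambda>n. exp (- (1 / y * (1 / real (Suc n))))) \<longlonglongrightarrow> exp (- (1 / y * 0))"
      by (intro tendsto_intros LIMSEQ_Suc[OF lim_1_over_n])
    moreover have "flat_exp 0 (real (Suc n) * y) = exp (- (1 / y * (1 / real (Suc n))))" for n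
    proof -
      have "0 < real (Suc n) * y" using that by simp
      then show ?thesis by (simp only: flat_exp_0 if_True) (simp add: field_simps)
    qed
    ultimately show ?thesis by simp
  qed
  from tendsto_mult[OF this[of "x - a"] this[of "b - x"]] assms
  show ?thesis by (simp add: bump_0)
qed

definition box_bump :: "real ^ 'n::finite \<Rightarrow> real ^ 'n \<Rightarrow> real \<Rightarrow> real ^ 'n \<Rightarrow> real" where
  "box_bump a b s = coordinate_product (\<lambda>k. bump (a $ k) (b $ k) s) (\<lambda>_. 0)"

lemma box_bump_test: "s > 0 \<Longrightarrow> box_bump a b s \<in> test_functions"
  unfolding box_bump_def
proof (rule coordinate_product_test)
  show "a $ k \<le> x \<and> x \<le> b $ k" if "s > 0" "bump (a $ k) (b $ k) s 0 x \<noteq> 0" for k x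
    using bump_outside[OF that(1), of "a $ k" x "b $ k" 0] that(2) by force
qed (rule derivatives_bump)

lemma box_bump_bounds: "s > 0 \<Longrightarrow> \<bar>box_bump a b s x\<bar> \<le> indicator (box a b) x"
proof (cases "x \<in> box a b")
  case True
  then show ?thesis
    using prod_mono[of UNIV "\<lambda>k. \<bar>bump (a $ k) (b $ k) s 0 (x $ k)\<bar>" "\<lambda>_. 1"] bump_0_bounds
    by (simp add: box_bump_def coordinate_product_def abs_prod)
next
  case False
  assume "s > 0"
  obtain k where "\<not> (a $ k < x $ k \<and> x $ k < b $ k)" using False by (auto simp: mem_box_cart)
  then have "bump (a $ k) (b $ k) s 0 (x $ k) = 0" by (rule bump_outside[OF \<open>s > 0\<close>])
  then have "box_bump a b s x = 0"
    unfolding box_bump_def coordinate_product_def by (intro prod_zero) auto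
  then show ?thesis by simp
qed

lemma box_bump_tendsto: "(\<lambda>n. box_bump a b (real (Suc n)) x) \<longlonglongrightarrow> indicator (box a b) x"
proof (cases "x \<in> box a b")
  case True
  have "(\<lambda>n. \<Prod>k\<in>UNIV. bump (a $ k) (b $ k) (real (Suc n)) 0 (x $ k)) \<longlonglongrightarrow> (\<Prod>k\<in>(UNIV :: 'a set). 1)"
    by (intro tendsto_prod bump_0_tendsto_1) (use True in \<open>auto simp: mem_box_cart\<close>)
  then show ?thesis using True by (simp add: box_bump_def coordinate_product_def)
next
  case False
  have "box_bump a b (real (Suc n)) x = 0" for n
    using box_bump_bounds[of "real (Suc n)" a b x] False by simp
  then show ?thesis using False by simp
qed

section \<open>Partial integration\<close>

lemma partial_deriv_lin:
  assumes "u differentiable (at x)" "v differentiable (at x)"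
  shows "partial_deriv k (a *\<^sub>R u + b *\<^sub>R v) x = a * partial_deriv k u x + b * partial_deriv k v x"
proof -
  have "((\<lambda>x. a * u x + b * v x) has_derivative
      (\<lambda>h. a * frechet_derivative u (at x) h + b * frechet_derivative v (at x) h)) (at x)"
    using assms unfolding frechet_derivative_works by (intro derivative_eq_intros) auto
  from partial_deriv_eq[OF this] show ?thesis
    by (simp add: partial_deriv_def plus_fun_def scaleR_fun_def)
qed

lemma fold_partial_deriv_lin:
  assumes "\<And>ks. fold partial_deriv ks u differentiable_on UNIV" "\<And>ks. fold partial_deriv ks v differentiable_on UNIV"
  shows "fold partial_deriv ks (a *\<^sub>R u + b *\<^sub>R v) = a *\<^sub>R fold partial_deriv ks u + b *\<^sub>R fold partial_deriv ks v"
  using assms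
proof (induction ks arbitrary: u v)
  case (Cons k ks)
  have d: "u differentiable (at x)" "v differentiable (at x)" for x
    using Cons.prems(1)[of "[]"] Cons.prems(2)[of "[]"] by (simp_all add: differentiable_on_def)
  have "partial_deriv k (a *\<^sub>R u + b *\<^sub>R v) = a *\<^sub>R partial_deriv k u + b *\<^sub>R partial_deriv k v"
    by (rule ext) (simp only: partial_deriv_lin[OF d] plus_fun_apply scaleR_fun_apply real_scaleR_def)
  moreover have "fold partial_deriv ks (a *\<^sub>R partial_deriv k u + b *\<^sub>R partial_deriv k v)
      = a *\<^sub>R fold partial_deriv ks (partial_deriv k u) + b *\<^sub>R fold partial_deriv ks (partial_deriv k v)"
    using Cons.prems(1)[of "k # _"] Cons.prems(2)[of "k # _"] by (intro Cons.IH) simp_all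
  ultimately show ?case by (simp only: fold_Cons o_apply)
qed simp

lemma test_functions_lin:
  assumes u: "u \<in> test_functions" and v: "v \<in> test_functions"
  shows "a *\<^sub>R u + b *\<^sub>R v \<in> test_functions"
proof -
  have d: "fold partial_deriv ks u differentiable_on UNIV" "fold partial_deriv ks v differentiable_on UNIV" for ks
    using u v by (simp_all add: test_functions_def)
  have "fold partial_deriv ks (a *\<^sub>R u + b *\<^sub>R v) differentiable_on UNIV" for ks
  proof -
    have "(\<lambda>x. a *\<^sub>R fold partial_deriv ks u x + b *\<^sub>R fold partial_deriv ks v x) differentiable_on UNIV"
      using d by (intro derivative_intros) auto
    then show ?thesis
      unfolding fold_partial_deriv_lin[OF d] by (simp only: plus_fun_def scaleR_fun_def)
  qed
  moreover have "bounded {x. (a *\<^sub>R u + b *\<^sub>R v) x \<noteq> 0}"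
  proof (rule bounded_subset)
    show "bounded ({x. u x \<noteq> 0} \<union> {x. v x \<noteq> 0})"
      using u v by (simp add: test_functions_def)
  qed (auto simp: scaleR_fun_def)
  ultimately show ?thesis by (simp add: test_functions_def)
qed

lemma subspace_test_functions: "subspace test_functions"
proof -
  have "(0 :: real ^ 'n \<Rightarrow> real) \<in> test_functions"
  proof -
    have "partial_deriv k (0 :: real ^ 'n \<Rightarrow> real) = 0" for k
    proof
      fix x :: "real ^ 'n"
      have "((0 :: real ^ 'n \<Rightarrow> real) has_derivative (\<lambda>_. 0)) (at x)" by (simp add: zero_fun_def)
      from partial_deriv_eq[OF this] show "partial_deriv k (0 :: real ^ 'n \<Rightarrow> real) x = 0 x" by simp
    qed
    then have "fold partial_deriv ks (0 :: real ^ 'n \<Rightarrow> real) = 0" for ks by (induction ks) auto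
    then show ?thesis by (simp add: test_functions_def) (simp add: zero_fun_def)
  qed
  then show ?thesis unfolding subspace_def
    using test_functions_lin[of _ _ 1 1] test_functions_lin[of _ 0 _ 0] by auto
qed

text \<open>Continuously differentiable functions of bounded support. Unlike for test functions, closure
  under multiplication is immediate.\<close>

definition C1c :: "(real ^ 'n::finite \<Rightarrow> real) set" where
  "C1c = {u. (\<forall>x. u differentiable (at x)) \<and> (\<forall>k. continuous_on UNIV (partial_deriv k u)) \<and>
     bounded {x. u x \<noteq> 0}}"

lemma test_functions_C1c: "u \<in> test_functions \<Longrightarrow> u \<in> C1c"
proof -
  assume "u \<in> test_functions"
  then have d: "fold partial_deriv ks u differentiable_on UNIV" and b: "bounded {x. u x \<noteq> 0}" for ks
    by (auto simp: test_functions_def)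
  show "u \<in> C1c"
    using d[of "[]"] d[of "[_]"] b
    by (simp add: C1c_def differentiable_imp_continuous_on) (simp add: differentiable_on_def)
qed

lemma partial_deriv_mult:
  assumes "u differentiable (at x)" "v differentiable (at x)"
  shows "partial_deriv k (\<lambda>x. u x * v x) x = partial_deriv k u x * v x + u x * partial_deriv k v x"
proof -
  have "((\<lambda>x. u x * v x) has_derivative
      (\<lambda>h. u x * frechet_derivative v (at x) h + frechet_derivative u (at x) h * v x)) (at x)"
    using assms unfolding frechet_derivative_works by (rule has_derivative_mult)
  from partial_deriv_eq[OF this] show ?thesis by (simp add: partial_deriv_def)
qed

lemma C1c_continuous: "u \<in> C1c \<Longrightarrow> continuous_on UNIV u"
  by (simp add: C1c_def continuous_at_imp_continuous_on differentiable_imp_continuous_within)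

lemma C1c_mult: assumes "u \<in> C1c" "v \<in> C1c" shows "(\<lambda>x. u x * v x) \<in> C1c"
proof -
  have d: "u differentiable (at x)" "v differentiable (at x)" for x using assms by (auto simp: C1c_def)
  have "continuous_on UNIV (partial_deriv k (\<lambda>x. u x * v x))" for k
    unfolding partial_deriv_mult[OF d, abs_def]
    using assms C1c_continuous[OF assms(1)] C1c_continuous[OF assms(2)]
    by (intro continuous_intros) (auto simp: C1c_def)
  moreover have "bounded {x. u x * v x \<noteq> 0}"
    by (rule bounded_subset[of "{x. u x \<noteq> 0}"]) (use assms in \<open>auto simp: C1c_def\<close>)
  ultimately show ?thesis using d by (simp add: C1c_def)
qed

lemma partial_deriv_C1c_lin:
  assumes "u \<in> C1c" "v \<in> C1c"
  shows "partial_deriv k (u + v) = partial_deriv k u + partial_deriv k v"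
    "partial_deriv k (u - v) = partial_deriv k u - partial_deriv k v"
    "partial_deriv k (c *\<^sub>R u) = c *\<^sub>R partial_deriv k u"
proof -
  have d: "u differentiable (at x)" "v differentiable (at x)" for x using assms by (auto simp: C1c_def)
  have *: "partial_deriv k (a *\<^sub>R u + b *\<^sub>R v) = a *\<^sub>R partial_deriv k u + b *\<^sub>R partial_deriv k v" for a b
    by (rule ext) (simp only: partial_deriv_lin[OF d] plus_fun_apply scaleR_fun_apply real_scaleR_def)
  show "partial_deriv k (u + v) = partial_deriv k u + partial_deriv k v" using *[of 1 1] by simp
  show "partial_deriv k (u - v) = partial_deriv k u - partial_deriv k v" using *[of 1 "-1"] by simp
  show "partial_deriv k (c *\<^sub>R u) = c *\<^sub>R partial_deriv k u" using *[of c 0] by simp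
qed

text \<open>These functions are integrable with respect to every measure with a locally bounded density,
  also after multiplication with an exponential of the weight.\<close>

definition bounded_supported :: "('a::euclidean_space \<Rightarrow> real) set" where
  "bounded_supported = {f. f \<in> borel_measurable borel \<and> (\<exists>B R. \<forall>x. \<bar>f x\<bar> \<le> B \<and> (R < norm x \<longrightarrow> f x = 0))}"

lemma bounded_supportedI:
  assumes "f \<in> borel_measurable borel" "\<And>x. \<bar>f x\<bar> \<le> B" "\<And>x. R < norm x \<Longrightarrow> f x = 0"
  shows "f \<in> bounded_supported"
  using assms unfolding bounded_supported_def by blast

lemma continuous_bounded_supported:
  fixes f :: "'a::euclidean_space \<Rightarrow> real"
  assumes f: "continuous_on UNIV f" and "bounded {x. f x \<noteq> 0}"
  shows "f \<in> bounded_supported"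
proof -
  obtain R where R: "\<And>x. f x \<noteq> 0 \<Longrightarrow> norm x \<le> R" using assms(2) by (auto simp: bounded_iff)
  have "bounded (f ` cball 0 R)"
    by (intro compact_imp_bounded compact_continuous_image continuous_on_subset[OF f]) auto
  then obtain B where "\<forall>y\<in>f ` cball 0 R. norm y \<le> B" unfolding bounded_iff by blast
  then have B: "\<bar>f x\<bar> \<le> B" if "norm x \<le> R" for x using that by auto
  have "\<bar>f x\<bar> \<le> max B 0 \<and> (R < norm x \<longrightarrow> f x = 0)" for x
    using B[of x] R[of x] by (cases "f x = 0") force+
  then show ?thesis using borel_measurable_continuous_onI[OF f] unfolding bounded_supported_def by blast
qed

lemma bounded_supported_mult:
  assumes "f \<in> bounded_supported" "g \<in> bounded_supported"
  shows "(\<lambda>x. f x * g x) \<in> bounded_supported"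
proof -
  obtain B R where B: "\<And>x. \<bar>f x\<bar> \<le> B" "\<And>x. R < norm x \<Longrightarrow> f x = 0"
    using assms(1) unfolding bounded_supported_def by blast
  obtain C where C: "\<And>x. \<bar>g x\<bar> \<le> C" using assms(2) unfolding bounded_supported_def by blast
  have "\<bar>f x * g x\<bar> \<le> B * C" for x
    using mult_mono[OF B(1)[of x] C[of x]] B(1)[of x] by (simp add: abs_mult)
  moreover have "(\<lambda>x. f x * g x) \<in> borel_measurable borel"
    using assms by (auto simp: bounded_supported_def)
  ultimately show ?thesis unfolding bounded_supported_def using B(2)
    by (intro CollectI conjI exI[of _ "B * C"] exI[of _ R]) auto
qed

lemma bounded_supported_scale: "f \<in> bounded_supported \<Longrightarrow> (\<lambda>x. c * f x :: real) \<in> bounded_supported"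
proof -
  assume f: "f \<in> bounded_supported"
  then obtain B R where B: "\<And>x. \<bar>f x\<bar> \<le> B" "\<And>x. R < norm x \<Longrightarrow> f x = 0"
    unfolding bounded_supported_def by blast
  show ?thesis
    by (rule bounded_supportedI[of _ "\<bar>c\<bar> * B" R])
       (use f B in \<open>auto simp: bounded_supported_def abs_mult intro: mult_left_mono\<close>)
qed

lemma bounded_supported_add:
  "f \<in> bounded_supported \<Longrightarrow> g \<in> bounded_supported \<Longrightarrow> (\<lambda>x. f x + g x :: real) \<in> bounded_supported"
proof -
  assume fg: "f \<in> bounded_supported" "g \<in> bounded_supported"
  obtain B R where B: "\<And>x. \<bar>f x\<bar> \<le> B" "\<And>x. R < norm x \<Longrightarrow> f x = 0"
    using fg(1) unfolding bounded_supported_def by blast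
  obtain C S where C: "\<And>x. \<bar>g x\<bar> \<le> C" "\<And>x. S < norm x \<Longrightarrow> g x = 0"
    using fg(2) unfolding bounded_supported_def by blast
  show ?thesis
  proof (rule bounded_supportedI[of _ "B + C" "max R S"])
    show "\<bar>f x + g x\<bar> \<le> B + C" for x using B(1)[of x] C(1)[of x] by linarith
  qed (use fg B C in \<open>auto simp: bounded_supported_def\<close>)
qed

lemma bounded_supported_exp:
  fixes w :: "'a::euclidean_space \<Rightarrow> real"
  assumes [measurable]: "w \<in> borel_measurable borel"
    and locally_bounded: "\<And>R. \<exists>B. \<forall>x. norm x \<le> R \<longrightarrow> \<bar>w x\<bar> \<le> B"
    and "f \<in> bounded_supported"
  shows "(\<lambda>x. exp (c * w x) * f x) \<in> bounded_supported"
proof -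
  obtain B R where B: "\<And>x. \<bar>f x\<bar> \<le> B" "\<And>x. R < norm x \<Longrightarrow> f x = 0" and [measurable]: "f \<in> borel_measurable borel"
    using assms(3) unfolding bounded_supported_def by blast
  obtain C where C: "\<And>x. norm x \<le> R \<Longrightarrow> \<bar>w x\<bar> \<le> C" using locally_bounded by blast
  have B0: "0 \<le> B" using B(1)[of 0] by linarith
  have "\<bar>exp (c * w x) * f x\<bar> \<le> exp (\<bar>c\<bar> * C) * B" for x
  proof (cases "R < norm x")
    case True
    then show ?thesis using B B0 by simp
  next
    case False
    then have "\<bar>c\<bar> * \<bar>w x\<bar> \<le> \<bar>c\<bar> * C" using C by (intro mult_left_mono) auto
    then have "c * w x \<le> \<bar>c\<bar> * C" using abs_ge_self[of "c * w x"] by (simp add: abs_mult)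
    then show ?thesis using B(1)[of x] by (simp add: abs_mult) (intro mult_mono, auto)
  qed
  then show ?thesis unfolding bounded_supported_def using B(2)
    by (intro CollectI conjI exI[of _ "exp (\<bar>c\<bar> * C) * B"] exI[of _ R]) auto
qed

lemma bounded_supported_integrable:
  assumes "f \<in> bounded_supported"
  shows "integrable lborel f"
proof -
  obtain B R where B: "\<And>x. \<bar>f x\<bar> \<le> B" "\<And>x. R < norm x \<Longrightarrow> f x = 0" and [measurable]: "f \<in> borel_measurable borel"
    using assms unfolding bounded_supported_def by blast
  show ?thesis
  proof (rule Bochner_Integration.integrable_bound)
    show "integrable lborel (\<lambda>x. B * indicator (cball 0 R) x)"
      by (intro integrable_mult_right integrable_real_indicator) (auto simp: emeasure_lborel_cball_finite[unfolded infinity_ennreal_def])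
    have "norm (f x) \<le> norm (B * indicator (cball 0 R) x)" for x
      using B(1)[of x] B(2)[of x] by (cases "R < norm x") (auto simp: not_less)
    then show "AE x in lborel. norm (f x) \<le> norm (B * indicator (cball 0 R) x)" by simp
  qed measurable
qed

lemma C1c_bounded_supported:
  assumes "u \<in> C1c"
  shows "u \<in> bounded_supported" "partial_deriv k u \<in> bounded_supported"
proof -
  show "u \<in> bounded_supported"
    using assms C1c_continuous by (intro continuous_bounded_supported) (auto simp: C1c_def)
  show "partial_deriv k u \<in> bounded_supported"
  proof (rule continuous_bounded_supported)
    show "bounded {x. partial_deriv k u x \<noteq> 0}"
    proof (rule bounded_subset)
      show "bounded (closure {x. u x \<noteq> 0})" using assms by (simp add: C1c_def bounded_closure)
      show "{x. partial_deriv k u x \<noteq> 0} \<subseteq> closure {x. u x \<noteq> 0}"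
      proof (rule subsetI, rule ccontr)
        fix x assume x: "x \<in> {x. partial_deriv k u x \<noteq> 0}" "x \<notin> closure {x. u x \<noteq> 0}"
        have "((\<lambda>_. 0) has_derivative (\<lambda>_. 0)) (at x)" by simp
        then have "(u has_derivative (\<lambda>_. 0)) (at x)"
          by (rule has_derivative_transform_within_open[of _ _ _ _ "- closure {x. u x \<noteq> 0}"])
             (use x closure_subset[of "{x. u x \<noteq> 0}"] in \<open>auto simp: open_Compl\<close>)
        from partial_deriv_eq[OF this] x show False by simp
      qed
    qed
  qed (use assms in \<open>auto simp: C1c_def\<close>)
qed

lemma line_derivative:
  assumes "u differentiable (at (x + t *\<^sub>R axis k 1))"
  shows "((\<lambda>t. u (x + t *\<^sub>R axis k 1)) has_real_derivative partial_deriv k u (x + t *\<^sub>R axis k 1)) (at t)"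
proof -
  let ?D = "frechet_derivative u (at (x + t *\<^sub>R axis k 1))"
  have D: "(u has_derivative ?D) (at (x + t *\<^sub>R axis k 1))"
    using assms by (simp add: frechet_derivative_works)
  have "((\<lambda>t. x + t *\<^sub>R axis k 1) has_derivative (\<lambda>h. h *\<^sub>R axis k 1)) (at t)"
    by (auto intro!: derivative_eq_intros)
  from has_derivative_compose[OF this D]
  have "((\<lambda>t. u (x + t *\<^sub>R axis k 1)) has_derivative (\<lambda>h. ?D (h *\<^sub>R axis k 1))) (at t)" .
  moreover have "?D (h *\<^sub>R axis k 1) = partial_deriv k u (x + t *\<^sub>R axis k 1) * h" for h
    using linear_scale[OF has_derivative_linear[OF D]] by (simp add: partial_deriv_def)
  ultimately show ?thesis by (simp add: has_field_derivative_def)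
qed

text \<open>By translation invariance all difference quotients have integral 0, and they converge to the
  partial derivative boundedly and with supports in a fixed ball.\<close>

lemma integral_partial_deriv:
  fixes u :: "real ^ 'n::finite \<Rightarrow> real"
  assumes u: "u \<in> C1c"
  shows "(\<integral>x. partial_deriv k u x \<partial>lborel) = 0"
proof -
  define s where "s n = 1 / real (Suc n)" for n
  have s: "0 < s n" "s n \<le> 1" for n by (auto simp: s_def)
  have s0: "s \<longlonglongrightarrow> 0" unfolding s_def[abs_def] by (rule LIMSEQ_Suc[OF lim_1_over_n])
  define F where "F n x = (u (x + s n *\<^sub>R axis k 1) - u x) / s n" for n x
  have d: "u differentiable (at x)" for x using u by (simp add: C1c_def)
  obtain B R0 where B: "\<And>x. \<bar>partial_deriv k u x\<bar> \<le> B" and B_meas [measurable]: "partial_deriv k u \<in> borel_measurable borel"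
    using C1c_bounded_supported(2)[OF u, of k] unfolding bounded_supported_def by blast
  obtain R where R: "\<And>x. R < norm x \<Longrightarrow> u x = 0" and u_meas [measurable]: "u \<in> borel_measurable borel"
    using C1c_bounded_supported(1)[OF u] unfolding bounded_supported_def by blast
  have int_u: "integrable lborel u" by (intro bounded_supported_integrable C1c_bounded_supported u)
  have shift: "integrable lborel (\<lambda>x. u (x + c))" "(\<integral>x. u (x + c) \<partial>lborel) = (\<integral>x. u x \<partial>lborel)" for c
  proof -
    have "integrable (distr lborel borel ((+) c)) u" using int_u by (simp add: lborel_distr_plus)
    then show "integrable lborel (\<lambda>x. u (x + c))" by (simp add: integrable_distr_eq add.commute)
    have "(\<integral>x. u x \<partial>lborel) = (\<integral>x. u x \<partial>distr lborel borel ((+) c))" by (simp add: lborel_distr_plus)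
    then show "(\<integral>x. u (x + c) \<partial>lborel) = (\<integral>x. u x \<partial>lborel)" by (simp add: integral_distr add.commute)
  qed
  have "(\<lambda>n. \<integral>x. F n x \<partial>lborel) \<longlonglongrightarrow> (\<integral>x. partial_deriv k u x \<partial>lborel)"
  proof (rule integral_dominated_convergence)
    show "integrable lborel (\<lambda>x. B * indicator (cball 0 (R + 1)) x)"
      by (intro integrable_mult_right integrable_real_indicator) (auto simp: emeasure_lborel_cball_finite[unfolded infinity_ennreal_def])
    show "F n \<in> borel_measurable lborel" for n unfolding F_def by measurable
    show "AE x in lborel. (\<lambda>n. F n x) \<longlonglongrightarrow> partial_deriv k u x"
    proof (intro AE_I2)
      fix x
      have "((\<lambda>h. (u (x + h *\<^sub>R axis k 1) - u x) / h) \<longlongrightarrow> partial_deriv k u x) (at 0)"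
        using line_derivative[of u x 0 k] d by (simp add: DERIV_def)
      moreover have "filterlim s (at 0) sequentially"
        using s0 s by (auto simp: filterlim_at less_imp_neq[symmetric] intro!: always_eventually)
      ultimately show "(\<lambda>n. F n x) \<longlonglongrightarrow> partial_deriv k u x"
        unfolding F_def by (rule filterlim_compose)
    qed
    have "norm (F n x) \<le> B * indicator (cball 0 (R + 1)) x" for n x
    proof (cases "norm x \<le> R + 1")
      case True
      obtain z where "u (x + s n *\<^sub>R axis k 1) - u (x + 0 *\<^sub>R axis k 1) = (s n - 0) * partial_deriv k u (x + z *\<^sub>R axis k 1)"
        using MVT2[of 0 "s n" "\<lambda>t. u (x + t *\<^sub>R axis k 1)" "\<lambda>t. partial_deriv k u (x + t *\<^sub>R axis k 1)"]
          line_derivative[OF d] s by blast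
      then have "F n x = partial_deriv k u (x + z *\<^sub>R axis k 1)" using s[of n] by (simp add: F_def)
      then show ?thesis using B True by simp
    next
      case False
      have "norm x \<le> norm (x + s n *\<^sub>R axis k 1) + norm (s n *\<^sub>R (axis k 1 :: real ^ 'n))"
        using norm_triangle_ineq4[of "x + s n *\<^sub>R axis k 1" "s n *\<^sub>R (axis k 1 :: real ^ 'n)"] by simp
      then have "R < norm (x + s n *\<^sub>R axis k 1)" using False s[of n] by simp
      then show ?thesis using R False by (simp add: F_def)
    qed
    then show "AE x in lborel. norm (F n x) \<le> B * indicator (cball 0 (R + 1)) x" for n by simp
  qed simp
  moreover have "(\<integral>x. F n x \<partial>lborel) = 0" for n
    unfolding F_def by (simp add: shift int_u)
  ultimately show ?thesis by (simp add: LIMSEQ_const_iff)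
qed

lemma integral_by_parts:
  assumes "u \<in> C1c" "v \<in> C1c"
  shows "(\<integral>x. partial_deriv k u x * v x \<partial>lborel) = - (\<integral>x. u x * partial_deriv k v x \<partial>lborel)"
proof -
  have d: "u differentiable (at x)" "v differentiable (at x)" for x using assms by (auto simp: C1c_def)
  have "integrable lborel (\<lambda>x. partial_deriv k u x * v x)" "integrable lborel (\<lambda>x. u x * partial_deriv k v x)"
    by (intro bounded_supported_integrable bounded_supported_mult C1c_bounded_supported assms)+
  then have "(\<integral>x. partial_deriv k u x * v x \<partial>lborel) + (\<integral>x. u x * partial_deriv k v x \<partial>lborel)
      = (\<integral>x. partial_deriv k (\<lambda>x. u x * v x) x \<partial>lborel)"
    by (simp add: partial_deriv_mult[OF d])
  also have "\<dots> = 0" by (intro integral_partial_deriv C1c_mult assms)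
  finally show ?thesis by simp
qed

section \<open>Functions with vanishing integrals over boxes\<close>

text \<open>Boxes are a generator of the Borel sets that is stable under intersection, so within a large
  box the integral of \<open>f\<close> over every Borel set vanishes.\<close>

lemma AE_zero_of_box_integrals:
  fixes f :: "'a::euclidean_space \<Rightarrow> real"
  assumes int: "\<And>a b. integrable lborel (\<lambda>x. indicator (box a b) x * f x)"
    and zero: "\<And>a b. (\<integral>x. indicator (box a b) x * f x \<partial>lborel) = 0"
  shows "AE x in lborel. f x = 0"
proof -
  define A :: "nat \<Rightarrow> 'a set" where "A n = box (- (real n *\<^sub>R One)) (real n *\<^sub>R One)" for n
  have "AE x in lborel. indicator (A n) x * f x = 0" for n
  proof -
    define g where "g x = indicator (A n) x * f x" for x
    have g: "integrable lborel g" unfolding g_def A_def by (rule int)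
    have set: "(\<integral>x. indicator S x * g x \<partial>lborel) = 0" if "S \<in> sets borel" for S
    proof -
      let ?E = "range (\<lambda>(a, b). box a b :: 'a set)"
      have "Int_stable ?E" by (auto simp: Int_stable_def box_Int_box)
      moreover have "?E \<subseteq> Pow UNIV" by simp
      moreover have "S \<in> sigma_sets UNIV ?E" using that by (simp add: borel_eq_box)
      ultimately show ?thesis
      proof (induction rule: sigma_sets_induct_disjoint)
        case (basic S)
        then obtain a b where "S = box a b" by auto
        then have "indicator S x * g x = indicator (box a b \<inter> A n) x * f x" for x
          by (simp add: g_def indicator_inter_arith)
        then show ?case using zero unfolding A_def box_Int_box by simp
      next
        case (compl S)
        then have [measurable]: "S \<in> sets borel" by (simp add: borel_eq_box)
        have "(\<integral>x. indicator (UNIV - S) x * g x \<partial>lborel) = (\<integral>x. g x - indicator S x * g x \<partial>lborel)"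
          by (intro Bochner_Integration.integral_cong) (auto simp: indicator_def)
        also have "\<dots> = (\<integral>x. g x \<partial>lborel) - (\<integral>x. indicator S x * g x \<partial>lborel)"
          using g by (intro Bochner_Integration.integral_diff) (auto intro: integrable_real_mult_indicator simp: mult.commute)
        also have "(\<integral>x. g x \<partial>lborel) = 0" unfolding g_def A_def by (rule zero)
        finally show ?case using compl by simp
      next
        case (union S)
        then have [measurable]: "S i \<in> sets borel" for i by (auto simp: borel_eq_box)
        have "(LINT x:(\<Union>i. S i)|lborel. g x) = (\<Sum>i. LINT x:S i|lborel. g x)"
        proof (rule lebesgue_integral_countable_add)
          show "S i \<inter> S j = {}" if "i \<noteq> j" for i j
            using union(1) that by (auto simp: disjoint_family_on_def)
          show "set_integrable lborel (\<Union>i. S i) g"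
            unfolding set_integrable_def using g by (intro integrable_mult_indicator) auto
        qed simp
        then show ?case using union(3) by (simp add: set_lebesgue_integral_def)
      qed simp
    qed
    have "AE x in lborel. g x = 0"
    proof (rule density_unique_real)
      show "(LINT x:S|lborel. g x) = (LINT x:S|lborel. 0)" if "S \<in> sets lborel" for S
        using set[of S] that by (simp add: set_lebesgue_integral_def)
    qed (use g in auto)
    then show ?thesis by (simp add: g_def)
  qed
  then have "AE x in lborel. \<forall>n. indicator (A n) x * f x = 0" unfolding AE_all_countable by blast
  then show ?thesis
  proof eventually_elim
    fix x assume *: "\<forall>n. indicator (A n) x * f x = 0"
    have "x \<in> (\<Union>n. A n)" unfolding A_def using UN_box_eq_UNIV by blast
    then obtain n where "x \<in> A n" by blast
    with *[rule_format, of n] show "f x = 0" by simp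
  qed
qed

section \<open>The Dirichlet form of a locally bounded weight\<close>

locale locally_bounded_weight =
  fixes w :: "real ^ 'n::finite \<Rightarrow> real"
  assumes measurable_w [measurable]: "w \<in> borel_measurable borel"
    and locally_bounded: "\<And>R. \<exists>B. \<forall>x. norm x \<le> R \<longrightarrow> \<bar>w x\<bar> \<le> B"
begin

abbreviation M :: "(real ^ 'n) measure" where "M \<equiv> weighted_measure w"

lemma sets_M [measurable_cong, simp]: "sets M = sets borel"
  by (simp add: weighted_measure_def)

lemma AE_M: "(AE x in M. P x) \<longleftrightarrow> (AE x in lborel. P x)"
  unfolding weighted_measure_def by (subst AE_density) auto

lemma integrable_M:
  fixes f :: "real ^ 'n \<Rightarrow> real"
  assumes "f \<in> borel_measurable borel"
  shows "integrable M f \<longleftrightarrow> integrable lborel (\<lambda>x. exp (- w x) * f x)"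
  unfolding weighted_measure_def using assms by (subst integrable_density) auto

lemma integral_M:
  fixes f :: "real ^ 'n \<Rightarrow> real"
  assumes "f \<in> borel_measurable borel"
  shows "(\<integral>x. f x \<partial>M) = (\<integral>x. exp (- w x) * f x \<partial>lborel)"
  unfolding weighted_measure_def using assms by (subst integral_density) auto

lemma bounded_supported_l2: "f \<in> bounded_supported \<Longrightarrow> f \<in> l2 M"
proof -
  assume f: "f \<in> bounded_supported"
  then have [measurable]: "f \<in> borel_measurable borel" by (simp add: bounded_supported_def)
  have "integrable lborel (\<lambda>x. exp (-1 * w x) * (f x * f x))"
    by (intro bounded_supported_integrable bounded_supported_exp measurable_w locally_bounded
        bounded_supported_mult f)
  then show ?thesis by (intro l2I) (auto simp: integrable_M power2_eq_square)
qed

text \<open>With this factor, inner products in the weighted space turn into plain Lebesgue integrals,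
  for which partial integration is available although the weight is not differentiable.\<close>

lemma bounded_supported_exp_l2: "f \<in> bounded_supported \<Longrightarrow> (\<lambda>x. exp (w x) * f x) \<in> l2 M"
  using bounded_supported_exp[OF measurable_w locally_bounded, of f 1]
  by (intro bounded_supported_l2) simp

lemma l2_inner_exp:
  assumes f: "f \<in> l2 M" and h: "h \<in> bounded_supported"
  shows "l2_inner M f (\<lambda>x. exp (w x) * h x) = (\<integral>x. f x * h x \<partial>lborel)"
    and "integrable lborel (\<lambda>x. f x * h x)"
proof -
  have [measurable]: "f \<in> borel_measurable borel" "h \<in> borel_measurable borel"
    using f h by (auto simp: l2_def bounded_supported_def)
  have eq: "exp (- w x) * (f x * (exp (w x) * h x)) = f x * h x" for x
    by (simp add: exp_minus)
  show "l2_inner M f (\<lambda>x. exp (w x) * h x) = (\<integral>x. f x * h x \<partial>lborel)"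
    unfolding l2_inner_def by (subst integral_M) (auto simp: eq)
  show "integrable lborel (\<lambda>x. f x * h x)"
    using l2_mult_integrable[OF f bounded_supported_exp_l2[OF h]] by (subst (asm) integrable_M) (auto simp: eq)
qed

lemma partial_deriv_l2: "u \<in> C1c \<Longrightarrow> partial_deriv k u \<in> l2 M"
  by (intro bounded_supported_l2 C1c_bounded_supported)

lemma pre_form_eq:
  assumes "u \<in> C1c" "v \<in> C1c"
  shows "pre_form w u v = 1 / 2 * (\<Sum>k\<in>UNIV. l2_inner M (partial_deriv k u) (partial_deriv k v))"
proof -
  have [measurable]: "partial_deriv k u \<in> borel_measurable borel" "partial_deriv k v \<in> borel_measurable borel" for k
    using C1c_bounded_supported(2) assms by (auto simp: bounded_supported_def)
  have int: "integrable M (\<lambda>x. partial_deriv k u x * partial_deriv k v x)" for k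
    by (intro l2_mult_integrable partial_deriv_l2 assms)
  have "(\<Sum>k\<in>UNIV. l2_inner M (partial_deriv k u) (partial_deriv k v))
      = (\<integral>x. (\<Sum>k\<in>UNIV. partial_deriv k u x * partial_deriv k v x) \<partial>M)"
    unfolding l2_inner_def by (rule Bochner_Integration.integral_sum[symmetric]) (rule int)
  also have "\<dots> = (\<integral>x. (grad u x \<bullet> grad v x) * exp (- w x) \<partial>lborel)"
    by (subst integral_M) (simp_all add: grad_def inner_vec_def mult.commute)
  finally show ?thesis by (simp add: pre_form_def)
qed

interpretation L: semi_inner "l2 M" "l2_inner M"
  by (rule semi_inner_l2)

lemma semi_inner_pre_form: "semi_inner test_functions (pre_form w)"
proof
  show "subspace test_functions" by (rule subspace_test_functions)
  fix x y z :: "real ^ 'n \<Rightarrow> real" and c :: real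
  assume x: "x \<in> test_functions"
  then have xC: "x \<in> C1c" by (rule test_functions_C1c)
  show "0 \<le> pre_form w x x"
    using L.ip_nonneg partial_deriv_l2[OF xC] by (simp add: pre_form_eq[OF xC xC] sum_nonneg)
  assume y: "y \<in> test_functions"
  then have yC: "y \<in> C1c" by (rule test_functions_C1c)
  have sC: "c *\<^sub>R x \<in> C1c" using test_functions_lin[OF x x, of c 0] by (intro test_functions_C1c) simp
  show "pre_form w (c *\<^sub>R x) y = c * pre_form w x y"
    using partial_deriv_l2[OF xC] partial_deriv_l2[OF yC]
    by (simp add: pre_form_eq[OF xC yC] pre_form_eq[OF sC yC] partial_deriv_C1c_lin[OF xC xC]
        L.ip_scale sum_distrib_left)
  show "pre_form w x y = pre_form w y x"
    using L.ip_sym partial_deriv_l2[OF xC] partial_deriv_l2[OF yC]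
    by (simp add: pre_form_eq[OF xC yC] pre_form_eq[OF yC xC])
  assume z: "z \<in> test_functions"
  then have zC: "z \<in> C1c" by (rule test_functions_C1c)
  have aC: "x + y \<in> C1c" using test_functions_lin[OF x y, of 1 1] by (intro test_functions_C1c) simp
  show "pre_form w (x + y) z = pre_form w x z + pre_form w y z"
    using partial_deriv_l2[OF xC] partial_deriv_l2[OF yC] partial_deriv_l2[OF zC]
    by (simp add: pre_form_eq[OF xC zC] pre_form_eq[OF yC zC] pre_form_eq[OF aC zC]
        partial_deriv_C1c_lin[OF xC yC] L.ip_add sum.distrib algebra_simps)
qed

lemma test_functions_l2: "test_functions \<subseteq> l2 M"
  using bounded_supported_l2 C1c_bounded_supported(1) test_functions_C1c by blast

text \<open>For a test function \<open>\<psi>\<close>, partial integration turns the integral of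
  \<open>partial_deriv k (\<rho> n) * \<psi>\<close> into one of \<open>\<rho> n * partial_deriv k \<psi>\<close>, which tends to 0. Hence \<open>F\<close>
  integrates to 0 against all test functions, in particular against the bumps that converge to the
  indicator of a box.\<close>

lemma weak_gradient_of_null:
  assumes \<rho>: "\<And>n. \<rho> n \<in> test_functions" and \<rho>0: "(\<lambda>n. l2_norm M (\<rho> n)) \<longlonglongrightarrow> 0"
    and F: "F \<in> l2 M" and lim: "(\<lambda>n. l2_norm M (partial_deriv k (\<rho> n) - F)) \<longlonglongrightarrow> 0"
  shows "l2_norm M F = 0"
proof -
  note \<rho>C = test_functions_C1c[OF \<rho>]
  have \<rho>l: "\<rho> n \<in> l2 M" for n using \<rho> test_functions_l2 by blast
  have [measurable]: "F \<in> borel_measurable borel"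
    using F by (simp add: l2_def measurable_cong_sets[OF sets_M refl])
  have test_zero: "(\<integral>x. F x * \<psi> x \<partial>lborel) = 0" if \<psi>: "\<psi> \<in> test_functions" for \<psi>
  proof -
    note \<psi>C = test_functions_C1c[OF \<psi>]
    have "(\<lambda>n. l2_inner M (partial_deriv k (\<rho> n)) (\<lambda>x. exp (w x) * \<psi> x))
        \<longlonglongrightarrow> l2_inner M F (\<lambda>x. exp (w x) * \<psi> x)"
      by (rule L.tendsto_ip)
         (use F lim in \<open>auto simp: l2_norm_eq intro: partial_deriv_l2 \<rho>C bounded_supported_exp_l2
            C1c_bounded_supported(1)[OF \<psi>C]\<close>)
    moreover have "l2_inner M (partial_deriv k (\<rho> n)) (\<lambda>x. exp (w x) * \<psi> x)
        = - l2_inner M (\<rho> n) (\<lambda>x. exp (w x) * partial_deriv k \<psi> x)" for n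
      using l2_inner_exp(1)[OF partial_deriv_l2[OF \<rho>C] C1c_bounded_supported(1)[OF \<psi>C]]
        l2_inner_exp(1)[OF \<rho>l C1c_bounded_supported(2)[OF \<psi>C]] integral_by_parts[OF \<rho>C \<psi>C]
      by simp
    moreover have "(\<lambda>n. - l2_inner M (\<rho> n) (\<lambda>x. exp (w x) * partial_deriv k \<psi> x))
        \<longlonglongrightarrow> - l2_inner M 0 (\<lambda>x. exp (w x) * partial_deriv k \<psi> x)"
      by (intro tendsto_minus L.tendsto_ip)
         (use \<rho>0 in \<open>auto simp: l2_norm_eq intro: \<rho>l bounded_supported_exp_l2
            C1c_bounded_supported(2)[OF \<psi>C]\<close>)
    moreover have "l2_inner M 0 (\<lambda>x. exp (w x) * partial_deriv k \<psi> x) = 0"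
      by (simp add: l2_inner_def)
    ultimately have "l2_inner M F (\<lambda>x. exp (w x) * \<psi> x) = 0"
      using LIMSEQ_unique by fastforce
    then show ?thesis using l2_inner_exp(1)[OF F C1c_bounded_supported(1)[OF \<psi>C]] by simp
  qed
  have "AE x in lborel. F x = 0"
  proof (rule AE_zero_of_box_integrals)
    fix a b :: "real ^ 'n"
    have ind: "indicator (box a b) \<in> bounded_supported"
    proof -
      obtain R where "\<forall>x\<in>box a b. norm x \<le> R" using bounded_box[of a b] by (auto simp: bounded_iff)
      then show ?thesis unfolding bounded_supported_def
        by (intro CollectI conjI exI[of _ 1] exI[of _ R]) (auto simp: indicator_def)
    qed
    show int: "integrable lborel (\<lambda>x. indicator (box a b) x * F x)"
      using l2_inner_exp(2)[OF F ind] by (simp add: mult.commute)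
    have "(\<lambda>n. \<integral>x. F x * box_bump a b (real (Suc n)) x \<partial>lborel) \<longlonglongrightarrow> (\<integral>x. indicator (box a b) x * F x \<partial>lborel)"
    proof (rule integral_dominated_convergence)
      show "integrable lborel (\<lambda>x. \<bar>indicator (box a b) x * F x\<bar>)" using int by simp
      have "box_bump a b (real (Suc n)) \<in> bounded_supported" for n
        by (intro C1c_bounded_supported(1) test_functions_C1c box_bump_test) simp
      then have [measurable]: "box_bump a b (real (Suc n)) \<in> borel_measurable borel" for n
        by (simp only: bounded_supported_def mem_Collect_eq)
      show "(\<lambda>x. F x * box_bump a b (real (Suc n)) x) \<in> borel_measurable lborel" for n
        by measurable
      show "AE x in lborel. (\<lambda>n. F x * box_bump a b (real (Suc n)) x) \<longlonglongrightarrow> indicator (box a b) x * F x"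
      proof (intro AE_I2)
        fix x
        show "(\<lambda>n. F x * box_bump a b (real (Suc n)) x) \<longlonglongrightarrow> indicator (box a b) x * F x"
          using tendsto_mult[OF tendsto_const box_bump_tendsto, of "F x" a b x]
          by (simp only: mult.commute[of "F x" "indicator _ _"])
      qed
      have "norm (F x * box_bump a b (real (Suc n)) x) \<le> \<bar>indicator (box a b) x * F x\<bar>" for n x
        using mult_left_mono[OF box_bump_bounds[of "real (Suc n)" a b x], of "\<bar>F x\<bar>"]
        by (simp add: abs_mult mult.commute)
      then show "AE x in lborel. norm (F x * box_bump a b (real (Suc n)) x) \<le> \<bar>indicator (box a b) x * F x\<bar>" for n
        by simp
    qed (use int in simp)
    then show "(\<integral>x. indicator (box a b) x * F x \<partial>lborel) = 0"
      by (simp add: test_zero box_bump_test LIMSEQ_const_iff)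
  qed
  then show ?thesis using F by (simp add: l2_norm_zero_iff AE_M)
qed

lemma pre_form_closable:
  assumes \<rho>: "\<And>n. \<rho> n \<in> test_functions" and \<rho>0: "(\<lambda>n. l2_norm M (\<rho> n)) \<longlonglongrightarrow> 0"
    and Cauchy: "\<And>\<epsilon>. \<epsilon> > 0 \<Longrightarrow> \<exists>N. \<forall>m\<ge>N. \<forall>n\<ge>N. pre_form w (\<rho> m - \<rho> n) (\<rho> m - \<rho> n) < \<epsilon>"
  shows "(\<lambda>n. pre_form w (\<rho> n) (\<rho> n)) \<longlonglongrightarrow> 0"
proof -
  note \<rho>C = test_functions_C1c[OF \<rho>]
  have dl: "partial_deriv k (\<rho> n) \<in> l2 M" for k n by (rule partial_deriv_l2[OF \<rho>C])
  have form_norm: "pre_form w u u = 1 / 2 * (\<Sum>k\<in>UNIV. (l2_norm M (partial_deriv k u))\<^sup>2)" if "u \<in> C1c" for u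
    using L.nrm_sq[OF partial_deriv_l2[OF that]] by (simp add: pre_form_eq[OF that that] l2_norm_eq)
  have lim0: "(\<lambda>n. l2_norm M (partial_deriv k (\<rho> n))) \<longlonglongrightarrow> 0" for k
  proof -
    have "\<exists>F\<in>l2 M. (\<lambda>n. l2_norm M (partial_deriv k (\<rho> n) - F)) \<longlonglongrightarrow> 0"
    proof (rule l2_complete)
      fix \<epsilon> :: real assume \<epsilon>: "\<epsilon> > 0"
      then obtain N where N: "\<And>m n. m \<ge> N \<Longrightarrow> n \<ge> N \<Longrightarrow> pre_form w (\<rho> m - \<rho> n) (\<rho> m - \<rho> n) < \<epsilon>\<^sup>2 / 2"
        using Cauchy[of "\<epsilon>\<^sup>2 / 2"] by auto
      have "l2_norm M (partial_deriv k (\<rho> m) - partial_deriv k (\<rho> n)) < \<epsilon>" if "m \<ge> N" "n \<ge> N" for m n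
      proof -
        have "\<rho> m - \<rho> n \<in> test_functions" using test_functions_lin[OF \<rho> \<rho>, of 1 m "-1" n] by simp
        then have C: "\<rho> m - \<rho> n \<in> C1c" by (rule test_functions_C1c)
        have "(l2_norm M (partial_deriv k (\<rho> m - \<rho> n)))\<^sup>2 \<le> (\<Sum>k\<in>UNIV. (l2_norm M (partial_deriv k (\<rho> m - \<rho> n)))\<^sup>2)"
          by (rule member_le_sum) auto
        then have "(l2_norm M (partial_deriv k (\<rho> m - \<rho> n)))\<^sup>2 < \<epsilon>\<^sup>2"
          using N[OF that] by (simp add: form_norm[OF C])
        then show ?thesis using \<epsilon> by (simp add: partial_deriv_C1c_lin[OF \<rho>C \<rho>C] power_less_imp_less_base)
      qed
      then show "\<exists>N. \<forall>m\<ge>N. \<forall>n\<ge>N. l2_norm M (partial_deriv k (\<rho> m) - partial_deriv k (\<rho> n)) < \<epsilon>" by blast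
    qed (rule dl)
    then obtain F where F: "F \<in> l2 M" "(\<lambda>n. l2_norm M (partial_deriv k (\<rho> n) - F)) \<longlonglongrightarrow> 0" by blast
    have F0: "l2_norm M F = 0" by (rule weak_gradient_of_null[OF \<rho> \<rho>0 F])
    have "l2_norm M (partial_deriv k (\<rho> n) - F) = l2_norm M (partial_deriv k (\<rho> n))" for n
      using L.nrm_eqI[of "partial_deriv k (\<rho> n)" "partial_deriv k (\<rho> n) - F"] F F0 dl
      by (simp add: l2_norm_eq)
    then show ?thesis using F(2) by simp
  qed
  have "(\<lambda>n. 1 / 2 * (\<Sum>k\<in>UNIV. (l2_norm M (partial_deriv k (\<rho> n)))\<^sup>2)) \<longlonglongrightarrow> 1 / 2 * (\<Sum>k\<in>(UNIV :: 'n set). 0\<^sup>2)"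
    by (intro tendsto_intros lim0)
  then show ?thesis by (simp add: form_norm[OF \<rho>C])
qed

sublocale closable_form "l2 M" "l2_inner M" test_functions "pre_form w"
proof -
  interpret semi_hilbert "l2 M" "l2_inner M" by (rule semi_hilbert_l2)
  interpret form: semi_inner test_functions "pre_form w" by (rule semi_inner_pre_form)
  show "closable_form (l2 M) (l2_inner M) test_functions (pre_form w)"
    by unfold_locales (use test_functions_l2 pre_form_closable in \<open>auto simp: l2_norm_eq\<close>)
qed

lemma approx_eq: "approx \<phi> u \<longleftrightarrow> form_approx w \<phi> u"
  unfolding approx_def form_approx_def by (simp add: l2_norm_eq fun_diff_def)

lemma dom_eq: "dom = form_domain w"
  unfolding dom_def form_domain_def by (simp add: approx_eq)

lemma E_eq: "E u v = dirichlet_form w u v"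
  unfolding E_def dirichlet_form_def by (simp add: approx_eq)

text \<open>The generator of the Dirichlet form is nonpositive and \<open>gen\<close> is nonnegative, whence the
  sign.\<close>

lemma gen_eq: "neg_graph (dirichlet_generator w) = gen"
proof -
  have "(u, g) \<in> neg_graph (dirichlet_generator w) \<longleftrightarrow> (u, g) \<in> gen" for u g
  proof
    assume "(u, g) \<in> gen"
    then have "(u, \<lambda>x. - g x) \<in> dirichlet_generator w"
      using L.scale_mem[of g "-1"]
      by (auto simp: gen_def dirichlet_generator_def dom_eq E_eq scaleR_fun_def)
    then show "(u, g) \<in> neg_graph (dirichlet_generator w)"
      unfolding neg_graph_def by force
  next
    assume "(u, g) \<in> neg_graph (dirichlet_generator w)"
    then obtain f where f: "g = (\<lambda>x. - f x)" "(u, f) \<in> dirichlet_generator w"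
      by (auto simp: neg_graph_def)
    then show "(u, g) \<in> gen"
      using L.scale_mem[of f "-1"]
      by (auto simp: gen_def dirichlet_generator_def dom_eq E_eq scaleR_fun_def)
  qed
  then show ?thesis by auto
qed

lemma spectrum_nonneg: "spectrum M gen \<subseteq> {0..}"
proof
  fix z assume z: "z \<in> spectrum M gen"
  show "z \<in> {0..}"
  proof (rule ccontr)
    assume "z \<notin> {0..}"
    then have s: "- z > 0" by simp
    have "z \<in> resolvent_set M gen"
      unfolding resolvent_set_def
    proof (intro CollectI conjI)
      show "\<forall>f\<in>l2 M. \<exists>u g. (u, g) \<in> gen \<and> (AE x in M. g x - z * u x = f x)"
      proof
        fix f assume "f \<in> l2 M"
        then obtain u where "(u, f - (- z) *\<^sub>R u) \<in> gen" using gen_resolvent[OF _ s] by blast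
        then show "\<exists>u g. (u, g) \<in> gen \<and> (AE x in M. g x - z * u x = f x)"
          by (intro exI[of _ u] exI[of _ "f - (- z) *\<^sub>R u"]) simp
      qed
      show "\<exists>C. \<forall>(u, g)\<in>gen. l2_norm M u \<le> C * l2_norm M (\<lambda>x. g x - z * u x)"
      proof (intro exI[of _ "1 / - z"] ballI, clarify)
        fix u g assume "(u, g) \<in> gen"
        from gen_bound[OF this s] show "l2_norm M u \<le> 1 / - z * l2_norm M (\<lambda>x. g x - z * u x)"
          by (simp add: l2_norm_eq plus_fun_def scaleR_fun_def fun_diff_def)
      qed
    qed
    then show False using z by (simp add: spectrum_def)
  qed
qed

lemma bounded_below_of_resolvent:
  assumes "z \<in> resolvent_set M gen"
  shows "\<exists>C. \<forall>(u, g)\<in>gen. l2_norm M u \<le> C * l2_norm M (g - z *\<^sub>R u)"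
  using assms unfolding resolvent_set_def by (simp add: fun_diff_def scaleR_fun_def)

end

section \<open>The bottom of the essential spectrum\<close>

locale low_energy_weight = locally_bounded_weight +
  low_energy "l2 (weighted_measure w)" "l2_inner (weighted_measure w)" test_functions "pre_form w" u for u
begin

text \<open>That 0 is spectral follows from the approximate null vectors \<open>u n\<close>; that it is not discrete,
  from \<open>kernel_not_finite_dimensional\<close>, as an isolated point has a gap above it.\<close>

lemma zero_in_ess_spectrum: "0 \<in> ess_spectrum M gen"
proof -
  have spec: "0 \<in> spectrum M gen"
  proof -
    have False if "0 \<in> resolvent_set M gen"
      using bounded_below_of_resolvent[OF that] not_bounded_below unfolding l2_norm_eq by simp
    then show ?thesis by (auto simp: spectrum_def)
  qed
  moreover have "0 \<notin> discrete_spectrum M gen"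
  proof
    assume d: "0 \<in> discrete_spectrum M gen"
    then have "0 isolated_in spectrum M gen" by (simp add: discrete_spectrum_def)
    then obtain T where T: "open T" "T \<inter> spectrum M gen = {0}" by (auto simp: isolated_in_def)
    then obtain \<delta> where \<delta>: "\<delta> > 0" "ball 0 \<delta> \<subseteq> T" by (metis Int_iff insertI1 open_contains_ball)
    have res: "\<exists>C. \<forall>(v, g)\<in>gen. nrm v \<le> C * nrm (g - z *\<^sub>R v)" if "0 < z" "z < \<delta>" for z
    proof -
      have "z \<in> T" by (rule subsetD[OF \<delta>(2)]) (use that in \<open>simp add: dist_real_def\<close>)
      then have "z \<notin> spectrum M gen" using T(2) that(1) by (metis Int_iff less_irrefl singletonD)
      then have "z \<in> resolvent_set M gen" by (simp add: spectrum_def)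
      from bounded_below_of_resolvent[OF this] show ?thesis by (simp add: l2_norm_eq)
    qed
    obtain F where F: "F \<subseteq> eigenspace M gen 0" "finite F"
      "\<And>v. v \<in> eigenspace M gen 0 \<Longrightarrow> \<exists>c. AE x in M. v x = (\<Sum>b\<in>F. c b * b x)"
      using d unfolding discrete_spectrum_def finite_dim_def by blast
    have gen_l2: "v \<in> l2 M" "g \<in> l2 M" if "(v, g) \<in> gen" for v g
      using that by (auto simp: gen_def)
    show False
    proof (rule kernel_not_finite_dimensional[OF \<delta>(1) res F(2)])
      show "F \<subseteq> l2 M" using F(1) gen_l2 by (auto simp: eigenspace_def)
      fix v g assume vg: "(v, g) \<in> gen" "nrm g = 0"
      then have "v \<in> eigenspace M gen 0"
        using gen_l2[OF vg(1)] by (auto simp: eigenspace_def l2_norm_eq l2_norm_zero_iff)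
      then obtain c where c: "AE x in M. v x = (\<Sum>b\<in>F. c b * b x)" using F(3) by blast
      have "(\<Sum>b\<in>F. c b *\<^sub>R b) x = (\<Sum>b\<in>F. c b * b x)" for x
        by (induction F rule: infinite_finite_induct) auto
      then have "AE x in M. (v - (\<Sum>b\<in>F. c b *\<^sub>R b)) x = 0" using c by simp
      moreover have "v - (\<Sum>b\<in>F. c b *\<^sub>R b) \<in> l2 M"
        using \<open>F \<subseteq> l2 M\<close> gen_l2[OF vg(1)] by (intro diff_mem sum_mem scale_mem) auto
      ultimately have "l2_norm M (v - (\<Sum>b\<in>F. c b *\<^sub>R b)) = 0"
        by (subst l2_norm_zero_iff)
      then show "\<exists>c. nrm (v - (\<Sum>b\<in>F. c b *\<^sub>R b)) = 0"
        unfolding l2_norm_eq by blast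
    qed
  qed
  ultimately show ?thesis by (simp add: ess_spectrum_def)
qed

theorem lambda_ess_eq_0: "lambda_ess w = 0"
proof (rule antisym)
  show "lambda_ess w \<le> 0"
    unfolding lambda_ess_def gen_eq using zero_in_ess_spectrum
    by (intro Inf_lower) (auto simp: zero_ereal_def)
  show "0 \<le> lambda_ess w"
    unfolding lambda_ess_def gen_eq
    by (rule Inf_greatest) (use spectrum_nonneg in \<open>auto simp: ess_spectrum_def\<close>)
qed

theorem not_compact_semigroup:
  assumes P: "semigroup_generated_by M (dirichlet_generator w) P"
  shows "\<not> compact_semigroup M P"
proof
  assume compact: "compact_semigroup M P"
  note P' = P[unfolded semigroup_generated_by_def]
  have bd: "bounded_operator M (P t)" if "t > 0" for t using P' that by blast
  have PH: "P t x \<in> l2 M" if "t > 0" "x \<in> l2 M" for t x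
    using bd[OF that(1)] that(2) by (auto simp: bounded_operator_def)
  show False
  proof (rule semigroup_not_compact[of P])
    fix t :: real assume t: "t > 0"
    fix x y assume x: "x \<in> l2 M" and y: "y \<in> l2 M"
    fix a b :: real
    have "AE z in M. P t (\<lambda>z. a * x z + b * y z) z = a * P t x z + b * P t y z"
      using bd[OF t] x y unfolding bounded_operator_def by blast
    then have "AE z in M. (P t (a *\<^sub>R x + b *\<^sub>R y) - (a *\<^sub>R P t x + b *\<^sub>R P t y)) z = 0"
      by (simp add: plus_fun_def scaleR_fun_def)
    then show "nrm (P t (a *\<^sub>R x + b *\<^sub>R y) - (a *\<^sub>R P t x + b *\<^sub>R P t y)) = 0"
      using PH[OF t] x y by (simp add: l2_norm_eq l2_norm_zero_iff)
  next
    fix t :: real assume t: "t > 0"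
    show "\<exists>C. \<forall>x\<in>l2 M. nrm (P t x) \<le> C * nrm x"
      using bd[OF t] unfolding bounded_operator_def l2_norm_eq by blast
  next
    fix s t :: real and x assume st: "s > 0" "t > 0" and x: "x \<in> l2 M"
    have "AE z in M. P (s + t) x z = P s (P t x) z" using P' st x by blast
    then have "AE z in M. (P (s + t) x - P s (P t x)) z = 0" by simp
    then show "nrm (P (s + t) x - P s (P t x)) = 0"
      using PH st x by (simp add: l2_norm_eq l2_norm_zero_iff)
  next
    fix x assume x: "x \<in> l2 M"
    show "((\<lambda>t. nrm (P t x - x)) \<longlongrightarrow> 0) (at_right 0)"
      using P' x unfolding l2_norm_eq fun_diff_def by blast
  next
    fix v g assume vg: "(v, g) \<in> gen"
    then have v: "v \<in> l2 M" "g \<in> l2 M" by (auto simp: gen_def)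
    obtain f where f: "g = (\<lambda>x. - f x)" "(v, f) \<in> dirichlet_generator w"
      using vg unfolding gen_eq[symmetric] by (auto simp: neg_graph_def)
    have "f \<in> l2 M" using f(2) by (simp add: dirichlet_generator_def)
    then have "((\<lambda>t. l2_norm M (\<lambda>x. (P t v x - v x) / t - f x)) \<longlongrightarrow> 0) (at_right 0)"
      using P' f v by blast
    moreover have "(\<lambda>x. (P t v x - v x) / t - f x) = (1 / t) *\<^sub>R (P t v - v) + g" for t
      by (auto simp: f)
    ultimately show "((\<lambda>t. nrm ((1 / t) *\<^sub>R (P t v - v) + g)) \<longlongrightarrow> 0) (at_right 0)"
      by (simp add: l2_norm_eq)
  next
    fix t :: real assume t: "t > 0"
    have "\<forall>n. u n \<in> l2 M" "\<exists>C. \<forall>n. l2_norm M (u n) \<le> C"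
      using nrm_u by (auto simp: l2_norm_eq)
    then obtain r g where "strict_mono r" "g \<in> l2 M" "(\<lambda>n. l2_norm M (\<lambda>x. P t (u (r n)) x - g x)) \<longlonglongrightarrow> 0"
      using compact t unfolding compact_semigroup_def compact_operator_def by blast
    then show "\<exists>r g. strict_mono (r :: nat \<Rightarrow> nat) \<and> g \<in> l2 M \<and> (\<lambda>n. nrm (P t (u (r n)) - g)) \<longlonglongrightarrow> 0"
      unfolding l2_norm_eq fun_diff_def by blast
  qed (use PH in auto)
qed

end

section \<open>Weights on the line without exponential growth or decay\<close>

text \<open>Fubini's theorem, in coordinates: Lebesgue measure on a Euclidean space is the image of the
  product measure indexed by its basis.\<close>

lemma integral_coordinate_product:
  fixes f :: "'n::finite \<Rightarrow> real \<Rightarrow> real"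
  assumes f: "\<And>k. integrable lborel (f k)"
  shows "(\<integral>x. (\<Prod>k\<in>UNIV. f k (x $ k)) \<partial>(lborel :: (real ^ 'n) measure)) = (\<Prod>k\<in>UNIV. \<integral>t. f k t \<partial>lborel)"
proof -
  have [measurable]: "f k \<in> borel_measurable borel" for k using f[of k] by auto
  define ax :: "'n \<Rightarrow> real ^ 'n" where "ax k = axis k 1" for k
  have bij: "bij_betw ax UNIV Basis"
    unfolding bij_betw_def by (auto simp: ax_def inj_on_def axis_eq_axis Basis_vec_def)
  define g where "g b = f (the_inv_into UNIV ax b)" for b
  have g_ax: "g (ax k) = f k" for k
    using bij by (simp add: g_def bij_betw_def the_inv_into_f_f)
  interpret product_sigma_finite "\<lambda>_ :: real ^ 'n. lborel :: real measure" by standard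
  have nth: "(\<Sum>b\<in>Basis. h b *\<^sub>R b) $ k = h (ax k)" for h :: "real ^ 'n \<Rightarrow> real" and k
  proof -
    have "(\<Sum>b\<in>Basis. h b *\<^sub>R b) $ k = (\<Sum>b\<in>Basis. h b *\<^sub>R b) \<bullet> ax k"
      by (simp add: ax_def inner_axis)
    also have "\<dots> = h (ax k)" by (rule inner_sum_left_Basis) (simp add: ax_def axis_in_Basis_iff)
    finally show ?thesis .
  qed
  have "(\<integral>x. (\<Prod>k\<in>UNIV. f k (x $ k)) \<partial>(lborel :: (real ^ 'n) measure))
      = (\<integral>h. (\<Prod>k\<in>UNIV. f k (h (ax k))) \<partial>(\<Pi>\<^sub>M b\<in>Basis. lborel))"
    unfolding lborel_def[where 'a = "real ^ 'n"] lborel_eq_real[symmetric]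
    by (subst integral_distr) (simp_all add: nth del: sum_component)
  also have "\<dots> = (\<integral>h. (\<Prod>b\<in>Basis. g b (h b)) \<partial>(\<Pi>\<^sub>M b\<in>Basis. lborel))"
    by (simp add: prod.reindex_bij_betw[OF bij, symmetric] g_ax)
  also have "\<dots> = (\<Prod>b\<in>Basis. \<integral>t. g b t \<partial>lborel)"
    using f by (intro product_integral_prod) (auto simp: g_def)
  also have "\<dots> = (\<Prod>k\<in>UNIV. \<integral>t. f k t \<partial>lborel)"
    by (simp add: prod.reindex_bij_betw[OF bij, symmetric] g_ax)
  finally show ?thesis .
qed

text \<open>If \<open>m\<close> fails the inequality everywhere beyond \<open>k\<close>, it is strongly convex there: once it does
  not decrease, it doubles at each further step, and if it decreases forever, it halves. In both
  cases it leaves the range allowed by the hypothesis for \<open>q = sqrt 2\<close>.\<close>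

lemma no_exponential_dichotomy:
  fixes m :: "nat \<Rightarrow> real"
  assumes subexp: "\<And>q N. q > 1 \<Longrightarrow> \<exists>n\<ge>N. 1 / q ^ n \<le> m n \<and> m n \<le> q ^ n"
    and pos: "\<And>n. m n > 0"
  shows "\<exists>i\<ge>k. m i + m (i + 2) \<le> 3 * m (i + 1)"
proof (rule ccontr)
  assume "\<not> ?thesis"
  then have conv: "3 * m (i + 1) < m i + m (i + 2)" if "i \<ge> k" for i using that by force
  define q where "q = sqrt (2 :: real)"
  have q: "q > 1" and qq: "2 ^ n = q ^ n * q ^ n" for n
    by (simp_all add: q_def power_mult_distrib[symmetric])
  have large: "\<exists>N. \<forall>n\<ge>N. C < c * q ^ n" if "c > 0" for c C
  proof -
    obtain N where N: "C / c < q ^ N" using real_arch_pow[OF q] by blast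
    have "C < c * q ^ n" if "n \<ge> N" for n
    proof -
      have "C / c < q ^ n" using less_le_trans[OF N power_increasing[OF that]] q by simp
      then show ?thesis using \<open>c > 0\<close> by (simp add: field_simps)
    qed
    then show ?thesis by blast
  qed
  show False
  proof (cases "\<exists>i\<ge>k. m i \<le> m (i + 1)")
    case True
    then obtain i where i: "i \<ge> k" "m i \<le> m (i + 1)" by blast
    have grow: "m (i + j) \<le> m (i + j + 1) \<and> m (i + 1) * 2 ^ j \<le> m (i + j + 1)" for j
    proof (induction j)
      case (Suc j)
      have "2 * m (i + j + 1) \<le> m (i + j + 2)" using conv[of "i + j"] i Suc by simp
      then show ?case using Suc pos[of "i + j + 1"] by (simp add: algebra_simps)
    qed (use i in simp)
    define c where "c = m (i + 1) / 2 ^ (i + 1)"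
    have c: "c > 0" using pos by (simp add: c_def)
    obtain N where N: "\<And>n. n \<ge> N \<Longrightarrow> 1 < c * q ^ n" using large[OF c, of 1] by blast
    obtain n where n: "n \<ge> N + i + 1" "m n \<le> q ^ n" using subexp[OF q] by blast
    obtain j where j: "n = i + j + 1" using n(1) by (metis add.commute add.left_commute le_Suc_ex)
    have "c * 2 ^ n \<le> q ^ n" using grow[of j] n(2) by (simp add: c_def j power_add)
    then have "q ^ n * (c * q ^ n) \<le> q ^ n * 1" by (simp add: qq algebra_simps)
    then have "c * q ^ n \<le> 1" using q by (simp add: mult_le_cancel_left_pos)
    then show False using N[of n] n(1) by simp
  next
    case False
    have decay: "m (k + j) * 2 ^ j \<le> m k" for j
    proof (induction j)
      case (Suc j)
      have "2 * m (k + j + 1) \<le> m (k + j)"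
        using conv[of "k + j"] False[simplified, rule_format, of "k + j + 1"] by simp
      then have "2 ^ j * (2 * m (k + j + 1)) \<le> 2 ^ j * m (k + j)" by (intro mult_left_mono) auto
      also have "\<dots> \<le> m k" using Suc by (simp add: mult.commute)
      finally show ?case by (simp add: algebra_simps)
    qed simp
    define c where "c = 1 / (m k * 2 ^ k)"
    have c: "c > 0" using pos by (simp add: c_def)
    obtain N where N: "\<And>n. n \<ge> N \<Longrightarrow> 1 < c * q ^ n" using large[OF c, of 1] by blast
    obtain n where n: "n \<ge> N + k" "1 / q ^ n \<le> m n" using subexp[OF q] by blast
    obtain j where j: "n = k + j" using n(1) by (metis add_leD2 le_Suc_ex)
    have "2 ^ n / q ^ n \<le> m n * 2 ^ n" using mult_right_mono[OF n(2), of "2 ^ n"] by simp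
    also have "\<dots> = m (k + j) * 2 ^ j * 2 ^ k" by (simp add: j power_add)
    also have "\<dots> \<le> m k * 2 ^ k" using decay[of j] by (intro mult_right_mono) auto
    finally have "q ^ n \<le> m k * 2 ^ k" using q by (simp add: qq)
    then have "c * q ^ n \<le> 1" using pos by (simp add: c_def field_simps)
    then show False using N[of n] n(1) by simp
  qed
qed

lemma bump_bounded_supported: "s > 0 \<Longrightarrow> bump a b s n \<in> bounded_supported"
proof (rule continuous_bounded_supported)
  show "continuous_on UNIV (bump a b s n)"
    using derivativesD[OF derivatives_bump] by (meson DERIV_isCont continuous_at_imp_continuous_on)
  assume s: "s > 0"
  show "bounded {x. bump a b s n x \<noteq> 0}"
  proof (rule bounded_subset)
    show "{x. bump a b s n x \<noteq> 0} \<subseteq> {a..b}"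
    proof
      fix x assume "x \<in> {x. bump a b s n x \<noteq> 0}"
      then have "a < x \<and> x < b" using bump_outside[OF s, of a x b n] by blast
      then show "x \<in> {a..b}" by simp
    qed
  qed simp
qed

locale locally_bounded_line =
  fixes \<omega> :: "real \<Rightarrow> real"
  assumes measurable_\<omega> [measurable]: "\<omega> \<in> borel_measurable borel"
    and locally_bounded_\<omega>: "\<And>R. \<exists>B. \<forall>x. norm x \<le> R \<longrightarrow> \<bar>\<omega> x\<bar> \<le> B"
begin

definition wint :: "(real \<Rightarrow> real) \<Rightarrow> real" where
  "wint f = (\<integral>x. exp (- \<omega> x) * f x \<partial>lborel)"

lemma wint_integrable: "f \<in> bounded_supported \<Longrightarrow> integrable lborel (\<lambda>x. exp (- \<omega> x) * f x)"
  using bounded_supported_exp[OF measurable_\<omega> locally_bounded_\<omega>, of f "-1"]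
  by (intro bounded_supported_integrable) simp

lemma wint_add:
  assumes "f \<in> bounded_supported" "g \<in> bounded_supported"
  shows "wint (\<lambda>x. f x + g x) = wint f + wint g"
  using assms by (simp add: wint_def distrib_left wint_integrable)

lemma wint_mono:
  assumes "f \<in> bounded_supported" "g \<in> bounded_supported" "\<And>x. f x \<le> g x"
  shows "wint f \<le> wint g"
  unfolding wint_def
  by (rule integral_mono) (use assms wint_integrable in auto)

lemma indicator_bounded_supported: "indicator {a..b :: real} \<in> bounded_supported"
  by (rule bounded_supportedI[of _ 1 "max \<bar>a\<bar> \<bar>b\<bar>"]) (auto simp: indicator_def)

definition mass :: "real \<Rightarrow> nat \<Rightarrow> real" where
  "mass h i = wint (indicator {real i * h..real (i + 1) * h})"

lemma mass_bounds:
  assumes "h > 0" and b: "\<And>x. 0 \<le> x \<Longrightarrow> x \<le> real (i + 1) * h \<Longrightarrow> \<bar>\<omega> x\<bar> \<le> B"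
  shows "h * exp (- B) \<le> mass h i" "mass h i \<le> h * exp B"
proof -
  let ?I = "{real i * h..real (i + 1) * h}"
  have emeasure: "integral\<^sup>L lborel (indicator ?I) = h"
    using assms(1) by (simp add: algebra_simps)
  have int: "integrable lborel (\<lambda>x. c * indicator ?I x :: real)" for c
    by (intro integrable_mult_right bounded_supported_integrable indicator_bounded_supported)
  have B: "\<bar>\<omega> x\<bar> \<le> B" if "x \<in> ?I" for x
    using that assms(1) by (intro b) (auto intro: order_trans[of 0 "real i * h"])
  have "exp (- B) * indicator ?I x \<le> exp (- \<omega> x) * indicator ?I x" for x
    using B[of x] by (auto simp: indicator_def abs_le_iff)
  then have "(\<integral>x. exp (- B) * indicator ?I x \<partial>lborel) \<le> mass h i"
    unfolding mass_def wint_def by (intro integral_mono int wint_integrable indicator_bounded_supported)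
  then show "h * exp (- B) \<le> mass h i" using emeasure by (simp add: mult.commute)
  have "exp (- \<omega> x) * indicator ?I x \<le> exp B * indicator ?I x" for x
    using B[of x] by (auto simp: indicator_def abs_le_iff)
  then have "mass h i \<le> (\<integral>x. exp B * indicator ?I x \<partial>lborel)"
    unfolding mass_def wint_def by (intro integral_mono int wint_integrable indicator_bounded_supported)
  then show "mass h i \<le> h * exp B" using emeasure by (simp add: mult.commute)
qed

lemma mass_pos: "h > 0 \<Longrightarrow> mass h i > 0"
proof -
  assume h: "h > 0"
  obtain B where "\<forall>x. norm x \<le> real (i + 1) * h \<longrightarrow> \<bar>\<omega> x\<bar> \<le> B" using locally_bounded_\<omega> by blast
  then have "h * exp (- B) \<le> mass h i" by (intro mass_bounds h) auto
  then show ?thesis using h by (smt (verit) exp_gt_zero mult_pos_pos)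
qed

end

text \<open>The bound is only required along some sequence \<open>T \<rightarrow> \<infinity>\<close>, which is what scaling invariance
  provides.\<close>

locale sublinear_line = locally_bounded_line +
  assumes sublinear: "\<And>\<epsilon> N. \<epsilon> > 0 \<Longrightarrow> \<exists>T\<ge>N. \<forall>x. 0 \<le> x \<and> x \<le> T \<longrightarrow> \<bar>\<omega> x\<bar> \<le> \<epsilon> * T"
begin

text \<open>For the last interval of length \<open>h\<close> inside \<open>[0, T]\<close>, the number \<open>n\<close> of preceding intervals
  is about \<open>T / h\<close>, so a bound \<open>\<epsilon> * T\<close> for the weight with small \<open>\<epsilon>\<close> amounts to a small multiple
  of \<open>n\<close>.\<close>

lemma mass_subexponential:
  assumes h: "h > 0" and q: "q > 1"
  shows "\<exists>n\<ge>N. 1 / q ^ n \<le> mass h n \<and> mass h n \<le> q ^ n"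
proof -
  define l where "l = ln q"
  have l: "l > 0" using q by (simp add: l_def)
  have q_exp: "q ^ n = exp (l * real n)" for n
    using q by (simp add: l_def exp_of_nat2_mult)
  \<comment> \<open>The factor \<open>exp (l * n / 2)\<close> left over from the bound on the weight absorbs all constants
    once it exceeds \<open>a\<close>.\<close>
  define a where "a = max (h * exp l) (exp l / h)"
  define N' where "N' = max (real N) (2 / l * ln a)"
  have a: "a > 0" using h by (auto simp: a_def less_max_iff_disj)
  define \<epsilon> where "\<epsilon> = l / (2 * h)"
  have \<epsilon>: "\<epsilon> > 0" using l h by (simp add: \<epsilon>_def)
  obtain T where T: "T \<ge> h * (N' + 2)" "\<And>x. 0 \<le> x \<Longrightarrow> x \<le> T \<Longrightarrow> \<bar>\<omega> x\<bar> \<le> \<epsilon> * T"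
    using sublinear[OF \<epsilon>] by blast
  define n where "n = nat \<lfloor>T / h - 1\<rfloor>"
  have "T / h \<ge> N' + 2" using T(1) h by (simp add: field_simps)
  moreover have "N' \<ge> 0" by (simp add: N'_def)
  ultimately have n: "real n \<le> T / h - 1" "T / h - 1 < real n + 1" "N' \<le> real n"
    unfolding n_def by linarith+
  have nT: "real (n + 1) * h \<le> T" "T \<le> (real n + 2) * h"
    using n(1,2) h by (simp_all add: field_simps)
  define B where "B = \<epsilon> * T"
  have "B \<le> \<epsilon> * ((real n + 2) * h)" unfolding B_def using nT \<epsilon> by (intro mult_left_mono) auto
  also have "\<dots> = l * real n / 2 + l" using h by (simp add: \<epsilon>_def field_simps)
  finally have B: "B \<le> l * real n / 2 + l" .
  have "ln a \<le> l * real n / 2" using n(3) l by (simp add: N'_def field_simps)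
  then have "a \<le> exp (l * real n / 2)" using a by (simp add: ln_le_cancel_iff[symmetric] del: ln_le_cancel_iff)
  then have a1: "h * exp l \<le> exp (l * real n / 2)" and a2: "exp l / h \<le> exp (l * real n / 2)"
    by (simp_all add: a_def)
  have bound: "\<bar>\<omega> x\<bar> \<le> B" if "0 \<le> x" "x \<le> real (n + 1) * h" for x
    unfolding B_def using that nT by (intro T) auto
  have half: "exp (l * real n) = exp (l * real n / 2) * exp (l * real n / 2)"
    by (simp add: exp_add[symmetric])
  have "mass h n \<le> h * exp B" using bound by (intro mass_bounds h)
  also have "\<dots> \<le> h * exp (l * real n / 2 + l)" using B h by simp
  also have "\<dots> = (h * exp l) * exp (l * real n / 2)" by (simp add: exp_add)
  also have "\<dots> \<le> exp (l * real n / 2) * exp (l * real n / 2)" using a1 by (intro mult_right_mono) auto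
  finally have upper: "mass h n \<le> q ^ n" by (simp add: q_exp half)
  have "exp l * exp (l * real n / 2) \<le> (h * exp (l * real n / 2)) * exp (l * real n / 2)"
    using a2 h by (intro mult_right_mono) (auto simp: field_simps)
  then have "exp (l * real n / 2 + l) \<le> h * exp (l * real n)"
    by (simp add: half exp_add mult.assoc mult.commute)
  then have "1 / exp (l * real n) \<le> h * exp (- (l * real n / 2 + l))"
    by (simp add: exp_minus field_simps)
  also have "\<dots> \<le> h * exp (- B)" using B h by simp
  also have "\<dots> \<le> mass h n" using bound by (intro mass_bounds h)
  finally have "1 / q ^ n \<le> mass h n" by (simp add: q_exp)
  moreover have "n \<ge> N" using n(3) by (simp add: N'_def)
  ultimately show ?thesis using upper by blast
qed

text \<open>The bump lives on three neighbouring intervals of length \<open>h\<close>. Its derivative is at most of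
  order \<open>1 / h\<close> on all of them, while the bump itself is bounded below on the middle one, which
  carries at least a fixed fraction of the mass.\<close>

lemma low_energy_bump:
  assumes "\<epsilon> > 0"
  shows "\<exists>G p q. derivatives G \<and> R \<le> p \<and> (\<forall>n x. G n x \<noteq> 0 \<longrightarrow> p \<le> x \<and> x \<le> q) \<and> (\<forall>n. G n \<in> bounded_supported) \<and>
    wint (\<lambda>x. (G 1 x)\<^sup>2) \<le> \<epsilon> * wint (\<lambda>x. (G 0 x)\<^sup>2) \<and> 0 < wint (\<lambda>x. (G 0 x)\<^sup>2)"
proof -
  let ?b = "bump 0 3 1"
  obtain C0 where C0: "\<And>x. \<bar>?b 1 x\<bar> \<le> C0"
    using bump_bounded_supported[of 1 0 3 1] unfolding bounded_supported_def by auto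
  define C where "C = max C0 1"
  have C: "C > 0" "\<And>x. \<bar>?b 1 x\<bar> \<le> C" using C0 by (auto simp: C_def le_max_iff_disj)
  \<comment> \<open>This \<open>h\<close> solves \<open>4 (C / h)\<^sup>2 = \<epsilon> exp (- 4)\<close>, where 4 bounds the mass of the three intervals
    relative to the middle one and \<open>exp (- 4)\<close> is a lower bound of the squared bump there.\<close>
  define h where "h = 2 * C * exp 2 / sqrt \<epsilon>"
  have h: "h > 0" using C \<open>\<epsilon> > 0\<close> by (simp add: h_def)
  obtain k :: nat where k: "R / h \<le> real k" using real_arch_simple by blast
  obtain i where i: "i \<ge> k" and m3: "mass h i + mass h (i + 2) \<le> 3 * mass h (i + 1)"
    using no_exponential_dichotomy[of "mass h" k] mass_subexponential[OF h] mass_pos[OF h] by blast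
  define G where "G n x = (1 / h) ^ n * ?b n (1 / h * x + - real i)" for n x
  have G: "derivatives G"
    unfolding G_def[abs_def] by (intro derivatives_affine derivatives_bump)
  define p q where "p = real i * h" and "q = real (i + 3) * h"
  have supp: "p \<le> x \<and> x \<le> q" if "G n x \<noteq> 0" for n x
  proof -
    have "0 < 1 / h * x + - real i \<and> 1 / h * x + - real i < 3"
      using bump_outside[of 1 0 "1 / h * x + - real i" 3 n] that by (auto simp: G_def)
    then show ?thesis using h by (simp add: p_def q_def field_simps)
  qed
  have "R \<le> p"
  proof -
    have "R / h \<le> real i" using k i by linarith
    then show ?thesis using h by (simp add: p_def field_simps)
  qed
  have G_bs: "G n \<in> bounded_supported" for n
  proof (rule continuous_bounded_supported)
    show "continuous_on UNIV (G n)"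
      using derivativesD[OF G] by (meson DERIV_isCont continuous_at_imp_continuous_on)
    show "bounded {x. G n x \<noteq> 0}"
      by (rule bounded_subset[of "{p..q}"]) (use supp[of n] in \<open>simp_all add: subset_iff\<close>)
  qed
  have sq_bs: "(\<lambda>x. (G n x)\<^sup>2) \<in> bounded_supported" for n
    using bounded_supported_mult[OF G_bs G_bs] by (simp add: power2_eq_square)
  let ?I = "\<lambda>j. indicator {real j * h..real (j + 1) * h} :: real \<Rightarrow> real"
  have scale_bs: "(\<lambda>x. c * ?I j x) \<in> bounded_supported" for c j
    using bounded_supported_scale[OF indicator_bounded_supported] by simp
  have wint_I: "wint (\<lambda>x. c * ?I j x) = c * mass h j" for c j
    by (simp add: wint_def mass_def mult.left_commute)
  have lower: "exp (- 4) * mass h (i + 1) \<le> wint (\<lambda>x. (G 0 x)\<^sup>2)"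
    unfolding wint_I[symmetric]
  proof (rule wint_mono[OF scale_bs sq_bs])
    fix x
    show "exp (- 4) * ?I (i + 1) x \<le> (G 0 x)\<^sup>2"
    proof (cases "x \<in> {real (i + 1) * h..real (i + 1 + 1) * h}")
      case True
      define y where "y = 1 / h * x + - real i"
      have y: "1 \<le> y" "y \<le> 2" using True h by (auto simp: y_def field_simps)
      have "exp (- 1) \<le> flat_exp 0 z" if "z \<ge> 1" for z
        using that by (simp add: flat_exp_0)
      then have "exp (- 1) * exp (- 1) \<le> flat_exp 0 y * flat_exp 0 (3 - y)"
        using y flat_exp_0_bounds by (intro mult_mono) auto
      then have "exp (- 2) \<le> G 0 x" by (simp add: G_def y_def bump_0 exp_add[symmetric])
      then have "(exp (- 2))\<^sup>2 \<le> (G 0 x)\<^sup>2" by (intro power_mono) auto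
      then show ?thesis using True by (simp add: power2_eq_square exp_add[symmetric])
    qed simp
  qed
  have "wint (\<lambda>x. (G 1 x)\<^sup>2) \<le> wint (\<lambda>x. (C / h)\<^sup>2 * ?I i x + ((C / h)\<^sup>2 * ?I (i + 1) x + (C / h)\<^sup>2 * ?I (i + 2) x))"
    (is "_ \<le> wint ?f")
  proof (rule wint_mono[OF sq_bs])
    show "?f \<in> bounded_supported"
      by (intro bounded_supported_add scale_bs)
    fix x
    show "(G 1 x)\<^sup>2 \<le> ?f x"
    proof (cases "p \<le> x \<and> x \<le> q")
      case True
      have "\<bar>G 1 x\<bar> \<le> C / h"
        using C(2)[of "1 / h * x + - real i"] h by (simp add: G_def abs_mult divide_right_mono)
      then have "(G 1 x)\<^sup>2 \<le> (C / h)\<^sup>2" using C h by (intro abs_le_square_iff[THEN iffD1]) simp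
      moreover have "1 \<le> ?I i x + (?I (i + 1) x + ?I (i + 2) x)"
        using True by (auto simp: indicator_def p_def q_def algebra_simps)
      then have "(C / h)\<^sup>2 * 1 \<le> (C / h)\<^sup>2 * (?I i x + (?I (i + 1) x + ?I (i + 2) x))"
        by (intro mult_left_mono) auto
      ultimately show ?thesis by (simp add: distrib_left)
    next
      case False
      then have "G 1 x = 0" using supp by blast
      then show ?thesis by simp
    qed
  qed
  also have "wint ?f = (C / h)\<^sup>2 * (mass h i + (mass h (i + 1) + mass h (i + 2)))"
    by (simp only: wint_add[OF scale_bs bounded_supported_add[OF scale_bs scale_bs]]
        wint_add[OF scale_bs scale_bs] wint_I distrib_left)
  also have "\<dots> \<le> (C / h)\<^sup>2 * (4 * mass h (i + 1))"
    using m3 by (intro mult_left_mono) auto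
  also have "\<dots> = \<epsilon> * (exp (- 4) * mass h (i + 1))"
  proof -
    have "(C / h)\<^sup>2 * 4 = \<epsilon> * exp (- 4)"
    proof -
      have "h\<^sup>2 = 4 * C\<^sup>2 * (exp 2)\<^sup>2 / \<epsilon>"
        using \<open>\<epsilon> > 0\<close> by (simp add: h_def power_mult_distrib power_divide)
      also have "(exp 2)\<^sup>2 = exp (4 :: real)" by (simp add: power2_eq_square exp_add[symmetric])
      finally have "(C / h)\<^sup>2 = C\<^sup>2 / (4 * C\<^sup>2 * exp 4 / \<epsilon>)" by (simp only: power_divide)
      also have "\<dots> = \<epsilon> / (4 * exp 4)" using C(1) \<open>\<epsilon> > 0\<close> by simp
      finally have "(C / h)\<^sup>2 * 4 = \<epsilon> / (4 * exp 4) * 4" by (simp only:)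
      also have "\<dots> = \<epsilon> * exp (- 4)" by (simp add: exp_minus inverse_eq_divide)
      finally show ?thesis .
    qed
    then show ?thesis by (simp only: mult.assoc[symmetric])
  qed
  also have "\<dots> \<le> \<epsilon> * wint (\<lambda>x. (G 0 x)\<^sup>2)" using lower \<open>\<epsilon> > 0\<close> by simp
  finally have "wint (\<lambda>x. (G 1 x)\<^sup>2) \<le> \<epsilon> * wint (\<lambda>x. (G 0 x)\<^sup>2)" .
  moreover have "0 < wint (\<lambda>x. (G 0 x)\<^sup>2)"
    using mult_pos_pos[OF exp_gt_zero mass_pos[OF h]] lower by (rule less_le_trans)
  ultimately have "derivatives G \<and> R \<le> p \<and> (\<forall>n x. G n x \<noteq> 0 \<longrightarrow> p \<le> x \<and> x \<le> q) \<and>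
      (\<forall>n. G n \<in> bounded_supported) \<and>
      wint (\<lambda>x. (G 1 x)\<^sup>2) \<le> \<epsilon> * wint (\<lambda>x. (G 0 x)\<^sup>2) \<and> 0 < wint (\<lambda>x. (G 0 x)\<^sup>2)"
    by (intro conjI allI impI G \<open>R \<le> p\<close> G_bs) (erule supp[THEN conjunct1], erule supp[THEN conjunct2])
  then show ?thesis
    by - (rule exI[of _ G], rule exI[of _ p], rule exI[of _ q])
qed

end

section \<open>Sublinear growth of the environment\<close>

lemma path_one_sided_limits:
  assumes "w \<in> path_space"
  shows "\<exists>l. (w \<longlongrightarrow> l) (at_left x)" "\<exists>l. (w \<longlongrightarrow> l) (at_right x)"
proof -
  show "\<exists>l. (w \<longlongrightarrow> l) (at_left x)"
    using assms by (cases "x > 0") (auto simp: path_space_def continuous_within not_less)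
  show "\<exists>l. (w \<longlongrightarrow> l) (at_right x)"
    using assms by (cases "x < 0") (auto simp: path_space_def continuous_within not_less)
qed

text \<open>One-sided limits bound the path near every point; finitely many of these neighbourhoods
  cover a ball.\<close>

lemma path_locally_bounded:
  assumes w: "w \<in> path_space"
  shows "\<exists>B. \<forall>x. norm x \<le> R \<longrightarrow> \<bar>w x\<bar> \<le> B"
proof -
  have "\<exists>U B. open U \<and> x \<in> U \<and> (\<forall>y\<in>U. \<bar>w y\<bar> \<le> B)" for x
  proof -
    obtain l r where l: "(w \<longlongrightarrow> l) (at_left x)" and r: "(w \<longlongrightarrow> r) (at_right x)"
      using path_one_sided_limits[OF w, of x] by blast
    have "\<forall>\<^sub>F y in at_left x. \<bar>w y\<bar> < \<bar>l\<bar> + 1"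
      using tendsto_rabs[OF l] by (rule order_tendstoD) simp
    moreover have "\<forall>\<^sub>F y in at_right x. \<bar>w y\<bar> < \<bar>r\<bar> + 1"
      using tendsto_rabs[OF r] by (rule order_tendstoD) simp
    ultimately have "\<forall>\<^sub>F y in at x. \<bar>w y\<bar> \<le> max (\<bar>l\<bar> + 1) (\<bar>r\<bar> + 1)"
      unfolding eventually_at_split by (auto elim!: eventually_mono)
    then obtain U where "open U" "x \<in> U" "\<forall>y\<in>U. y \<noteq> x \<longrightarrow> \<bar>w y\<bar> \<le> max (\<bar>l\<bar> + 1) (\<bar>r\<bar> + 1)"
      unfolding eventually_at_topological by blast
    then show ?thesis
      by (intro exI[of _ U] exI[of _ "max (max (\<bar>l\<bar> + 1) (\<bar>r\<bar> + 1)) \<bar>w x\<bar>"]) (auto simp: le_max_iff_disj)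
  qed
  then obtain U B where U: "\<And>x. open (U x)" "\<And>x. x \<in> U x" "\<And>x y. y \<in> U x \<Longrightarrow> \<bar>w y\<bar> \<le> B x" by metis
  have "compact (cball (0 :: real) R)" by simp
  then obtain C where C: "finite C" "cball 0 R \<subseteq> (\<Union>x\<in>C. U x)"
    by (rule compactE_image[of _ "cball 0 R" U]) (use U in auto)
  have "\<bar>w y\<bar> \<le> (\<Sum>x\<in>C. \<bar>B x\<bar>)" if "norm y \<le> R" for y
  proof -
    obtain x where x: "x \<in> C" "y \<in> U x" using C(2) \<open>norm y \<le> R\<close> by (auto simp: subset_iff)
    have "\<bar>w y\<bar> \<le> \<bar>B x\<bar>" using U(3)[OF x(2)] by linarith
    also have "\<dots> \<le> (\<Sum>x\<in>C. \<bar>B x\<bar>)" using C(1) x(1) by (intro member_le_sum) auto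
    finally show ?thesis .
  qed
  then show ?thesis by blast
qed

text \<open>The path is the limit of step functions. The value on a step is taken at the end of the step
  farther from 0, because the path is continuous from that side.\<close>

lemma path_measurable:
  assumes w: "w \<in> path_space"
  shows "w \<in> borel_measurable borel"
proof (rule borel_measurable_LIMSEQ_real)
  define f :: "nat \<Rightarrow> real \<Rightarrow> real" where
    "f n x = (if 0 \<le> x then (\<lambda>k. w ((of_int k + 1) / real (Suc n))) \<lfloor>real (Suc n) * x\<rfloor>
      else (\<lambda>k. w ((of_int k - 1) / real (Suc n))) \<lceil>real (Suc n) * x\<rceil>)" for n x
  have m: "(\<lambda>x. h (g x)) \<in> borel_measurable borel"
    if "g \<in> measurable borel (count_space UNIV)" for g :: "real \<Rightarrow> int" and h :: "int \<Rightarrow> real"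
    by (rule measurable_compose[OF that]) simp
  show "f n \<in> borel_measurable borel" for n
    unfolding f_def by (intro measurable_If m) measurable
  fix x :: real
  have inv: "(\<lambda>n. 1 / real (Suc n)) \<longlonglongrightarrow> 0" by (rule LIMSEQ_Suc[OF lim_1_over_n])
  show "(\<lambda>n. f n x) \<longlonglongrightarrow> w x"
  proof (cases "0 \<le> x")
    case True
    define y where "y n = (of_int \<lfloor>real (Suc n) * x\<rfloor> + 1) / real (Suc n)" for n
    have y: "x < y n" "y n \<le> x + 1 / real (Suc n)" for n
    proof -
      have "real (Suc n) * x < of_int \<lfloor>real (Suc n) * x\<rfloor> + 1" "of_int \<lfloor>real (Suc n) * x\<rfloor> \<le> real (Suc n) * x"
        by linarith+
      then have "real (Suc n) * x / real (Suc n) < y n" "y n \<le> (real (Suc n) * x + 1) / real (Suc n)"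
        unfolding y_def by (intro divide_strict_right_mono divide_right_mono; simp)+
      then show "x < y n" "y n \<le> x + 1 / real (Suc n)"
        by (simp_all only: add_divide_distrib nonzero_mult_div_cancel_left of_nat_neq_0 not_False_eq_True)
    qed
    have "y \<longlonglongrightarrow> x"
    proof (rule tendsto_sandwich[of "\<lambda>_. x" y sequentially "\<lambda>n. x + 1 / real (Suc n)"])
      show "(\<lambda>n. x + 1 / real (Suc n)) \<longlonglongrightarrow> x" using tendsto_add[OF tendsto_const inv, of x] by simp
    qed (use y in \<open>auto intro!: always_eventually less_imp_le\<close>)
    then have "filterlim y (at_right x) sequentially"
      using y by (intro tendsto_imp_filterlim_at_right) auto
    moreover have "(w \<longlongrightarrow> w x) (at_right x)"
      using w True by (auto simp: path_space_def continuous_within)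
    ultimately have "(\<lambda>n. w (y n)) \<longlonglongrightarrow> w x" by (rule filterlim_compose[rotated])
    then show ?thesis using True by (simp add: f_def y_def)
  next
    case False
    define y where "y n = (of_int \<lceil>real (Suc n) * x\<rceil> - 1) / real (Suc n)" for n
    have y: "y n < x" "x - 1 / real (Suc n) \<le> y n" for n
    proof -
      have "of_int \<lceil>real (Suc n) * x\<rceil> - 1 < real (Suc n) * x" "real (Suc n) * x \<le> of_int \<lceil>real (Suc n) * x\<rceil>"
        by linarith+
      then have "y n < real (Suc n) * x / real (Suc n)" "(real (Suc n) * x - 1) / real (Suc n) \<le> y n"
        unfolding y_def by (intro divide_strict_right_mono divide_right_mono; simp)+
      then show "y n < x" "x - 1 / real (Suc n) \<le> y n"
        by (simp_all only: diff_divide_distrib nonzero_mult_div_cancel_left of_nat_neq_0 not_False_eq_True)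
    qed
    have "y \<longlonglongrightarrow> x"
    proof (rule tendsto_sandwich[of "\<lambda>n. x - 1 / real (Suc n)" y sequentially "\<lambda>_. x"])
      show "(\<lambda>n. x - 1 / real (Suc n)) \<longlonglongrightarrow> x" using tendsto_diff[OF tendsto_const inv, of x] by simp
    qed (use y in \<open>auto intro!: always_eventually less_imp_le\<close>)
    then have "filterlim y (at_left x) sequentially"
      using y by (intro tendsto_imp_filterlim_at_left) auto
    moreover have "(w \<longlongrightarrow> w x) (at_left x)"
      using w False by (auto simp: path_space_def continuous_within)
    ultimately have "(\<lambda>n. w (y n)) \<longlonglongrightarrow> w x" by (rule filterlim_compose[rotated])
    then show ?thesis using False by (simp add: f_def y_def)
  qed
qed

text \<open>The time scale \<open>s\<close> is kept apart from the set of times, so that the scaling relation acts on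
  \<open>s\<close> and \<open>\<theta>\<close> for a fixed set of times.\<close>

definition exceeds :: "'a measure \<Rightarrow> (real \<Rightarrow> 'a \<Rightarrow> real) \<Rightarrow> real set \<Rightarrow> real \<Rightarrow> real \<Rightarrow> 'a set" where
  "exceeds M X J s \<theta> = {\<omega> \<in> space M. \<exists>x\<in>J. \<theta> < \<bar>X (s * x) \<omega>\<bar>}"

lemma exceeds_sets:
  assumes "countable J" "J \<subseteq> {0..}" "s \<ge> 0" "\<And>t. t \<ge> 0 \<Longrightarrow> X t \<in> borel_measurable M"
  shows "exceeds M X J s \<theta> \<in> sets M"
proof -
  have "exceeds M X J s \<theta> = (\<Union>x\<in>J. {\<omega> \<in> space M. \<theta> < \<bar>X (s * x) \<omega>\<bar>})"
    by (auto simp: exceeds_def)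
  also have "\<dots> \<in> sets M"
  proof (intro sets.countable_UN'' assms(1))
    fix x assume "x \<in> J"
    then have [measurable]: "X (s * x) \<in> borel_measurable M" using assms by (intro assms(4)) auto
    show "{\<omega> \<in> space M. \<theta> < \<bar>X (s * x) \<omega>\<bar>} \<in> sets M" by measurable
  qed
  finally show ?thesis .
qed

lemma exceeds_scale_finite:
  assumes X: "\<And>t. t \<ge> 0 \<Longrightarrow> X t \<in> borel_measurable M" and sc: "scales M X \<alpha> c" and c: "c > 0"
    and J: "finite J" "J \<subseteq> {0..}"
  shows "measure M (exceeds M X J c \<theta>) = measure M (exceeds M X J 1 (\<theta> / c powr (1 / \<alpha>)))"
proof -
  let ?P = "PiM J (\<lambda>_. borel :: real measure)"
  let ?A = "{f \<in> space ?P. \<exists>x\<in>J. \<theta> < \<bar>f x\<bar>}"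
  have A: "?A \<in> sets ?P" using J(1) by measurable
  have X1: "(\<lambda>\<omega>. \<lambda>x\<in>J. X (c * x) \<omega>) \<in> measurable M ?P"
    using J c by (intro measurable_restrict X) auto
  have X2: "(\<lambda>\<omega>. \<lambda>x\<in>J. c powr (1 / \<alpha>) * X x \<omega>) \<in> measurable M ?P"
  proof (rule measurable_restrict)
    fix x assume "x \<in> J"
    then have "0 \<le> x" using J(2) by auto
    show "(\<lambda>\<omega>. c powr (1 / \<alpha>) * X x \<omega>) \<in> borel_measurable M"
      by (rule borel_measurable_times[OF borel_measurable_const X[OF \<open>0 \<le> x\<close>]])
  qed
  have "measure (distr M ?P (\<lambda>\<omega>. \<lambda>x\<in>J. X (c * x) \<omega>)) ?A
      = measure (distr M ?P (\<lambda>\<omega>. \<lambda>x\<in>J. c powr (1 / \<alpha>) * X x \<omega>)) ?A"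
    using sc[unfolded scales_def same_fdd_def, rule_format, OF conjI, OF J] by (rule arg_cong)
  moreover have "(\<lambda>\<omega>. \<lambda>x\<in>J. X (c * x) \<omega>) -` ?A \<inter> space M = exceeds M X J c \<theta>"
    by (auto simp: exceeds_def space_PiM)
  moreover have "(\<lambda>\<omega>. \<lambda>x\<in>J. c powr (1 / \<alpha>) * X x \<omega>) -` ?A \<inter> space M
      = exceeds M X J 1 (\<theta> / c powr (1 / \<alpha>))"
  proof -
    have "\<theta> < \<bar>c powr (1 / \<alpha>) * t\<bar> \<longleftrightarrow> \<theta> / c powr (1 / \<alpha>) < \<bar>t\<bar>" for t
      using c by (simp add: abs_mult pos_divide_less_eq mult.commute)
    then show ?thesis by (auto simp: exceeds_def space_PiM)
  qed
  ultimately show ?thesis by (simp add: measure_distr[OF X1 A] measure_distr[OF X2 A])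
qed

lemma exceeds_rescale: "exceeds M X ((*) r ` J) s \<theta> = exceeds M X J (s * r) \<theta>"
  by (auto simp: exceeds_def mult.assoc)

text \<open>A factor \<open>c < 1\<close> is replaced by \<open>1 / c\<close>, since the relation can be read backwards.\<close>

lemma expanding_scale:
  assumes X: "\<And>t. t \<ge> 0 \<Longrightarrow> X t \<in> borel_measurable M" and sc: "scales M X \<alpha> c" and c: "c > 0" "c \<noteq> 1"
  shows "\<exists>b>1. \<forall>J \<theta> n. finite J \<and> J \<subseteq> {0..} \<longrightarrow>
    measure M (exceeds M X J (b ^ n) \<theta>) = measure M (exceeds M X J 1 (\<theta> / (b powr (1 / \<alpha>)) ^ n))"
proof -
  have "\<exists>b>1. \<forall>J \<theta>. finite J \<and> J \<subseteq> {0..} \<longrightarrow>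
    measure M (exceeds M X J b \<theta>) = measure M (exceeds M X J 1 (\<theta> / b powr (1 / \<alpha>)))"
  proof (cases "c > 1")
    case True
    then show ?thesis using exceeds_scale_finite[OF X sc c(1)] by blast
  next
    case False
    define b where "b = 1 / c"
    have b: "b > 1" using False c by (simp add: b_def)
    have "measure M (exceeds M X J b \<theta>) = measure M (exceeds M X J 1 (\<theta> / b powr (1 / \<alpha>)))"
      if J: "finite J" "J \<subseteq> {0..}" for J \<theta>
    proof -
      let ?a = "c powr (1 / \<alpha>)"
      have bJ: "finite ((*) b ` J)" "(*) b ` J \<subseteq> {0..}" using J b by auto
      have "measure M (exceeds M X ((*) b ` J) c (\<theta> * ?a)) = measure M (exceeds M X ((*) b ` J) 1 (\<theta> * ?a / ?a))"
        by (rule exceeds_scale_finite[OF X sc c(1) bJ])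
      moreover have "c * b = 1" using c by (simp add: b_def)
      moreover have "\<theta> / b powr (1 / \<alpha>) = \<theta> * ?a"
        using c by (simp add: b_def powr_divide)
      ultimately show ?thesis using c by (simp add: exceeds_rescale)
    qed
    then show ?thesis using b by blast
  qed
  then obtain b where b: "b > 1" and step: "\<And>J \<theta>. finite J \<Longrightarrow> J \<subseteq> {0..} \<Longrightarrow>
    measure M (exceeds M X J b \<theta>) = measure M (exceeds M X J 1 (\<theta> / b powr (1 / \<alpha>)))" by blast
  have "measure M (exceeds M X J (b ^ n) \<theta>) = measure M (exceeds M X J 1 (\<theta> / (b powr (1 / \<alpha>)) ^ n))"
    if J: "finite J" "J \<subseteq> {0..}" for J \<theta> n
  proof (induction n arbitrary: \<theta>)
    case (Suc n)
    have bJ: "finite ((*) (b ^ n) ` J)" "(*) (b ^ n) ` J \<subseteq> {0..}" using J b by auto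
    have "measure M (exceeds M X J (b ^ Suc n) \<theta>) = measure M (exceeds M X ((*) (b ^ n) ` J) b \<theta>)"
      by (simp add: exceeds_rescale)
    also have "\<dots> = measure M (exceeds M X J (b ^ n) (\<theta> / b powr (1 / \<alpha>)))"
      by (subst step[OF bJ]) (simp add: exceeds_rescale)
    also have "\<dots> = measure M (exceeds M X J 1 (\<theta> / (b powr (1 / \<alpha>)) ^ Suc n))"
      by (simp add: Suc divide_divide_eq_left mult.commute)
    finally show ?case .
  qed simp
  with b show ?thesis by blast
qed

text \<open>Finite-dimensional distributions determine the probability for finite sets of times; exhaust
  the countable set.\<close>

lemma (in prob_space) exceeds_scale_countable:
  assumes X: "\<And>t. t \<ge> 0 \<Longrightarrow> X t \<in> borel_measurable M"
    and s: "s \<ge> 0"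
    and fin: "\<And>J. finite J \<Longrightarrow> J \<subseteq> {0..} \<Longrightarrow> prob (exceeds M X J s \<theta>) = prob (exceeds M X J 1 \<mu>)"
    and D: "countable D" "D \<subseteq> {0..}" "D \<noteq> {}"
  shows "prob (exceeds M X D s \<theta>) = prob (exceeds M X D 1 \<mu>)"
proof -
  define J where "J n = from_nat_into D ` {..n}" for n
  have J: "finite (J n)" "J n \<subseteq> {0..}" for n
    using from_nat_into[OF D(3)] D(2) by (auto simp: J_def)
  have D_eq: "D = (\<Union>n. J n)"
  proof (intro equalityI subsetI)
    fix x assume "x \<in> D"
    then obtain n where "x = from_nat_into D n" using range_from_nat_into[OF D(3,1)] by (metis rangeE)
    then have "x \<in> J n" by (simp add: J_def)
    then show "x \<in> (\<Union>n. J n)" by blast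
  qed (use from_nat_into[OF D(3)] in \<open>auto simp: J_def\<close>)
  have lim: "(\<lambda>n. prob (exceeds M X (J n) r \<nu>)) \<longlonglongrightarrow> prob (exceeds M X D r \<nu>)" if "r \<ge> 0" for r \<nu>
  proof -
    have "(\<lambda>n. prob (exceeds M X (J n) r \<nu>)) \<longlonglongrightarrow> prob (\<Union>n. exceeds M X (J n) r \<nu>)"
    proof (rule finite_Lim_measure_incseq)
      show "range (\<lambda>n. exceeds M X (J n) r \<nu>) \<subseteq> events"
      proof -
        have "exceeds M X (J n) r \<nu> \<in> events" for n
          by (rule exceeds_sets) (use J[of n] that X in \<open>auto intro: countable_finite\<close>)
        then show ?thesis by blast
      qed
      show "incseq (\<lambda>n. exceeds M X (J n) r \<nu>)"
      proof (rule monoI)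
        fix i j :: nat assume "i \<le> j"
        then have "J i \<subseteq> J j" by (auto simp: J_def)
        then show "exceeds M X (J i) r \<nu> \<subseteq> exceeds M X (J j) r \<nu>" unfolding exceeds_def by blast
      qed
    qed
    also have "(\<Union>n. exceeds M X (J n) r \<nu>) = exceeds M X D r \<nu>"
      unfolding D_eq by (auto simp: exceeds_def)
    finally show ?thesis .
  qed
  show ?thesis
    using LIMSEQ_unique[OF lim[OF s, of \<theta>]] lim[of 1 \<mu>] fin[OF J] by simp
qed

text \<open>Let \<open>B n\<close> be the event that \<open>\<bar>w\<bar>\<close> exceeds \<open>\<delta> b\<^sup>n\<close> somewhere on \<open>[0, b\<^sup>n]\<close>. By scaling, its
  probability is that of exceeding \<open>\<delta> b^(n - n / \<alpha>)\<close> on \<open>[0, 1]\<close>, which tends to 0 since paths are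
  bounded on compact sets. So almost surely infinitely many of the events \<open>B n\<close> fail. Rational
  multiples of \<open>b\<^sup>n\<close> suffice as times by right continuity.\<close>

lemma sublinear_paths:
  assumes sss: "semi_selfsimilar_levy Q V_plus \<alpha>" and space: "space Q \<subseteq> path_space" and \<alpha>: "1 < \<alpha>"
  shows "AE w in Q. \<forall>\<epsilon>>0. \<forall>N. \<exists>T\<ge>N. \<forall>x. 0 \<le> x \<and> x \<le> T \<longrightarrow> \<bar>w x\<bar> \<le> \<epsilon> * T"
proof -
  interpret prob_space Q using sss by (simp add: semi_selfsimilar_levy_def levy_process_def)
  have X: "V_plus t \<in> borel_measurable Q" if "t \<ge> 0" for t
    using sss that by (simp add: semi_selfsimilar_levy_def levy_process_def)
  obtain c where c: "c > 0" "c \<noteq> 1" "scales Q V_plus \<alpha> c"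
    using sss by (auto simp: semi_selfsimilar_levy_def)
  have "\<exists>b>1. \<forall>J \<theta> n. finite J \<and> J \<subseteq> {0..} \<longrightarrow>
      prob (exceeds Q V_plus J (b ^ n) \<theta>) = prob (exceeds Q V_plus J 1 (\<theta> / (b powr (1 / \<alpha>)) ^ n))"
    by (rule expanding_scale) (fact X c)+
  then obtain b where b: "b > 1" and scale0: "\<forall>J \<theta> n. finite J \<and> J \<subseteq> {0..} \<longrightarrow>
      prob (exceeds Q V_plus J (b ^ n) \<theta>) = prob (exceeds Q V_plus J 1 (\<theta> / (b powr (1 / \<alpha>)) ^ n))"
    by (elim exE conjE)
  have scale: "prob (exceeds Q V_plus J (b ^ n) \<theta>) = prob (exceeds Q V_plus J 1 (\<theta> / (b powr (1 / \<alpha>)) ^ n))"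
    if "finite J" "J \<subseteq> {0..}" for J n \<theta>
    by (rule scale0[rule_format]) (intro conjI that)
  define D where "D = \<rat> \<inter> {0..1 :: real}"
  have "0 \<in> D" by (simp add: D_def)
  then have D: "countable D" "D \<subseteq> {0..}" "D \<noteq> {}" by (auto simp: D_def countable_rat)
  have scaleD: "prob (exceeds Q V_plus D (b ^ n) \<theta>) = prob (exceeds Q V_plus D 1 (\<theta> / (b powr (1 / \<alpha>)) ^ n))" for \<theta> n
  proof (rule exceeds_scale_countable)
    show "0 \<le> b ^ n" using b by simp
  qed (fact X D scale)+
  have tail: "(\<lambda>k. prob (exceeds Q V_plus D 1 (real k))) \<longlonglongrightarrow> 0"
  proof -
    have "(\<lambda>k. prob (exceeds Q V_plus D 1 (real k))) \<longlonglongrightarrow> prob (\<Inter>k. exceeds Q V_plus D 1 (real k))"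
    proof (rule finite_Lim_measure_decseq)
      show "range (\<lambda>k. exceeds Q V_plus D 1 (real k)) \<subseteq> events"
      proof -
        have "exceeds Q V_plus D 1 (real k) \<in> events" for k
          by (rule exceeds_sets) (use D X in auto)
        then show ?thesis by blast
      qed
      show "decseq (\<lambda>k. exceeds Q V_plus D 1 (real k))"
      proof (rule antimonoI)
        fix i j :: nat assume "i \<le> j"
        then have "real i < z" if "real j < z" for z using that by linarith
        then show "exceeds Q V_plus D 1 (real j) \<subseteq> exceeds Q V_plus D 1 (real i)"
          unfolding exceeds_def by blast
      qed
    qed
    also have "(\<Inter>k. exceeds Q V_plus D 1 (real k)) = {}"
    proof (rule ccontr)
      assume "\<not> ?thesis"
      then obtain w where w: "\<And>k. w \<in> exceeds Q V_plus D 1 (real k)" by blast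
      then have "w \<in> path_space" using space by (auto simp: exceeds_def)
      then obtain B where B: "\<And>x. norm x \<le> 1 \<Longrightarrow> \<bar>w x\<bar> \<le> B" using path_locally_bounded by blast
      obtain k :: nat where "B \<le> real k" using real_arch_simple by blast
      moreover obtain x where "x \<in> D" "real k < \<bar>w x\<bar>"
        using w[of k] by (auto simp: exceeds_def V_plus_def)
      ultimately show False using B[of x] by (auto simp: D_def)
    qed
    finally show ?thesis by simp
  qed
  have "AE w in Q. \<exists>n\<ge>N. w \<notin> exceeds Q V_plus D (b ^ n) (b ^ n / real (Suc k))" for k N
  proof -
    let ?B = "\<lambda>n. exceeds Q V_plus D (b ^ n) (b ^ n / real (Suc k))"
    have ev: "exceeds Q V_plus D r \<theta> \<in> events" if "r \<ge> 0" for r \<theta>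
      by (rule exceeds_sets) (use D X that in auto)
    have B: "?B n \<in> events" for n using b by (intro ev) simp
    define Z where "Z = (\<Inter>n\<in>{N..}. ?B n)"
    have Z: "Z \<in> events" unfolding Z_def by (rule sets.countable_INT') (use B in auto)
    have "prob Z \<le> \<delta>" if "\<delta> > 0" for \<delta>
    proof -
      obtain m where m: "prob (exceeds Q V_plus D 1 (real m)) < \<delta>"
        using order_tendstoD(2)[OF tail \<open>\<delta> > 0\<close>] by (auto simp: eventually_sequentially)
      \<comment> \<open>Time is scaled by \<open>b\<close> but space only by \<open>b^(1 / \<alpha>)\<close>, so the threshold grows like \<open>r^n\<close>
        relative to space.\<close>
      define r where "r = b / b powr (1 / \<alpha>)"
      have "b powr (1 / \<alpha>) < b powr 1" using b \<alpha> by (intro powr_less_mono) auto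
      then have r: "r > 1" using b by (simp add: r_def)
      obtain n0 where n0: "real m * real (Suc k) < r ^ n0" using real_arch_pow[OF r] by blast
      define n where "n = max N n0"
      have "real m * real (Suc k) \<le> r ^ n0" using n0 by simp
      also have "\<dots> \<le> r ^ n" using r by (intro power_increasing) (auto simp: n_def)
      finally have "real m \<le> r ^ n / real (Suc k)" by (simp add: pos_le_divide_eq)
      also have "\<dots> = b ^ n / real (Suc k) / (b powr (1 / \<alpha>)) ^ n"
        by (simp only: r_def power_divide divide_divide_eq_left mult.commute)
      finally have big: "real m \<le> b ^ n / real (Suc k) / (b powr (1 / \<alpha>)) ^ n" .
      have "prob Z \<le> prob (?B n)"
        using B by (intro finite_measure_mono) (auto simp: Z_def n_def)
      also have "\<dots> = prob (exceeds Q V_plus D 1 (b ^ n / real (Suc k) / (b powr (1 / \<alpha>)) ^ n))"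
        by (rule scaleD)
      also have "\<dots> \<le> prob (exceeds Q V_plus D 1 (real m))"
      proof (rule finite_measure_mono)
        have "real m < z" if "b ^ n / real (Suc k) / (b powr (1 / \<alpha>)) ^ n < z" for z
          using big that by linarith
        then show "exceeds Q V_plus D 1 (b ^ n / real (Suc k) / (b powr (1 / \<alpha>)) ^ n)
            \<subseteq> exceeds Q V_plus D 1 (real m)"
          unfolding exceeds_def by blast
      qed (rule ev, simp)
      finally show ?thesis using m by simp
    qed
    then have "prob Z = 0" by (metis field_le_epsilon add_0 antisym measure_nonneg)
    then have "Z \<in> null_sets Q" using Z by (simp add: null_sets_def emeasure_eq_measure)
    then show ?thesis by (rule AE_I') (auto simp: Z_def)
  qed
  then have "AE w in Q. \<forall>k N. \<exists>n\<ge>N. w \<notin> exceeds Q V_plus D (b ^ n) (b ^ n / real (Suc k))"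
    by (simp add: AE_all_countable)
  then show ?thesis
  proof (rule AE_mp, intro AE_I2 impI allI)
    fix w \<epsilon> N assume w: "w \<in> space Q" and \<epsilon>: "(\<epsilon> :: real) > 0"
      and *: "\<forall>k N. \<exists>n\<ge>N. w \<notin> exceeds Q V_plus D (b ^ n) (b ^ n / real (Suc k))"
    have path: "w \<in> path_space" using w space by blast
    obtain k where k: "1 / real (Suc k) < \<epsilon>" using nat_approx_posE[OF \<epsilon>] by blast
    obtain n0 where n0: "N < b ^ n0" using real_arch_pow[OF b] by blast
    obtain n where n: "n \<ge> n0" "w \<notin> exceeds Q V_plus D (b ^ n) (b ^ n / real (Suc k))" using * by blast
    define T where "T = b ^ n"
    have T: "T > 0" using b by (simp add: T_def)
    have "b ^ n0 \<le> b ^ n" using n(1) b by (intro power_increasing) auto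
    then have "N \<le> T" using n0 by (simp add: T_def)
    have rat: "\<bar>w (T * x)\<bar> \<le> T / real (Suc k)" if "x \<in> D" for x
      using n(2) w that by (auto simp: exceeds_def V_plus_def T_def not_less)
    have "\<bar>w x\<bar> \<le> T / real (Suc k)" if x: "0 \<le> x" "x \<le> T" for x
    proof (cases "x = T")
      case True
      then show ?thesis using rat[of 1] by (simp add: D_def)
    next
      case False
      show ?thesis
      proof (rule ccontr)
        assume neg: "\<not> ?thesis"
        have "(w \<longlongrightarrow> w x) (at_right x)" using path x by (auto simp: path_space_def continuous_within)
        from order_tendstoD(1)[OF tendsto_rabs[OF this], of "T / real (Suc k)"] neg
        have "\<forall>\<^sub>F y in at_right x. T / real (Suc k) < \<bar>w y\<bar>" by simp
        then obtain z where z: "z > x" "\<And>y. x < y \<Longrightarrow> y < z \<Longrightarrow> T / real (Suc k) < \<bar>w y\<bar>"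
          by (auto simp: eventually_at_right_field)
        have "x / T < min (z / T) 1" using z(1) x False T by (simp add: divide_strict_right_mono)
        then obtain r where r: "r \<in> \<rat>" "x / T < r" "r < min (z / T) 1" using Rats_dense_in_real by blast
        have "0 \<le> x / T" using x T by simp
        then have "r \<in> D" using r by (auto simp: D_def)
        moreover have "x < T * r" "T * r < z" using r T by (auto simp: field_simps)
        ultimately show False using rat[of r] z(2)[of "T * r"] by simp
      qed
    qed
    moreover have "T / real (Suc k) \<le> \<epsilon> * T"
      using mult_right_mono[of "1 / real (Suc k)" \<epsilon> T] k T by simp
    ultimately show "\<exists>T\<ge>N. \<forall>x. 0 \<le> x \<and> x \<le> T \<longrightarrow> \<bar>w x\<bar> \<le> \<epsilon> * T"
      using \<open>N \<le> T\<close> by (meson order_trans)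
  qed
qed

section \<open>The product environment\<close>

lemma V_env_eq: "V_env x w = w x"
  by (simp add: V_env_def V_plus_def V_minus_def)

lemma locally_bounded_weight_sum:
  assumes "locally_bounded_line \<omega>"
  shows "locally_bounded_weight (\<lambda>x :: real ^ 'n::finite. \<Sum>k\<in>UNIV. \<omega> (x $ k))"
proof
  interpret locally_bounded_line \<omega> by fact
  show "(\<lambda>x :: real ^ 'n. \<Sum>k\<in>UNIV. \<omega> (x $ k)) \<in> borel_measurable borel" by measurable
  fix R
  obtain B where B: "\<And>x. norm x \<le> R \<Longrightarrow> \<bar>\<omega> x\<bar> \<le> B" using locally_bounded_\<omega> by blast
  have "\<bar>\<Sum>k\<in>UNIV. \<omega> (x $ k)\<bar> \<le> real CARD('n) * B" if "norm x \<le> R" for x :: "real ^ 'n"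
  proof -
    have "\<bar>\<Sum>k\<in>UNIV. \<omega> (x $ k)\<bar> \<le> (\<Sum>k\<in>(UNIV :: 'n set). \<bar>\<omega> (x $ k)\<bar>)" by (rule sum_abs)
    also have "\<dots> \<le> (\<Sum>k\<in>(UNIV :: 'n set). B)"
      using B order_trans[OF component_le_norm_cart that] by (intro sum_mono) auto
    finally show ?thesis by simp
  qed
  then show "\<exists>B. \<forall>x :: real ^ 'n. norm x \<le> R \<longrightarrow> \<bar>\<Sum>k\<in>UNIV. \<omega> (x $ k)\<bar> \<le> B" by blast
qed

context locally_bounded_line
begin

text \<open>Both the weight, as the exponential of a sum, and the functions factorise over the
  coordinates.\<close>

lemma l2_inner_coordinate_product:
  fixes G G' :: "'n::finite \<Rightarrow> nat \<Rightarrow> real \<Rightarrow> real"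
  assumes bs: "\<And>k n. G k n \<in> bounded_supported" "\<And>k n. G' k n \<in> bounded_supported"
  shows "l2_inner (weighted_measure (\<lambda>x :: real ^ 'n. \<Sum>k\<in>UNIV. \<omega> (x $ k))) (coordinate_product G m) (coordinate_product G' m')
    = (\<Prod>k\<in>UNIV. wint (\<lambda>t. G k (m k) t * G' k (m' k) t))"
proof -
  interpret locally_bounded_weight "\<lambda>x :: real ^ 'n. \<Sum>k\<in>UNIV. \<omega> (x $ k)"
    by (rule locally_bounded_weight_sum) unfold_locales
  have [measurable]: "G k n \<in> borel_measurable borel" "G' k n \<in> borel_measurable borel" for k n
    using bs by (auto simp: bounded_supported_def)
  have "l2_inner M (coordinate_product G m) (coordinate_product G' m')
      = (\<integral>x. (\<Prod>k\<in>UNIV. exp (- \<omega> (x $ k)) * (G k (m k) (x $ k) * G' k (m' k) (x $ k))) \<partial>lborel)"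
    unfolding l2_inner_def coordinate_product_def
    by (subst integral_M) (simp_all add: prod.distrib exp_sum sum_negf[symmetric])
  also have "\<dots> = (\<Prod>k\<in>UNIV. wint (\<lambda>t. G k (m k) t * G' k (m' k) t))"
    unfolding wint_def
    by (rule integral_coordinate_product) (intro wint_integrable bounded_supported_mult bs)
  finally show ?thesis .
qed

end

context sublinear_line
begin

text \<open>For the \<open>d\<close>-fold product of a bump \<open>G\<close>, each partial derivative replaces one factor \<open>\<integral>G\<^sup>2\<close>
  of the squared norm by \<open>\<integral>G'\<^sup>2\<close>, so the Rayleigh quotient is \<open>d / 2\<close> times that of \<open>G\<close>. The bumps
  are chosen one after the other with disjoint supports.\<close>

lemma low_energy_sequence:
  "\<exists>u. low_energy_weight (\<lambda>x :: real ^ 'n::finite. \<Sum>k\<in>UNIV. \<omega> (x $ k)) u"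
proof -
  let ?w = "\<lambda>x :: real ^ 'n. \<Sum>k\<in>UNIV. \<omega> (x $ k)"
  interpret W: locally_bounded_weight ?w by (rule locally_bounded_weight_sum) unfold_locales
  define good where "good n g \<longleftrightarrow> derivatives (fst g) \<and>
      (\<forall>n x. fst g n x \<noteq> 0 \<longrightarrow> fst (snd g) \<le> x \<and> x \<le> snd (snd g)) \<and> (\<forall>n. fst g n \<in> bounded_supported) \<and>
      wint (\<lambda>x. (fst g 1 x)\<^sup>2) \<le> 1 / real (Suc n) * wint (\<lambda>x. (fst g 0 x)\<^sup>2) \<and> 0 < wint (\<lambda>x. (fst g 0 x)\<^sup>2)"
    for n :: nat and g :: "(nat \<Rightarrow> real \<Rightarrow> real) \<times> real \<times> real"
  have ex: "\<exists>g. good n g \<and> R \<le> fst (snd g)" for n R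
  proof -
    have "1 / real (Suc n) > 0" by simp
    from low_energy_bump[OF this, of R] obtain G p q where
      "derivatives G \<and> R \<le> p \<and> (\<forall>n x. G n x \<noteq> 0 \<longrightarrow> p \<le> x \<and> x \<le> q) \<and> (\<forall>n. G n \<in> bounded_supported) \<and>
      wint (\<lambda>x. (G 1 x)\<^sup>2) \<le> 1 / real (Suc n) * wint (\<lambda>x. (G 0 x)\<^sup>2) \<and> 0 < wint (\<lambda>x. (G 0 x)\<^sup>2)"
      by (elim exE)
    then show ?thesis by (intro exI[of _ "(G, p, q)"]) (simp add: good_def)
  qed
  have "\<exists>g. \<forall>n. good n (g n) \<and> snd (snd (g n)) + 1 \<le> fst (snd (g (Suc n)))"
  proof (rule dependent_nat_choice)
    show "\<exists>g. good 0 g" using ex[of 0 0] by (elim exE conjE) (rule exI)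
    show "\<exists>g'. good (Suc n) g' \<and> snd (snd g) + 1 \<le> fst (snd g')" for g n by (rule ex)
  qed
  then obtain g where g_all: "\<forall>n. good n (g n) \<and> snd (snd (g n)) + 1 \<le> fst (snd (g (Suc n)))"
    by (elim exE)
  have g: "good n (g n)" "snd (snd (g n)) + 1 \<le> fst (snd (g (Suc n)))" for n
    using g_all by simp_all
  define G where "G n = fst (g n)" for n
  define p where "p n = fst (snd (g n))" for n
  define q where "q n = snd (snd (g n))" for n
  have G: "derivatives (G n)" "\<And>j x. G n j x \<noteq> 0 \<Longrightarrow> p n \<le> x \<and> x \<le> q n" "\<And>j. G n j \<in> bounded_supported"
    and G_energy: "wint (\<lambda>x. (G n 1 x)\<^sup>2) \<le> 1 / real (Suc n) * wint (\<lambda>x. (G n 0 x)\<^sup>2)"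
    and G_pos: "0 < wint (\<lambda>x. (G n 0 x)\<^sup>2)" for n
    using g(1)[of n] unfolding good_def G_def p_def q_def by simp_all
  have pq: "p n \<le> q n" for n
  proof (rule ccontr)
    assume "\<not> ?thesis"
    then have "G n 0 x = 0" for x using G(2)[of n 0 x] by linarith
    then show False using G_pos[of n] by (simp add: wint_def)
  qed
  have qp: "q n < p (Suc n)" for n using g(2)[of n] by (simp add: p_def q_def)
  have separated: "q n < p m" if "n < m" for n m
    using that
  proof (induction m)
    case (Suc m)
    then show ?case using qp[of n] qp[of m] pq[of m] by (cases "n = m") auto
  qed simp
  have disjoint: "G n 0 x * G m 0 x = 0" if "n \<noteq> m" for n m x
  proof (rule ccontr)
    assume "\<not> ?thesis"
    then have "p n \<le> x" "x \<le> q n" "p m \<le> x" "x \<le> q m" using G(2)[of n 0 x] G(2)[of m 0 x] by auto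
    then show False using separated[of n m] separated[of m n] that by (cases "n < m") auto
  qed
  define N where "N n = wint (\<lambda>x. (G n 0 x)\<^sup>2)" for n
  define d where "d = CARD('n)"
  have d: "d > 0" by (simp add: d_def)
  define U :: "nat \<Rightarrow> real ^ 'n \<Rightarrow> real" where "U n = coordinate_product (\<lambda>_. G n) (\<lambda>_. 0)" for n
  have U: "U n \<in> test_functions" for n
    unfolding U_def
    by (rule coordinate_product_test[where a = "\<chi> k. p n" and b = "\<chi> k. q n"]) (use G in auto)
  have UU: "l2_inner W.M (U m) (U n) = (if m = n then N n ^ d else 0)" for m n
  proof -
    have "l2_inner W.M (U m) (U n) = wint (\<lambda>t. G m 0 t * G n 0 t) ^ d"
      unfolding U_def by (subst l2_inner_coordinate_product) (simp_all add: G d_def)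
    then show ?thesis using disjoint[of m n] d
      by (cases "m = n") (simp_all add: N_def power2_eq_square wint_def zero_power)
  qed
  have energy_U: "pre_form ?w (U n) (U n) \<le> real d / 2 * (1 / real (Suc n)) * N n ^ d" for n
  proof -
    have "l2_inner W.M (partial_deriv j (U n)) (partial_deriv j (U n)) = wint (\<lambda>x. (G n 1 x)\<^sup>2) * N n ^ (d - 1)" for j
    proof -
      have "l2_inner W.M (partial_deriv j (U n)) (partial_deriv j (U n))
          = (\<Prod>k\<in>UNIV. wint (\<lambda>t. G n (((\<lambda>_. 0)(j := Suc 0)) k) t * G n (((\<lambda>_. 0)(j := Suc 0)) k) t))"
        unfolding U_def by (subst (1 2) coordinate_product_derivative(2)) (simp_all add: G l2_inner_coordinate_product)
      also have "\<dots> = wint (\<lambda>x. (G n 1 x)\<^sup>2) * (\<Prod>k\<in>UNIV - {j}. N n)"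
        by (subst prod.remove[of UNIV j]) (auto simp: N_def power2_eq_square intro!: prod.cong)
      also have "(\<Prod>k\<in>UNIV - {j}. N n) = N n ^ (d - 1)" by (simp add: d_def)
      finally show ?thesis .
    qed
    then have "pre_form ?w (U n) (U n) = real d / 2 * (wint (\<lambda>x. (G n 1 x)\<^sup>2) * N n ^ (d - 1))"
      using W.pre_form_eq[of "U n" "U n"] test_functions_C1c[OF U] by (simp add: d_def)
    also have "\<dots> \<le> real d / 2 * ((1 / real (Suc n) * N n) * N n ^ (d - 1))"
      using G_energy[of n] G_pos[of n] by (intro mult_left_mono mult_right_mono) (auto simp: N_def)
    also have "\<dots> = real d / 2 * (1 / real (Suc n)) * N n ^ d"
      using power_Suc[of "N n" "d - 1"] d by simp
    finally show ?thesis .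
  qed
  define c where "c n = 1 / sqrt (N n ^ d)" for n
  have Npos: "N n ^ d > 0" for n using G_pos by (simp add: N_def)
  have cN: "c n * (c n * N n ^ d) = 1" for n
    using Npos[of n] G_pos[of n] by (simp add: c_def N_def)
  define u where "u n = c n *\<^sub>R U n" for n
  have u: "u n \<in> test_functions" for n
    unfolding u_def using U W.form.scale_mem by blast
  have "low_energy_weight ?w u"
  proof unfold_locales
    show "u n \<in> test_functions" for n by (rule u)
    have Ul2: "U n \<in> l2 W.M" for n using U W.test_functions_l2 by blast
    show "l2_inner W.M (u m) (u n) = (if m = n then 1 else 0)" for m n
      using Ul2 cN[of n] by (simp add: u_def W.ip_scale W.ip_scale_right UU)
    have le: "pre_form ?w (u n) (u n) \<le> real d / 2 * (1 / real (Suc n))" for n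
    proof -
      have "pre_form ?w (u n) (u n) = c n * (c n * pre_form ?w (U n) (U n))"
        using U by (simp add: u_def W.form.ip_scale W.form.ip_scale_right)
      also have "\<dots> \<le> c n * (c n * (real d / 2 * (1 / real (Suc n)) * N n ^ d))"
        using energy_U Npos[of n] by (intro mult_left_mono) (auto simp: c_def)
      also have "\<dots> = real d / 2 * (1 / real (Suc n)) * (c n * (c n * N n ^ d))" by (simp only: mult_ac)
      finally show ?thesis by (simp only: cN mult_1_right)
    qed
    show "(\<lambda>n. pre_form ?w (u n) (u n)) \<longlonglongrightarrow> 0"
    proof (rule tendsto_sandwich[of "\<lambda>_. 0" _ sequentially "\<lambda>n. real d / 2 * (1 / real (Suc n))"])
      show "(\<lambda>n. real d / 2 * (1 / real (Suc n))) \<longlonglongrightarrow> 0"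
        using tendsto_mult[OF tendsto_const LIMSEQ_Suc[OF lim_1_over_n], of "real d / 2"] by simp
    qed (use le u W.form.ip_nonneg in \<open>auto intro!: always_eventually\<close>)
  qed
  then show ?thesis by (rule exI[of _ u])
qed

end

theorem theorem4p1:
  fixes Q :: "(real \<Rightarrow> real) measure" and \<alpha> :: real
  assumes "levy_environment Q \<alpha>"
    and "1 < \<alpha>" and "\<alpha> < 2"
    and "measure Q {w \<in> space Q. V_env 1 w < 0} > 0"
  shows "(AE w in Q. lambda_ess (W_env w :: real ^ 'n \<Rightarrow> real) = 0) \<and>
         (AE w in Q. \<forall>P. semigroup_generated_by (weighted_measure (W_env w :: real ^ 'n \<Rightarrow> real)) (dirichlet_generator (W_env w)) P \<longrightarrow>
            \<not> compact_semigroup (weighted_measure (W_env w :: real ^ 'n \<Rightarrow> real)) P)"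
proof -
  have space: "space Q \<subseteq> path_space"
    using assms(1) by (auto simp: levy_environment_def path_algebra_def space_restrict_space)
  have "semi_selfsimilar_levy Q V_plus \<alpha>" using assms(1) by (simp add: levy_environment_def)
  from sublinear_paths[OF this space assms(2)]
  have "AE w in Q. \<exists>u. low_energy_weight (W_env w :: real ^ 'n \<Rightarrow> real) u"
  proof (rule AE_mp, intro AE_I2 impI)
    fix w assume w: "w \<in> space Q"
      and sub: "\<forall>\<epsilon>>0. \<forall>N. \<exists>T\<ge>N. \<forall>x. 0 \<le> x \<and> x \<le> T \<longrightarrow> \<bar>w x\<bar> \<le> \<epsilon> * T"
    have path: "w \<in> path_space" using w space by blast
    interpret sublinear_line w
      by unfold_locales (use path_measurable[OF path] path_locally_bounded[OF path] sub in auto)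
    show "\<exists>u. low_energy_weight (W_env w :: real ^ 'n \<Rightarrow> real) u"
      using low_energy_sequence by (simp add: W_env_def[abs_def] V_env_eq)
  qed
  note low = this
  show ?thesis
  proof
    show "AE w in Q. lambda_ess (W_env w :: real ^ 'n \<Rightarrow> real) = 0"
      using low by eventually_elim (blast intro: low_energy_weight.lambda_ess_eq_0)
    show "AE w in Q. \<forall>P. semigroup_generated_by (weighted_measure (W_env w :: real ^ 'n \<Rightarrow> real)) (dirichlet_generator (W_env w)) P \<longrightarrow>
            \<not> compact_semigroup (weighted_measure (W_env w :: real ^ 'n \<Rightarrow> real)) P"
      using low by eventually_elim (blast dest: low_energy_weight.not_compact_semigroup)
  qed
qed

end
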